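(* The problems $\#\mathrm{Rank}\text{-}\mathrm{Bases}$ and $\#\mathrm{Nullity}\text{-}\mathrm{Bases}$ are $\mathsf{\#W[1]}$-hard, even when restricted to matroids representable over a field of characteristic $2$.
   Context: A matroid $M=(E,\mathcal{I})$ is a finite set $E$ with a nonempty, downward-closed family $\mathcal{I}$ of subsets (independent sets) satisfying the exchange property; bases are inclusion-maximal independent sets, the rank $\mathrm{rk}(M)$ is their common size and the nullity is $|E|-\mathrm{rk}(M)$. Matroids are assumed representable and are given as input by a representing matrix over a field $F$ (with a suitable encoding of $F$), i.e. a matrix whose columns are indexed by $E$ such that a set of columns is linearly independent iff the corresponding subset of $E$ is independent. $\#\mathrm{Rank}\text{-}\mathrm{Bases}$ (resp. $\#\mathrm{Nullity}\text{-}\mathrm{Bases}$) is the problem of counting the bases of the given matroid, parameterized by its rank (resp. nullity). $\mathsf{\#W[1]}$-hardness means there is an fpt Turing reduction from $\#k\text{-}\mathrm{Clique}$ (count $k$-cliques, parameterized by $k$): an oracle algorithm running in time $f(\kappa(x))|x|^c$ whose oracle queries have parameter bounded by a computable function of $\kappa(x)$. *)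

theory Defs
  imports
    "HOL-Algebra.Algebraic_Closure_Type"
    "HOL-Algebra.Polynomial_Divisibility"
    "HOL-Number_Theory.Residues"
    "HOL-Library.Log_Nat"
    "Jordan_Normal_Form.Matrix"
begin

section \<open>Computations with oracles\<close>

text \<open>
  The machine model is a WHILE language with finitely many registers. A register holds a binary
  tree with natural numbers at the leaves. Every evaluation step is charged the full (bit) size of
  the value it produces, so that every value read or computed has size at most the cost of the run.
  As all primitive operations are computable in polynomial time, the model is polynomially
  equivalent to Turing machines (with oracles) and to the RAM with logarithmic costs; in particular the
  computable functions and fixed-parameter tractability are the usual ones.
\<close>

datatype val = Num nat | Cell val val

fun val_size :: "val \<Rightarrow> nat" where
  "val_size (Num n) = 1 + floorlog 2 n"
| "val_size (Cell a b) = 1 + val_size a + val_size b"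

fun num_of :: "val \<Rightarrow> nat" where
  "num_of (Num n) = n"
| "num_of (Cell a b) = 0"

fun left_of :: "val \<Rightarrow> val" where
  "left_of (Cell a b) = a"
| "left_of (Num n) = Num 0"

fun right_of :: "val \<Rightarrow> val" where
  "right_of (Cell a b) = b"
| "right_of (Num n) = Num 0"

fun is_cell :: "val \<Rightarrow> bool" where
  "is_cell (Cell a b) = True"
| "is_cell (Num n) = False"

type_synonym state = "nat \<Rightarrow> val"

datatype expr =
    Reg nat
  | Const nat
  | MkCell expr expr
  | LeftOf expr
  | RightOf expr
  | IsCell expr
  | Equal expr expr
  | Less expr expr
  | Plus expr expr
  | Minus expr expr
  | Times expr expr
  | IntDiv expr expr

fun expr_val :: "expr \<Rightarrow> state \<Rightarrow> val" where
  "expr_val (Reg x) s = s x"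
| "expr_val (Const n) s = Num n"
| "expr_val (MkCell a b) s = Cell (expr_val a s) (expr_val b s)"
| "expr_val (LeftOf a) s = left_of (expr_val a s)"
| "expr_val (RightOf a) s = right_of (expr_val a s)"
| "expr_val (IsCell a) s = Num (of_bool (is_cell (expr_val a s)))"
| "expr_val (Equal a b) s = Num (of_bool (expr_val a s = expr_val b s))"
| "expr_val (Less a b) s = Num (of_bool (num_of (expr_val a s) < num_of (expr_val b s)))"
| "expr_val (Plus a b) s = Num (num_of (expr_val a s) + num_of (expr_val b s))"
| "expr_val (Minus a b) s = Num (num_of (expr_val a s) - num_of (expr_val b s))"
| "expr_val (Times a b) s = Num (num_of (expr_val a s) * num_of (expr_val b s))"
| "expr_val (IntDiv a b) s = Num (num_of (expr_val a s) div num_of (expr_val b s))"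

fun subexprs :: "expr \<Rightarrow> expr list" where
  "subexprs (Reg x) = []"
| "subexprs (Const n) = []"
| "subexprs (MkCell a b) = [a, b]"
| "subexprs (LeftOf a) = [a]"
| "subexprs (RightOf a) = [a]"
| "subexprs (IsCell a) = [a]"
| "subexprs (Equal a b) = [a, b]"
| "subexprs (Less a b) = [a, b]"
| "subexprs (Plus a b) = [a, b]"
| "subexprs (Minus a b) = [a, b]"
| "subexprs (Times a b) = [a, b]"
| "subexprs (IntDiv a b) = [a, b]"

lemma subexprs_size [termination_simp]: "a \<in> set (subexprs e) \<Longrightarrow> size a < size e"
  by (cases e) auto

fun expr_cost :: "expr \<Rightarrow> state \<Rightarrow> nat" where
  "expr_cost e s = val_size (expr_val e s) + (\<Sum>a\<leftarrow>subexprs e. expr_cost a s)"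

declare expr_cost.simps [simp del]

datatype com =
    Assign nat expr
  | Query nat expr
  | Seq com com
  | Cond expr com com
  | While expr com

text \<open>
  \<open>exec orc c s t Q s'\<close>: started in \<open>s\<close> and with queries \<open>q\<close> answered by \<open>orc q\<close>, the program \<open>c\<close> halts in \<open>s'\<close> at
  cost \<open>t\<close> and its sequence of queries is \<open>Q\<close>. The value \<open>Num 0\<close> counts as false, all
  others as true.
\<close>

inductive exec :: "(val \<Rightarrow> nat) \<Rightarrow> com \<Rightarrow> state \<Rightarrow> nat \<Rightarrow> val list \<Rightarrow> state \<Rightarrow> bool"
  for orc :: "val \<Rightarrow> nat" where
  Assign: "exec orc (Assign x e) s (1 + expr_cost e s) [] (s(x := expr_val e s))"
| Query: "q = expr_val e s \<Longrightarrow> a = Num (orc q) \<Longrightarrow>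
    exec orc (Query x e) s (1 + expr_cost e s + val_size a) [q] (s(x := a))"
| Seq: "exec orc c s t Q s' \<Longrightarrow> exec orc d s' t' Q' s'' \<Longrightarrow>
    exec orc (Seq c d) s (1 + t + t') (Q @ Q') s''"
| CondTrue: "expr_val b s \<noteq> Num 0 \<Longrightarrow> exec orc c s t Q s' \<Longrightarrow>
    exec orc (Cond b c d) s (1 + expr_cost b s + t) Q s'"
| CondFalse: "expr_val b s = Num 0 \<Longrightarrow> exec orc d s t Q s' \<Longrightarrow>
    exec orc (Cond b c d) s (1 + expr_cost b s + t) Q s'"
| WhileTrue: "expr_val b s \<noteq> Num 0 \<Longrightarrow> exec orc c s t Q s' \<Longrightarrow> exec orc (While b c) s' t' Q' s'' \<Longrightarrow>
    exec orc (While b c) s (1 + expr_cost b s + t + t') (Q @ Q') s''"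
| WhileFalse: "expr_val b s = Num 0 \<Longrightarrow>
    exec orc (While b c) s (1 + expr_cost b s) [] s"

definition init_state :: "val \<Rightarrow> state" where
  "init_state v = (\<lambda>x. if x = 0 then v else Num 0)"

text \<open>Input and output are in register 0.\<close>

definition computes_in :: "(val \<Rightarrow> nat) \<Rightarrow> com \<Rightarrow> val \<Rightarrow> nat \<Rightarrow> nat \<Rightarrow> val list \<Rightarrow> bool" where
  "computes_in orc c v r t Q \<longleftrightarrow> (\<exists>s'. exec orc c (init_state v) t Q s' \<and> s' 0 = Num r)"

definition computable :: "(nat \<Rightarrow> nat) \<Rightarrow> bool" where
  "computable f \<longleftrightarrow> (\<exists>c. \<forall>n. \<exists>t. computes_in (\<lambda>_. 0) c (Num n) (f n) t [])"


section \<open>Parameterized counting problems and fpt Turing reductions\<close>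

record 'i counting_problem =
  instances :: "'i set"
  encode :: "'i \<Rightarrow> val"
  solution :: "'i \<Rightarrow> nat"
  parameter :: "'i \<Rightarrow> nat"

text \<open>Answers are only meaningful on encodings of instances; reductions may query nothing else.\<close>

definition oracle_for :: "'i counting_problem \<Rightarrow> val \<Rightarrow> nat" where
  "oracle_for P q = solution P (the_inv_into (instances P) (encode P) q)"

definition fpt_turing_reduction ::
  "com \<Rightarrow> 'i counting_problem \<Rightarrow> 'j counting_problem \<Rightarrow> bool" where
  "fpt_turing_reduction A P P' \<longleftrightarrow>
    (\<exists>f g c. computable f \<and> computable g \<and>
      (\<forall>i\<in>instances P. \<exists>t Q.
        computes_in (oracle_for P') A (encode P i) (solution P i) t Q \<and>
        t \<le> f (parameter P i) * val_size (encode P i) ^ c \<and>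
        (\<forall>q\<in>set Q. \<exists>j\<in>instances P'. q = encode P' j \<and> parameter P' j \<le> g (parameter P i))))"

definition restrict_to :: "'i counting_problem \<Rightarrow> 'i set \<Rightarrow> 'i counting_problem" where
  "restrict_to P S = P\<lparr>instances := instances P \<inter> S\<rparr>"


section \<open>Encodings\<close>

fun enc_list :: "('a \<Rightarrow> val) \<Rightarrow> 'a list \<Rightarrow> val" where
  "enc_list e [] = Num 0"
| "enc_list e (x # xs) = Cell (e x) (enc_list e xs)"

definition enc_int :: "int \<Rightarrow> val" where
  "enc_int i = Cell (Num (of_bool (i < 0))) (Num (nat \<bar>i\<bar>))"

definition enc_rat :: "rat \<Rightarrow> val" where
  "enc_rat r = (case quotient_of r of (a, b) \<Rightarrow> Cell (enc_int a) (enc_int b))"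

definition enc_mat :: "('a \<Rightarrow> val) \<Rightarrow> 'a mat \<Rightarrow> val" where
  "enc_mat e A = Cell (Num (dim_row A)) (enc_list (enc_list e) (map list_of_vec (cols A)))"

lemma enc_list_inj:
  assumes "inj e"
  shows "inj (enc_list e)"
proof (rule injI)
  fix xs ys
  assume "enc_list e xs = enc_list e ys"
  then show "xs = ys"
  proof (induction xs arbitrary: ys)
    case Nil
    then show ?case by (cases ys) auto
  next
    case (Cons x xs)
    then show ?case by (cases ys) (auto simp: inj_eq[OF assms])
  qed
qed

lemma enc_int_inj: "inj enc_int"
  by (rule injI) (auto simp: enc_int_def of_bool_def split: if_splits)

lemma enc_rat_inj: "inj enc_rat"
proof (rule injI)
  fix r r' :: rat
  assume eq: "enc_rat r = enc_rat r'"
  obtain a b where r: "quotient_of r = (a, b)"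
    by fastforce
  obtain a' b' where r': "quotient_of r' = (a', b')"
    by fastforce
  have "enc_int a = enc_int a'" "enc_int b = enc_int b'"
    using eq by (simp_all add: enc_rat_def r r')
  then have "a = a'" "b = b'"
    using injD[OF enc_int_inj] by blast+
  then show "r = r'"
    by (simp add: quotient_of_inject_eq[symmetric] r r')
qed

lemma enc_mat_inj:
  fixes e :: "'a \<Rightarrow> val"
  assumes "inj e"
  shows "inj (enc_mat e)"
proof (rule injI)
  fix A B :: "'a mat"
  assume "enc_mat e A = enc_mat e B"
  then have rows: "dim_row A = dim_row B"
    and eq: "map list_of_vec (cols A) = map list_of_vec (cols B)"
    by (simp_all add: enc_mat_def inj_eq[OF enc_list_inj[OF enc_list_inj[OF assms]]])
  have "inj (list_of_vec :: 'a vec \<Rightarrow> 'a list)"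
    by (rule inj_on_inverseI[where g = vec_of_list]) (rule vec_list)
  then have "cols A = cols B"
    using eq by (simp add: inj_map_eq_map)
  then have "mat_of_cols (dim_row A) (cols A) = mat_of_cols (dim_row B) (cols B)"
    using rows by simp
  then show "A = B"
    by simp
qed


section \<open>Counting cliques\<close>

text \<open>The pair \<open>(n, E)\<close> is the graph with vertices \<open>0, \<dots>, n - 1\<close> and edge set \<open>E\<close>.\<close>

type_synonym graph = "nat \<times> nat set set"

definition simple_graph :: "graph \<Rightarrow> bool" where
  "simple_graph G \<longleftrightarrow> (\<forall>e\<in>snd G. \<exists>u v. u < fst G \<and> v < fst G \<and> u \<noteq> v \<and> e = {u, v})"

definition cliques :: "graph \<Rightarrow> nat \<Rightarrow> nat set set" where
  "cliques G k =
    {S. S \<subseteq> {..<fst G} \<and> card S = k \<and> (\<forall>u\<in>S. \<forall>v\<in>S. u \<noteq> v \<longrightarrow> {u, v} \<in> snd G)}"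

definition enc_graph :: "graph \<Rightarrow> val" where
  "enc_graph G = enc_list (enc_list (\<lambda>b. Num (of_bool b)))
    (map (\<lambda>u. map (\<lambda>v. {u, v} \<in> snd G) [0..<fst G]) [0..<fst G])"

definition clique_problem :: "(graph \<times> nat) counting_problem" where
  "clique_problem =
    \<lparr>instances = {(G, k). simple_graph G},
     encode = (\<lambda>(G, k). Cell (enc_graph G) (Num k)),
     solution = (\<lambda>(G, k). card (cliques G k)),
     parameter = (\<lambda>(G, k). k)\<rparr>"

lemma inj_on_encode_clique_problem: "inj_on (encode clique_problem) (instances clique_problem)"
proof -
  have "G = H" if G: "simple_graph G" and H: "simple_graph H" and eq: "enc_graph G = enc_graph H"
    for G H
  proof -
    have "inj (\<lambda>b::bool. Num (of_bool b))"
      by (rule injI) (simp add: of_bool_eq_iff)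
    note inj = enc_list_inj[OF enc_list_inj[OF this]]
    have mats: "map (\<lambda>u. map (\<lambda>v. {u, v} \<in> snd G) [0..<fst G]) [0..<fst G] =
        map (\<lambda>u. map (\<lambda>v. {u, v} \<in> snd H) [0..<fst H]) [0..<fst H]" (is "?A = ?B")
      by (rule injD[OF inj]) (rule eq[unfolded enc_graph_def])
    have "length ?A = length ?B"
      using mats by (rule arg_cong)
    then have n: "fst G = fst H"
      by simp
    have adj: "{u, v} \<in> snd G \<longleftrightarrow> {u, v} \<in> snd H" if "u < fst G" "v < fst G" for u v
    proof -
      have "?A ! u ! v = ?B ! u ! v"
        using mats by simp
      then show ?thesis
        using that n by simp
    qed
    have "snd G \<subseteq> snd H"
    proof
      fix e
      assume e: "e \<in> snd G"
      then obtain u v where "u < fst G" "v < fst G" "e = {u, v}"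
        using G unfolding simple_graph_def by metis
      then show "e \<in> snd H"
        using e adj by simp
    qed
    moreover have "snd H \<subseteq> snd G"
    proof
      fix e
      assume e: "e \<in> snd H"
      then obtain u v where "u < fst H" "v < fst H" "e = {u, v}"
        using H unfolding simple_graph_def by metis
      then show "e \<in> snd G"
        using e adj n by simp
    qed
    ultimately have "snd G = snd H"
      by (rule subset_antisym)
    then show ?thesis
      using n by (simp add: prod_eq_iff)
  qed
  then show ?thesis
    by (auto simp: inj_on_def clique_problem_def)
qed

definition sharp_W1_hard :: "'i counting_problem \<Rightarrow> bool" where
  "sharp_W1_hard P \<longleftrightarrow> (\<exists>A. fpt_turing_reduction A clique_problem P)"


section \<open>Matroids\<close>

definition matroid :: "'a set \<Rightarrow> 'a set set \<Rightarrow> bool" where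
  "matroid E I \<longleftrightarrow> finite E \<and> I \<subseteq> Pow E \<and> I \<noteq> {} \<and>
    (\<forall>S\<in>I. \<forall>S'. S' \<subseteq> S \<longrightarrow> S' \<in> I) \<and>
    (\<forall>S\<in>I. \<forall>T\<in>I. card S < card T \<longrightarrow> (\<exists>t\<in>T - S. insert t S \<in> I))"

definition bases :: "'a set set \<Rightarrow> 'a set set" where
  "bases I = {B \<in> I. \<forall>S\<in>I. B \<subseteq> S \<longrightarrow> S = B}"

definition matroid_rank :: "'a set set \<Rightarrow> nat" where
  "matroid_rank I = (THE r. \<forall>B\<in>bases I. card B = r)"

definition matroid_nullity :: "'a set \<Rightarrow> 'a set set \<Rightarrow> nat" where
  "matroid_nullity E I = card E - matroid_rank I"

lemma matroid_ex_basis: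
  assumes "matroid E I"
  shows "bases I \<noteq> {}"
proof -
  have "finite E" "I \<subseteq> Pow E" and I: "I \<noteq> {}"
    using assms by (simp_all add: matroid_def)
  then have "finite I"
    using finite_subset[of I "Pow E"] by simp
  from finite_has_maximal[OF this I] show ?thesis
    unfolding bases_def by blast
qed

lemma matroid_card_basis:
  assumes "matroid E I" "B \<in> bases I"
  shows "card B = matroid_rank I"
proof -
  have le: "card C \<le> card D" if "C \<in> bases I" "D \<in> bases I" for C D
  proof (rule ccontr)
    assume "\<not> card C \<le> card D"
    then have "card D < card C"
      by simp
    moreover have "C \<in> I" "D \<in> I"
      using that by (simp_all add: bases_def)
    moreover have "\<forall>S\<in>I. \<forall>T\<in>I. card S < card T \<longrightarrow> (\<exists>t\<in>T - S. insert t S \<in> I)"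
      using assms(1)[unfolded matroid_def, THEN conjunct2, THEN conjunct2, THEN conjunct2]
      by (rule conjunct2)
    ultimately obtain t where "t \<in> C - D" "insert t D \<in> I"
      by blast
    then show False
      using that(2) unfolding bases_def by blast
  qed
  have eq: "card C = card B" if "C \<in> bases I" for C
    by (rule le_antisym) (rule le; rule that assms(2))+
  have "matroid_rank I = card B"
    unfolding matroid_rank_def
  proof (rule the_equality)
    show "\<forall>C\<in>bases I. card C = card B"
      using eq by (rule ballI)
  next
    fix r
    assume "\<forall>C\<in>bases I. card C = r"
    then show "r = card B"
      using assms(2) by simp
  qed
  then show ?thesis ..
qed

definition indep_columns :: "('a, 'b) ring_scheme \<Rightarrow> 'a mat \<Rightarrow> nat set \<Rightarrow> bool" where
  "indep_columns R M S \<longleftrightarrow>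
    (\<forall>c \<in> S \<rightarrow> carrier R.
      (\<forall>i<dim_row M. (\<Oplus>\<^bsub>R\<^esub>j\<in>S. c j \<otimes>\<^bsub>R\<^esub> M $$ (i, j)) = \<zero>\<^bsub>R\<^esub>) \<longrightarrow> (\<forall>j\<in>S. c j = \<zero>\<^bsub>R\<^esub>))"

definition column_matroid :: "('a, 'b) ring_scheme \<Rightarrow> 'a mat \<Rightarrow> nat set set" where
  "column_matroid R M = {S. S \<subseteq> {..<dim_col M} \<and> indep_columns R M S}"

lemma (in Ring.field) homogeneous_solution:
  assumes "finite K" "finite T" "card K < card T"
    and "\<And>i t. i \<in> K \<Longrightarrow> t \<in> T \<Longrightarrow> a i t \<in> carrier R"
  shows "\<exists>c\<in>T \<rightarrow> carrier R. (\<exists>t\<in>T. c t \<noteq> \<zero>) \<and> (\<forall>i\<in>K. (\<Oplus>t\<in>T. c t \<otimes> a i t) = \<zero>)"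
  using assms
proof (induction K arbitrary: T a rule: finite_induct)
  case empty
  then obtain t where "t \<in> T"
    by fastforce
  then show ?case
    by (intro bexI[where x = "\<lambda>_. \<one>"]) auto
next
  case (insert k K)
  have less: "card K < card T"
    using insert.hyps insert.prems by simp
  show ?case
  proof (cases "\<forall>t\<in>T. a k t = \<zero>")
    case True
    obtain c where c: "c \<in> T \<rightarrow> carrier R" "\<exists>t\<in>T. c t \<noteq> \<zero>"
      "\<forall>i\<in>K. (\<Oplus>t\<in>T. c t \<otimes> a i t) = \<zero>"
      using insert.IH[of T a] insert.prems less by auto
    have "(\<Oplus>t\<in>T. c t \<otimes> a k t) = (\<Oplus>t\<in>T. \<zero>)"
      using c(1) True by (intro finsum_cong') (auto simp: Pi_iff)
    then have "(\<Oplus>t\<in>T. c t \<otimes> a k t) = \<zero>"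
      by simp
    then show ?thesis
      using c by (intro bexI[where x = c]) auto
  next
    case False
    then obtain t0 where t0: "t0 \<in> T" "a k t0 \<noteq> \<zero>"
      by blast
    define T' where "T' = T - {t0}"
    have T: "T = insert t0 T'" "t0 \<notin> T'" "finite T'"
      using t0 insert.prems(1) by (auto simp: T'_def)
    have aK: "a i t \<in> carrier R" if "i \<in> insert k K" "t \<in> T" for i t
      using insert.prems(3) that by blast
    define q where "q = inv (a k t0)"
    have akt0: "a k t0 \<in> carrier R"
      using aK t0 by simp
    have q: "q \<in> carrier R" "a k t0 \<otimes> q = \<one>"
      using akt0 t0(2) field_Units unfolding q_def by auto
    define a' where "a' = (\<lambda>i t. a i t \<ominus> a i t0 \<otimes> q \<otimes> a k t)"
    have cl: "a i t \<in> carrier R" "a k t \<in> carrier R" "a i t0 \<in> carrier R" "a k t0 \<in> carrier R"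
      if "i \<in> K" "t \<in> T'" for i t
      using aK that T(1) by simp_all
    obtain c where c: "c \<in> T' \<rightarrow> carrier R" "\<exists>t\<in>T'. c t \<noteq> \<zero>"
      "\<forall>i\<in>K. (\<Oplus>t\<in>T'. c t \<otimes> a' i t) = \<zero>"
    proof -
      have "card K < card T'"
        using insert.hyps insert.prems(2) T by simp
      moreover have "a' i t \<in> carrier R" if "i \<in> K" "t \<in> T'" for i t
        using cl[OF that] q unfolding a'_def by simp
      ultimately show thesis
        using insert.IH[of T' a'] T(3) that by blast
    qed
    have ct: "c t \<in> carrier R" if "t \<in> T'" for t
      using c(1) that by blast
    define s where "s = (\<Oplus>t\<in>T'. c t \<otimes> a k t)"
    have akt: "a k t \<in> carrier R" if "t \<in> T'" for t
      using aK that T(1) by simp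
    have s: "s \<in> carrier R"
      unfolding s_def using ct akt by (intro finsum_closed) auto
    define d where "d = c(t0 := \<ominus> (q \<otimes> s))"
    have d: "d \<in> T \<rightarrow> carrier R"
      unfolding d_def using T ct s q by auto
    have sum: "(\<Oplus>t\<in>T. d t \<otimes> a i t) = \<ominus> (q \<otimes> s) \<otimes> a i t0 \<oplus> (\<Oplus>t\<in>T'. c t \<otimes> a i t)"
      if "i \<in> insert k K" for i
    proof -
      have cli: "a i t \<in> carrier R" if "t \<in> T" for t
        using aK that \<open>i \<in> insert k K\<close> by blast
      have "(\<Oplus>t\<in>T. d t \<otimes> a i t) = d t0 \<otimes> a i t0 \<oplus> (\<Oplus>t\<in>T'. d t \<otimes> a i t)"
        unfolding T(1) using T d cli by (intro finsum_insert) auto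
      also have "(\<Oplus>t\<in>T'. d t \<otimes> a i t) = (\<Oplus>t\<in>T'. c t \<otimes> a i t)"
        using T ct cli by (intro finsum_cong') (auto simp: d_def)
      finally show ?thesis
        by (simp add: d_def)
    qed
    have "(\<Oplus>t\<in>T. d t \<otimes> a k t) = \<zero>"
    proof -
      have "\<ominus> (q \<otimes> s) \<otimes> a k t0 = \<ominus> (a k t0 \<otimes> q \<otimes> s)"
        using q(1) s akt0 by algebra
      also have "\<dots> = \<ominus> s"
        using q s by simp
      finally show ?thesis
        using sum[of k] s by (simp add: s_def[symmetric] l_neg)
    qed
    moreover have "(\<Oplus>t\<in>T. d t \<otimes> a i t) = \<zero>" if i: "i \<in> K" for i
    proof -
      define r where "r = (\<Oplus>t\<in>T'. c t \<otimes> a i t)"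
      have ait: "a i t \<in> carrier R" if "t \<in> T'" for t
        using cl i that by blast
      have ait0: "a i t0 \<in> carrier R"
        using aK i t0 by simp
      have r: "r \<in> carrier R"
        unfolding r_def using ct ait by (intro finsum_closed) auto
      have "\<zero> = (\<Oplus>t\<in>T'. c t \<otimes> a' i t)"
        using c(3) i by simp
      also have "\<dots> = (\<Oplus>t\<in>T'. c t \<otimes> a i t \<oplus> (\<ominus> (a i t0 \<otimes> q)) \<otimes> (c t \<otimes> a k t))"
      proof (rule finsum_cong')
        fix t
        assume t: "t \<in> T'"
        show "c t \<otimes> a' i t = c t \<otimes> a i t \<oplus> (\<ominus> (a i t0 \<otimes> q)) \<otimes> (c t \<otimes> a k t)"
          unfolding a'_def using ct[OF t] ait[OF t] akt[OF t] ait0 q(1) by algebra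
      qed (use ct ait akt ait0 q in auto)
      also have "\<dots> = r \<oplus> (\<Oplus>t\<in>T'. (\<ominus> (a i t0 \<otimes> q)) \<otimes> (c t \<otimes> a k t))"
        unfolding r_def using ct ait akt ait0 q by (intro finsum_addf) auto
      also have "(\<Oplus>t\<in>T'. (\<ominus> (a i t0 \<otimes> q)) \<otimes> (c t \<otimes> a k t)) = (\<ominus> (a i t0 \<otimes> q)) \<otimes> s"
        unfolding s_def using ct akt ait0 q T(3) by (intro finsum_rdistr[symmetric]) auto
      finally have "r \<oplus> (\<ominus> (a i t0 \<otimes> q)) \<otimes> s = \<zero>" ..
      moreover have "\<ominus> (q \<otimes> s) \<otimes> a i t0 \<oplus> r = r \<oplus> (\<ominus> (a i t0 \<otimes> q)) \<otimes> s"
        using r s q(1) ait0 by algebra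
      ultimately show ?thesis
        using sum[of i] i by (simp add: r_def)
    qed
    moreover have "\<exists>t\<in>T. d t \<noteq> \<zero>"
      using c(2) T unfolding d_def by auto
    ultimately show ?thesis
      using d by auto
  qed
qed

lemma (in Ring.field) indep_columns_subset:
  assumes "indep_columns R M S" "S' \<subseteq> S" "S \<subseteq> {..<dim_col M}"
    and M: "\<And>i j. i < dim_row M \<Longrightarrow> j < dim_col M \<Longrightarrow> M $$ (i, j) \<in> carrier R"
  shows "indep_columns R M S'"
  unfolding indep_columns_def
proof (intro ballI impI)
  fix c j
  assume c: "c \<in> S' \<rightarrow> carrier R" and j: "j \<in> S'"
    and eqs: "\<forall>i<dim_row M. (\<Oplus>j\<in>S'. c j \<otimes> M $$ (i, j)) = \<zero>"
  define d where "d = (\<lambda>j. if j \<in> S' then c j else \<zero>)"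
  have fin: "finite S"
    using assms(3) finite_subset by blast
  have d: "d \<in> S \<rightarrow> carrier R"
    using c by (auto simp: d_def)
  have "(\<Oplus>j\<in>S. d j \<otimes> M $$ (i, j)) = \<zero>" if i: "i < dim_row M" for i
  proof -
    have Mi: "M $$ (i, j) \<in> carrier R" if "j \<in> S" for j
      using M i assms(3) that by blast
    have "(\<Oplus>j\<in>S'. c j \<otimes> M $$ (i, j)) = (\<Oplus>j\<in>S. d j \<otimes> M $$ (i, j))"
      using fin assms(2) Mi d by (intro add.finprod_mono_neutral_cong_left) (auto simp: d_def)
    then show ?thesis
      using eqs i by simp
  qed
  then have "\<forall>j\<in>S. d j = \<zero>"
    using assms(1) d unfolding indep_columns_def by blast
  then have "d j = \<zero>"
    using j assms(2) by blast
  then show "c j = \<zero>"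
    using j by (simp add: d_def)
qed

lemma (in Ring.field) dependent_column:
  assumes indep: "indep_columns R M S" and S: "S \<subseteq> {..<dim_col M}" and t: "t < dim_col M" "t \<notin> S"
    and dep: "\<not> indep_columns R M (insert t S)"
    and M: "\<And>i j. i < dim_row M \<Longrightarrow> j < dim_col M \<Longrightarrow> M $$ (i, j) \<in> carrier R"
  shows "\<exists>b\<in>S \<rightarrow> carrier R. \<forall>i<dim_row M. M $$ (i, t) = (\<Oplus>s\<in>S. b s \<otimes> M $$ (i, s))"
proof -
  have fin: "finite S"
    using S finite_subset by blast
  obtain c where c: "c \<in> insert t S \<rightarrow> carrier R" "\<exists>j\<in>insert t S. c j \<noteq> \<zero>"
    and eqs: "\<forall>i<dim_row M. (\<Oplus>j\<in>insert t S. c j \<otimes> M $$ (i, j)) = \<zero>"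
    using dep unfolding indep_columns_def by blast
  have ct: "c t \<in> carrier R" and cs: "c s \<in> carrier R" if "s \<in> S" for s
    using c(1) that by auto
  have ct: "c t \<in> carrier R"
    using c(1) by blast
  have Mt: "M $$ (i, t) \<in> carrier R" and Ms: "\<And>s. s \<in> S \<Longrightarrow> M $$ (i, s) \<in> carrier R"
    if "i < dim_row M" for i
    using M that t(1) S by auto
  have split: "c t \<otimes> M $$ (i, t) \<oplus> (\<Oplus>s\<in>S. c s \<otimes> M $$ (i, s)) = \<zero>" if i: "i < dim_row M" for i
  proof -
    have "(\<Oplus>j\<in>insert t S. c j \<otimes> M $$ (i, j)) = c t \<otimes> M $$ (i, t) \<oplus> (\<Oplus>s\<in>S. c s \<otimes> M $$ (i, s))"
      using fin t(2) cs ct Mt[OF i] Ms[OF i] by (intro finsum_insert) auto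
    then show ?thesis
      using eqs i by simp
  qed
  have "c t \<noteq> \<zero>"
  proof
    assume 0: "c t = \<zero>"
    have "(\<Oplus>s\<in>S. c s \<otimes> M $$ (i, s)) = \<zero>" if i: "i < dim_row M" for i
    proof -
      have "(\<Oplus>s\<in>S. c s \<otimes> M $$ (i, s)) \<in> carrier R"
        using cs Ms[OF i] by (intro finsum_closed) auto
      then show ?thesis
        using split[OF i] 0 Mt[OF i] by simp
    qed
    moreover have "c \<in> S \<rightarrow> carrier R"
      using cs by auto
    ultimately have "\<forall>s\<in>S. c s = \<zero>"
      using indep unfolding indep_columns_def by blast
    then show False
      using c(2) 0 by blast
  qed
  define q where "q = inv (c t)"
  have q: "q \<in> carrier R" "q \<otimes> c t = \<one>"
    using ct \<open>c t \<noteq> \<zero>\<close> field_Units unfolding q_def by auto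
  define b where "b = (\<lambda>s. \<ominus> q \<otimes> c s)"
  have "M $$ (i, t) = (\<Oplus>s\<in>S. b s \<otimes> M $$ (i, s))" if i: "i < dim_row M" for i
  proof -
    define r where "r = (\<Oplus>s\<in>S. c s \<otimes> M $$ (i, s))"
    have r: "r \<in> carrier R"
      unfolding r_def using cs Ms[OF i] by (intro finsum_closed) auto
    have "(\<Oplus>s\<in>S. b s \<otimes> M $$ (i, s)) = (\<Oplus>s\<in>S. \<ominus> q \<otimes> (c s \<otimes> M $$ (i, s)))"
      using cs Ms[OF i] q(1) by (intro finsum_cong') (auto simp: b_def m_assoc)
    also have "\<dots> = \<ominus> q \<otimes> r"
      unfolding r_def using cs Ms[OF i] q(1) fin by (intro finsum_rdistr[symmetric]) auto
    also have "\<dots> = \<ominus> q \<otimes> (c t \<otimes> M $$ (i, t) \<oplus> r) \<oplus> q \<otimes> c t \<otimes> M $$ (i, t)"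
      using q(1) ct Mt[OF i] r by algebra
    also have "\<dots> = M $$ (i, t)"
      using split[OF i] q Mt[OF i] by (simp add: r_def[symmetric])
    finally show ?thesis ..
  qed
  moreover have "b \<in> S \<rightarrow> carrier R"
    using q(1) cs by (auto simp: b_def)
  ultimately show ?thesis
    by blast
qed

lemma (in Ring.field) matroid_column_matroid:
  assumes M: "\<And>i j. i < dim_row M \<Longrightarrow> j < dim_col M \<Longrightarrow> M $$ (i, j) \<in> carrier R"
  shows "matroid {..<dim_col M} (column_matroid R M)"
proof -
  have "indep_columns R M {}"
    by (simp add: indep_columns_def)
  then have ne: "column_matroid R M \<noteq> {}"
    by (auto simp: column_matroid_def)
  have down: "S' \<in> column_matroid R M" if "S \<in> column_matroid R M" "S' \<subseteq> S" for S S'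
    using that indep_columns_subset[OF _ _ _ M, of S S'] by (auto simp: column_matroid_def)
  have exch: "\<exists>t\<in>T - S. insert t S \<in> column_matroid R M"
    if S': "S \<in> column_matroid R M" and T': "T \<in> column_matroid R M" and card: "card S < card T" for S T
  proof (rule ccontr)
    assume no: "\<not> (\<exists>t\<in>T - S. insert t S \<in> column_matroid R M)"
    have S: "S \<subseteq> {..<dim_col M}" "indep_columns R M S" "finite S"
      and T: "T \<subseteq> {..<dim_col M}" "indep_columns R M T" "finite T"
      using S' T' finite_subset by (auto simp: column_matroid_def)
    have "\<exists>b\<in>S \<rightarrow> carrier R. \<forall>i<dim_row M. M $$ (i, t) = (\<Oplus>s\<in>S. b s \<otimes> M $$ (i, s))" if t: "t \<in> T" for t
    proof (cases "t \<in> S")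
      case True
      define b where "b = (\<lambda>s. if s = t then \<one> else \<zero>)"
      have "M $$ (i, t) = (\<Oplus>s\<in>S. b s \<otimes> M $$ (i, s))" if i: "i < dim_row M" for i
      proof -
        have Ms: "M $$ (i, s) \<in> carrier R" if "s \<in> S" for s
          using M i S(1) that by blast
        have "(\<Oplus>s\<in>S. b s \<otimes> M $$ (i, s)) = (\<Oplus>s\<in>S. if t = s then M $$ (i, s) else \<zero>)"
          using Ms by (intro finsum_cong') (auto simp: b_def)
        also have "\<dots> = M $$ (i, t)"
          using True S(3) Ms by (intro finsum_singleton) auto
        finally show ?thesis ..
      qed
      moreover have "b \<in> S \<rightarrow> carrier R"
        by (auto simp: b_def)
      ultimately show ?thesis
        by blast
    next
      case False
      have "t < dim_col M"
        using t T(1) by blast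
      moreover have "\<not> indep_columns R M (insert t S)"
        using no t False S(1) \<open>t < dim_col M\<close> by (auto simp: column_matroid_def)
      ultimately show ?thesis
        using dependent_column[OF S(2,1) _ False _ M] by blast
    qed
    then obtain b where b: "\<And>t. t \<in> T \<Longrightarrow> b t \<in> S \<rightarrow> carrier R"
      and bM: "\<And>t i. t \<in> T \<Longrightarrow> i < dim_row M \<Longrightarrow> M $$ (i, t) = (\<Oplus>s\<in>S. b t s \<otimes> M $$ (i, s))"
      by metis
    have bc: "b t s \<in> carrier R" if "t \<in> T" "s \<in> S" for s t
      using b that by blast
    obtain c where c: "c \<in> T \<rightarrow> carrier R" "\<exists>t\<in>T. c t \<noteq> \<zero>"
      "\<forall>s\<in>S. (\<Oplus>t\<in>T. c t \<otimes> b t s) = \<zero>"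
      using homogeneous_solution[OF S(3) T(3) card, of "\<lambda>s t. b t s"] bc by blast
    have cc: "c t \<in> carrier R" if "t \<in> T" for t
      using c(1) that by blast
    have "(\<Oplus>t\<in>T. c t \<otimes> M $$ (i, t)) = \<zero>" if i: "i < dim_row M" for i
    proof -
      have Ms: "M $$ (i, s) \<in> carrier R" if "s \<in> S" for s
        using M i S(1) that by blast
      have Mt: "M $$ (i, t) \<in> carrier R" if "t \<in> T" for t
        using M i T(1) that by blast
      have "(\<Oplus>t\<in>T. c t \<otimes> M $$ (i, t)) = (\<Oplus>t\<in>T. \<Oplus>s\<in>S. c t \<otimes> b t s \<otimes> M $$ (i, s))"
      proof (rule finsum_cong')
        fix t
        assume t: "t \<in> T"
        have "c t \<otimes> M $$ (i, t) = c t \<otimes> (\<Oplus>s\<in>S. b t s \<otimes> M $$ (i, s))"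
          using bM[OF t i] by simp
        also have "\<dots> = (\<Oplus>s\<in>S. c t \<otimes> (b t s \<otimes> M $$ (i, s)))"
          using cc t bc Ms S(3) by (intro finsum_rdistr) auto
        also have "\<dots> = (\<Oplus>s\<in>S. c t \<otimes> b t s \<otimes> M $$ (i, s))"
          using cc t bc Ms by (intro finsum_cong') (auto simp: m_assoc)
        finally show "c t \<otimes> M $$ (i, t) = (\<Oplus>s\<in>S. c t \<otimes> b t s \<otimes> M $$ (i, s))" .
      qed (use cc bc Ms in \<open>auto intro!: finsum_closed\<close>)
      also have "\<dots> = (\<Oplus>s\<in>S. \<Oplus>t\<in>T. c t \<otimes> b t s \<otimes> M $$ (i, s))"
        using cc bc Ms S(3) T(3) by (intro finsum_finsum_swap) auto
      also have "\<dots> = (\<Oplus>s\<in>S. \<zero>)"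
      proof (rule finsum_cong')
        fix s
        assume s: "s \<in> S"
        have "(\<Oplus>t\<in>T. c t \<otimes> b t s \<otimes> M $$ (i, s)) = (\<Oplus>t\<in>T. c t \<otimes> b t s) \<otimes> M $$ (i, s)"
          using cc bc Ms s T(3) by (intro finsum_ldistr[symmetric]) auto
        then show "(\<Oplus>t\<in>T. c t \<otimes> b t s \<otimes> M $$ (i, s)) = \<zero>"
          using c(3) s Ms by simp
      qed auto
      finally show ?thesis
        by simp
    qed
    then have "\<forall>t\<in>T. c t = \<zero>"
      using T(2) c(1) unfolding indep_columns_def by blast
    then show False
      using c(2) by blast
  qed
  have "column_matroid R M \<subseteq> Pow {..<dim_col M}"
    by (auto simp: column_matroid_def)
  then show ?thesis
    unfolding matroid_def using ne down exch by (intro conjI ballI allI impI) auto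
qed


section \<open>Matroids given by a matrix over an explicitly presented field\<close>

text \<open>
  A finite field is presented by its characteristic \<open>p\<close> and an irreducible polynomial \<open>f\<close> over
  the prime field; its elements are given by their representatives of degree less than that of
  \<open>f\<close>. Polynomials are lists of coefficients as in \<^theory>\<open>HOL-Algebra.Polynomials\<close>, highest
  degree first and without leading zeros.
\<close>

datatype matrix_repr =
    Over_Finite_Field nat "nat list" "nat list mat"
  | Over_Rationals "rat mat"

definition prime_field :: "nat \<Rightarrow> int ring" where
  "prime_field p = residue_ring (int p)"

definition finite_field :: "nat \<Rightarrow> nat list \<Rightarrow> int list set ring" where
  "finite_field p f = Rupt\<^bsub>prime_field p\<^esub> (carrier (prime_field p)) (map int f)"

definition finite_field_elem :: "nat \<Rightarrow> nat list \<Rightarrow> nat list \<Rightarrow> int list set" where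
  "finite_field_elem p f a =
    PIdl\<^bsub>poly_ring (prime_field p)\<^esub> (map int f) +>\<^bsub>poly_ring (prime_field p)\<^esub> map int a"

fun valid_repr :: "matrix_repr \<Rightarrow> bool" where
  "valid_repr (Over_Finite_Field p f A) \<longleftrightarrow>
    prime p \<and>
    map int f \<in> carrier (poly_ring (prime_field p)) \<and>
    pirreducible\<^bsub>prime_field p\<^esub> (carrier (prime_field p)) (map int f) \<and>
    (\<forall>a\<in>elements_mat A.
      map int a \<in> carrier (poly_ring (prime_field p)) \<and> length a < length f)"
| "valid_repr (Over_Rationals A) \<longleftrightarrow> True"

fun ground_set :: "matrix_repr \<Rightarrow> nat set" where
  "ground_set (Over_Finite_Field p f A) = {..<dim_col A}"
| "ground_set (Over_Rationals A) = {..<dim_col A}"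

fun indep_sets :: "matrix_repr \<Rightarrow> nat set set" where
  "indep_sets (Over_Finite_Field p f A) =
    column_matroid (finite_field p f) (map_mat (finite_field_elem p f) A)"
| "indep_sets (Over_Rationals A) = column_matroid ring_of_type_algebra A"

fun field_char :: "matrix_repr \<Rightarrow> nat" where
  "field_char (Over_Finite_Field p f A) = p"
| "field_char (Over_Rationals A) = 0"

fun enc_repr :: "matrix_repr \<Rightarrow> val" where
  "enc_repr (Over_Finite_Field p f A) =
    Cell (Cell (Num p) (enc_list Num f)) (enc_mat (enc_list Num) A)"
| "enc_repr (Over_Rationals A) = Cell (Num 0) (enc_mat enc_rat A)"

lemma inj_enc_repr: "inj enc_repr"
proof (rule injI)
  have "inj Num"
    by (simp add: inj_def)
  note inj = inj_eq[OF enc_list_inj[OF this]] inj_eq[OF enc_mat_inj[OF enc_list_inj[OF this]]]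
    inj_eq[OF enc_mat_inj[OF enc_rat_inj]]
  fix x y
  assume eq: "enc_repr x = enc_repr y"
  show "x = y"
  proof (cases x)
    case (Over_Finite_Field p f A)
    then show ?thesis
      using eq by (cases y) (simp_all add: inj)
  next
    case (Over_Rationals A)
    then show ?thesis
      using eq by (cases y) (simp_all add: inj)
  qed
qed

lemma field_prime_field: "prime p \<Longrightarrow> Ring.field (prime_field p)"
  unfolding prime_field_def
  by (intro residues_prime.is_field) (auto simp: residues_prime_def)

lemma field_finite_field:
  assumes "valid_repr (Over_Finite_Field p f A)"
  shows "Ring.field (finite_field p f)"
proof -
  interpret F: Ring.field "prime_field p"
    using assms by (intro field_prime_field) simp
  show ?thesis
    unfolding finite_field_def
    using assms F.rupture_is_field_iff_pirreducible[OF F.carrier_is_subfield] by simp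
qed

lemma finite_field_elem_closed:
  assumes "valid_repr (Over_Finite_Field p f A)" "a \<in> elements_mat A"
  shows "finite_field_elem p f a \<in> carrier (finite_field p f)"
  using assms
  unfolding finite_field_def finite_field_elem_def rupture_def FactRing_def A_RCOSETS_def' by auto

lemma matroid_indep_sets:
  assumes "valid_repr M"
  shows "matroid (ground_set M) (indep_sets M)"
proof (cases M)
  case (Over_Finite_Field p f A)
  then interpret F: Ring.field "finite_field p f"
    using assms field_finite_field[of p f A] by simp
  have "finite_field_elem p f (A $$ (i, j)) \<in> carrier (finite_field p f)"
    if "i < dim_row A" "j < dim_col A" for i j
    using assms that Over_Finite_Field by (intro finite_field_elem_closed) auto
  then show ?thesis
    using F.matroid_column_matroid[of "map_mat (finite_field_elem p f) A"] Over_Finite_Field by simp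
next
  case (Over_Rationals A)
  interpret Q: Ring.field "ring_of_type_algebra :: rat ring"
    by (rule field_from_type_algebra)
  show ?thesis
    using Q.matroid_column_matroid[of A] Over_Rationals by (simp add: ring_of_type_algebra_def)
qed

definition rank_bases :: "matrix_repr counting_problem" where
  "rank_bases =
    \<lparr>instances = {M. valid_repr M},
     encode = enc_repr,
     solution = (\<lambda>M. card (bases (indep_sets M))),
     parameter = (\<lambda>M. matroid_rank (indep_sets M))\<rparr>"

definition nullity_bases :: "matrix_repr counting_problem" where
  "nullity_bases =
    \<lparr>instances = {M. valid_repr M},
     encode = enc_repr,
     solution = (\<lambda>M. card (bases (indep_sets M))),
     parameter = (\<lambda>M. matroid_nullity (ground_set M) (indep_sets M))\<rparr>"

end

theory Submission
  imports Defs
begin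

text \<open>
  Over a field of characteristic 2, take a matrix \<open>A\<close> with one row for each of \<open>K = k^2\<close> types and a
  last row. An item of type \<open>t\<close> and weight \<open>x\<close> is a column with entry 1 in row \<open>t\<close> and \<open>x\<close> in the last
  row; one further column has entries 1 and \<open>s\<close> in the last row. The bases of the column matroid of
  \<open>[I | A]\<close> correspond to the nonsingular square submatrices of \<open>A\<close>, and so do those of \<open>[I | A^T]\<close>. The
  first matroid has rank \<open>K + 1\<close> and the second nullity \<open>K + 1\<close>. Whether a submatrix is nonsingular
  depends on \<open>s\<close> only if it selects one item for each of its types, and then it is singular iff the
  weights of these items sum up to \<open>s\<close>. Hence the numbers of bases for two values of \<open>s\<close>, one of which
  is not a sum of weights, differ by the number of selections with the other sum.

  Weights in \<open>F_2^d\<close> encode the choice of the vertices of a clique and its consistency. The field is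
  \<open>F_2[x]/(x^(2q) + x^q + 1)\<close> with \<open>q = 3^l\<close>: the trinomial is irreducible as a root in \<open>F_(2^e)\<close> has order
  \<open>3q\<close>, so that \<open>3q\<close> divides \<open>2^e - 1\<close>, which forces \<open>2q\<close> to divide \<open>e\<close>.
\<close>

section \<open>Binary expansions as polynomials over the field with two elements\<close>

unbundle bit_operations_syntax

text \<open>The parameter admits only \<open>k * k + 1\<close> rows, or columns for the nullity, so
  the whole graph has to sit in the field elements of a single line of the matrix. Telling all
  weights apart needs more than \<open>B ^ K\<close> field elements, so the degree of the field
  grows with the input, and a modulus of that degree must be written down deterministically in
  polynomial time. The trinomials serve this purpose: their degrees \<open>2 * 3 ^ l\<close> are
  spaced by a factor of 3, so the least sufficient \<open>l\<close> overshoots by a constant factor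
  only. Characteristic 2 dictates the form of the weights. Sums of field elements see parities only,
  so agreement of proposals is expressed by the cancellation of three contributions in one block of
  bits, and a separate bit certifies that a type occurs. The second value of \<open>s\<close> is
  \<open>B ^ K\<close>, a power of two beyond all bits of the weights, so the difference of the two
  counts is the number of cliques itself. Field elements are named by natural numbers below
  \<open>2 ^ (2 * q)\<close> throughout: addition becomes XOR, and every claim on a sum becomes one
  on single bits.\<close>

fun bits :: "nat \<Rightarrow> nat list" where
  "bits x = (if x = 0 then [] else bits (x div 2) @ [x mod 2])"

declare bits.simps [simp del]

lemma bits_0 [simp]: "bits 0 = []"
  by (simp add: bits.simps)

lemma bits_1 [simp]: "bits (Suc 0) = [1]"
  by (simp add: bits.simps)

lemma length_bits: "length (bits x) = floorlog 2 x"
  by (induction x rule: bits.induct) (subst bits.simps, subst compute_floorlog, auto)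

lemma length_bits_le: "x < 2 ^ d \<Longrightarrow> length (bits x) \<le> d"
proof (induction d arbitrary: x)
  case (Suc d)
  then have "x div 2 < 2 ^ d" by auto
  from Suc.IH[OF this] show ?case by (subst bits.simps) auto
qed simp

lemma hd_bits: "x \<noteq> 0 \<Longrightarrow> hd (bits x) = 1"
proof (induction x rule: bits.induct)
  case (1 x)
  show ?case
  proof (cases "x div 2 = 0")
    case True
    with 1(2) have "x = 1" by auto
    then show ?thesis by simp
  next
    case False
    with 1 have "hd (bits (x div 2)) = 1" "bits (x div 2) \<noteq> []"
      by (auto simp: bits.simps[of "x div 2"])
    with 1(2) show ?thesis by (subst bits.simps) (simp add: hd_append)
  qed
qed

lemma set_bits: "set (bits x) \<subseteq> {0, 1}"
  by (induction x rule: bits.induct) (subst bits.simps, auto)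

locale gf2 = Ring.field R for R :: "int ring" (structure) +
  assumes R_def: "R = prime_field 2"
begin

lemma gf2_simps: "carrier R = {0, 1}" "\<zero> = 0" "\<one> = 1" "x \<oplus> y = (x + y) mod 2"
  by (auto simp: R_def prime_field_def residue_ring_def)

text \<open>The list has its highest coefficient first, so its last element is the coefficient of
  degree 0 and \<open>bits (x div 2)\<close> is the shift by one. Equality and addition of
  polynomials reduce through this to statements on single bits.\<close>

lemma coeff_bits: "coeff (map int (bits x)) i = of_bool (bit x i)"
proof (induction x arbitrary: i rule: bits.induct)
  case (1 x)
  show ?case
  proof (cases "x = 0")
    case False
    note bits = bits.simps[of x] and IH = "1.IH"[OF False]
    show ?thesis
    proof (cases i)
      case 0
      then show ?thesis
        using False by (simp add: bits append_coeff bit_0 mod_2_eq_odd)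
    next
      case (Suc j)
      then show ?thesis
        using False IH[of j] by (simp add: bits append_coeff bit_Suc)
    qed
  qed (simp add: gf2_simps)
qed

lemma bits_inj: "bits x = bits y \<longleftrightarrow> x = y"
proof
  assume "bits x = bits y"
  then have "of_bool (bit x i) = (of_bool (bit y i) :: int)" for i
    by (metis coeff_bits)
  then show "x = y"
    by (intro bit_eqI) (simp add: of_bool_eq_iff)
qed simp

lemma bits_in_poly_ring: "map int (bits x) \<in> carrier (poly_ring R)"
proof -
  have "set (map int (bits x)) \<subseteq> {0, 1}"
    using set_bits[of x] by auto
  moreover have "hd (map int (bits x)) \<noteq> 0" if "x \<noteq> 0"
    using hd_bits[OF that] that by (subst hd_map) (auto simp: bits.simps)
  ultimately show ?thesis
    unfolding univ_poly_carrier[symmetric] polynomial_def gf2_simps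
    by (cases "x = 0") auto
qed

text \<open>Removing the last coefficient of a normalized polynomial leaves a normalized one unless
  nothing is left. On numbers this is division by two, hence the induction from the end of the
  list.\<close>

lemma poly_ring_gf2_bits:
  assumes "p \<in> carrier (poly_ring R)"
  shows "\<exists>x. p = map int (bits x)"
  using assms
proof (induction p rule: rev_induct)
  case Nil
  then show ?case by (intro exI[of _ 0]) simp
next
  case (snoc c p)
  have c: "c = 0 \<or> c = 1" "set p \<subseteq> {0, 1}" and hd: "hd (p @ [c]) \<noteq> 0"
    using snoc.prems unfolding univ_poly_carrier[symmetric] polynomial_def gf2_simps by auto
  show ?case
  proof (cases "p = []")
    case True
    with c hd show ?thesis by (intro exI[of _ 1]) auto
  next
    case False
    with c hd have "p \<in> carrier (poly_ring R)"
      unfolding univ_poly_carrier[symmetric] polynomial_def gf2_simps by auto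
    then obtain x where x: "p = map int (bits x)" using snoc.IH by blast
    then have "x \<noteq> 0" using False by (cases "x = 0") auto
    then show ?thesis
      using c x by (intro exI[of _ "2 * x + nat c"], subst bits.simps) auto
  qed
qed

lemma bits_xor:
  "map int (bits x) \<oplus>\<^bsub>poly_ring R\<^esub> map int (bits y) = map int (bits (x XOR y))"
proof -
  interpret P: Ring.ring "poly_ring R"
    by (rule univ_poly_is_ring[OF carrier_is_subring])
  have p: "polynomial (carrier R) (map int (bits z))" for z
    using bits_in_poly_ring univ_poly_carrier by blast
  have cl: "polynomial (carrier R) (map int (bits x) \<oplus>\<^bsub>poly_ring R\<^esub> map int (bits y))"
    unfolding univ_poly_carrier by (intro P.a_closed bits_in_poly_ring)
  have "coeff (poly_add (map int (bits x)) (map int (bits y))) = coeff (map int (bits (x XOR y)))"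
    by (subst poly_add_coeff)
      (use polynomial_incl[OF p] in \<open>auto simp: coeff_bits fun_eq_iff gf2_simps bit_xor_iff\<close>)
  then show ?thesis
    using coeff_iff_polynomial_cond[OF cl p] by (simp add: univ_poly_add)
qed

lemma short_polys_eq:
  "{p \<in> carrier (poly_ring R). length p \<le> d} = (\<lambda>x. map int (bits x)) ` {..<2 ^ d}"
  (is "?A = ?B")
proof
  show "?B \<subseteq> ?A" using bits_in_poly_ring length_bits_le by auto
  show "?A \<subseteq> ?B"
  proof
    fix p assume p: "p \<in> ?A"
    then obtain x where x: "p = map int (bits x)" using poly_ring_gf2_bits by blast
    then have "floorlog 2 x \<le> d" using p length_bits[of x] by simp
    then have "x < 2 ^ d"
      using floorlog_le_iff[of 2 x d] by simp
    then show "p \<in> ?B" using x by blast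
  qed
qed

lemma pmod_image:
  assumes g: "g \<in> carrier (poly_ring R)" "length g = Suc d"
  shows "(\<lambda>q. q pmod g) ` carrier (poly_ring R) = (\<lambda>x. map int (bits x)) ` {..<2 ^ d}"
  unfolding short_polys_eq[symmetric]
proof (intro equalityI subsetI)
  fix p assume "p \<in> (\<lambda>q. q pmod g) ` carrier (poly_ring R)"
  then obtain q where q: "q \<in> carrier (poly_ring R)" "p = q pmod g" by blast
  show "p \<in> {p \<in> carrier (poly_ring R). length p \<le> d}"
    using long_division_closed(2)[OF carrier_is_subfield q(1) g(1)]
      pmod_degree[OF carrier_is_subfield q(1) g(1)] g q(2) by (cases "p = []"; cases "g = []") auto
next
  fix p assume p: "p \<in> {p \<in> carrier (poly_ring R). length p \<le> d}"
  show "p \<in> (\<lambda>q. q pmod g) ` carrier (poly_ring R)"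
  \<comment> \<open>\<open>degree\<close> is \<open>length - 1\<close>, hence 0 also for the zero
    polynomial. For constant \<open>g\<close> the strict comparison of degrees in
    \<open>pmod_const\<close> fails, so this case is separate.\<close>
  proof (cases "d = 0")
    case True
    then have "p = []" using p by simp
    then show ?thesis
      using long_division_zero(2)[OF carrier_is_subfield g(1)] p by (metis (mono_tags, lifting) image_eqI mem_Collect_eq)
  next
    case False
    then have "p pmod g = p"
      using p g by (intro pmod_const(2)[OF carrier_is_subfield]) auto
    then show ?thesis using p by force
  qed
qed

lemma finite_field_elem_gf2:
  "finite_field_elem 2 f a = rupture_surj (carrier R) (map int f) (map int a)"
  by (simp add: finite_field_elem_def R_def)

text \<open>Residue classes correspond to remainders, and remainders to the numbers with at most
  \<open>d\<close> binary digits. Equations in the field can thus be tested on numbers.\<close>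

lemma bij_betw_gf2_extension:
  assumes g: "map int g \<in> carrier (poly_ring R)" "length g = Suc d"
  shows "bij_betw (\<lambda>x. finite_field_elem 2 g (bits x)) {..<2 ^ d} (carrier (finite_field 2 g))"
proof -
  have "bij_betw (rupture_surj (carrier R) (map int g))
      ((\<lambda>q. q pmod (map int g)) ` carrier (poly_ring R)) (carrier (finite_field 2 g))"
    unfolding bij_betw_def finite_field_def R_def[symmetric]
    using rupture_surj_inj_on[OF carrier_is_subfield g(1)]
      rupture_carrier_as_pmod_image[OF carrier_is_subfield g(1)] by blast
  moreover have "bij_betw (\<lambda>x. map int (bits x)) {..<2 ^ d} ((\<lambda>q. q pmod (map int g)) ` carrier (poly_ring R))"
    unfolding bij_betw_def
  proof
    show "inj_on (\<lambda>x. map int (bits x)) {..<2 ^ d}"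
      by (rule inj_onI) (simp add: bits_inj inj_map_eq_map)
    show "(\<lambda>x. map int (bits x)) ` {..<2 ^ d} = (\<lambda>q. q pmod (map int g)) ` carrier (poly_ring R)"
      using pmod_image[of "map int g" d] g by simp
  qed
  ultimately show ?thesis
    unfolding finite_field_elem_gf2 using bij_betw_trans[of "\<lambda>x. map int (bits x)"] by (auto simp: comp_def)
qed

end

section \<open>Irreducible trinomials\<close>

text \<open>One half of the fact that, for positive \<open>m\<close>, the 3-adic valuation of
  \<open>4 ^ m - 1\<close> exceeds that of \<open>m\<close> by one. The induction step is about
  cubing: for \<open>a = 1 + 3 * t\<close> the cofactor \<open>a * a + a + 1\<close> of
  \<open>a - 1\<close> in \<open>a ^ 3 - 1\<close> is divisible by 3 exactly once.\<close>

lemma three_power_dvd_four_power: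
  "3 ^ Suc l dvd (4::nat) ^ m - 1 \<Longrightarrow> 3 ^ l dvd m"
proof (induction l arbitrary: m)
  case (Suc l)
  \<comment> \<open>The exponent of 3 is at least 2 here. As 4 has order 3 modulo 9, this forces 3
    to divide \<open>m\<close>.\<close>
  have "9 dvd (4::nat) ^ m - 1"
    by (rule dvd_trans[OF _ Suc.prems]) simp
  then have m9: "(4::nat) ^ m mod 9 = 1"
    using mod_eq_dvd_iff_nat[of 1 "4 ^ m" 9] by simp
  have "(4::nat) ^ m mod 9 = (4 ^ 3) ^ (m div 3) * 4 ^ (m mod 3) mod 9"
    unfolding power_mult[symmetric] power_add[symmetric] by simp
  also have "\<dots> = (4 ^ 3 mod 9) ^ (m div 3) * 4 ^ (m mod 3) mod 9"
    by (metis mod_mult_left_eq power_mod)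
  also have "\<dots> = 4 ^ (m mod 3) mod 9"
    by simp
  finally have "(4::nat) ^ (m mod 3) mod 9 = 1"
    using m9 by simp
  moreover have "m mod 3 = 0 \<or> m mod 3 = 1 \<or> m mod 3 = 2"
    by linarith
  ultimately have "m mod 3 = 0"
    by auto
  then obtain n where n: "m = 3 * n"
    by (auto simp: dvd_def)
  define a where "a = (4::nat) ^ n"
  have "a mod 3 = 1"
    unfolding a_def by (subst power_mod[symmetric]) simp
  then obtain t where t: "a = 1 + 3 * t"
    by (metis add.commute mod_mult_div_eq mult.commute)
  have "(4::nat) ^ m - 1 = (a - 1) * (a * a + a + 1)"
  proof -
    have "(4::nat) ^ m = a * a * a"
      by (simp add: n a_def power_add[symmetric])
    then show ?thesis by (simp add: t algebra_simps)
  qed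
  also have "\<dots> = (a - 1) * 3 * (1 + 3 * t + 3 * t * t)"
    by (simp add: t algebra_simps)
  finally have "3 * 3 ^ Suc l dvd 3 * ((a - 1) * (1 + 3 * t + 3 * t * t))"
    using Suc.prems by (simp add: ac_simps)
  then have "3 ^ Suc l dvd (a - 1) * (1 + 3 * t + 3 * t * t)"
    by (rule dvd_mult_cancel) simp
  moreover have "coprime (3 ^ Suc l) (1 + 3 * t + 3 * t * t)"
  proof -
    have "1 + 3 * t + 3 * t * t = 1 + 3 * (t + t * t)"
      by (simp add: algebra_simps)
    then have "\<not> 3 dvd 1 + 3 * t + 3 * t * t"
      by presburger
    then have "coprime 3 (1 + 3 * t + 3 * t * t)"
      by (simp add: prime_imp_coprime)
    then show ?thesis by simp
  qed
  ultimately have "3 ^ Suc l dvd a - 1"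
    using coprime_dvd_mult_left_iff by blast
  then have "3 ^ Suc l dvd (4::nat) ^ n - 1"
    unfolding a_def .
  from Suc.IH[OF this] show ?case
    by (simp add: n)
qed simp

text \<open>Modulo 3 the number 2 has order 2, so \<open>e\<close> is even and the claim becomes one
  on powers of 4.\<close>

lemma three_power_dvd_two_power:
  assumes "3 ^ Suc l dvd (2::nat) ^ e - 1"
  shows "2 * 3 ^ l dvd e"
proof -
  have "3 dvd (2::nat) ^ e - 1"
    by (rule dvd_trans[OF _ assms]) simp
  then have *: "(2::nat) ^ e mod 3 = 1"
    using mod_eq_dvd_iff_nat[of 1 "2 ^ e" 3] by simp
  have "even e"
  proof (rule ccontr)
    assume "odd e"
    then obtain m where "e = 2 * m + 1" by (elim oddE)
    then have "(2::nat) ^ e mod 3 = 2 * (4 ^ m mod 3) mod 3"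
      by (simp add: power_mult mod_mult_right_eq)
    moreover have "(4::nat) ^ m mod 3 = 1"
      by (subst power_mod[symmetric]) simp
    ultimately show False using * by simp
  qed
  then obtain m where m: "e = 2 * m" by (elim evenE)
  then have "3 ^ Suc l dvd (4::nat) ^ m - 1"
    using assms by (simp add: power_mult)
  then show ?thesis
    using three_power_dvd_four_power m by auto
qed

text \<open>The order of \<open>x\<close> divides \<open>3q\<close>, as \<open>y = x^q\<close> satisfies \<open>y^3 - 1 = (y - 1)(y^2 + y + 1)\<close>; it does
  not divide \<open>q\<close>, because \<open>1\<close> is not a root of \<open>y^2 + y + 1\<close> in characteristic 2.\<close>

lemma (in Ring.field) cyclotomic_root_order:
  assumes card: "card (carrier R) = 2 ^ e" and x: "x \<in> carrier R" and two: "\<one> \<oplus> \<one> = \<zero>"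
    and q: "q = (3::nat) ^ l" and root: "x [^] (2 * q) \<oplus> (x [^] q \<oplus> \<one>) = \<zero>"
  shows "3 ^ Suc l dvd (2::nat) ^ e - 1"
proof -
  interpret G: group "Multiplicative_Group.mult_of R"
    by (rule field_mult_group)
  define y where "y = x [^] q"
  have y: "y \<in> carrier R" using x by (simp add: y_def)
  have root': "y \<otimes> y \<oplus> (y \<oplus> \<one>) = \<zero>"
    using root x by (simp add: y_def mult_2 nat_pow_mult)
  have "x \<noteq> \<zero>"
  proof
    assume "x = \<zero>"
    then have "y = \<zero>" using q by (simp add: y_def nat_pow_zero)
    then show False using root' by simp
  qed
  then have xG: "x \<in> carrier (Multiplicative_Group.mult_of R)" using x by simp
  have "\<ominus> \<one> = \<one>"
    using two by (simp add: minus_equality)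
  have "y \<noteq> \<one>"
    using root' two by auto
  have "y \<otimes> y \<otimes> y = \<one>"
  proof -
    have "y \<otimes> y \<otimes> y \<ominus> \<one> = (y \<ominus> \<one>) \<otimes> (y \<otimes> y \<oplus> (y \<oplus> \<one>))"
      using y by algebra
    also have "\<dots> = \<zero>" using root' y by simp
    finally show ?thesis using y by (metis m_closed one_closed r_right_minus_eq)
  qed
  moreover have "3 ^ Suc l = q + q + q" by (simp add: q)
  ultimately have "x [^] (3 ^ Suc l :: nat) = \<one>"
    using x by (simp only: y_def nat_pow_mult)
  then have "G.ord x dvd 3 ^ Suc l"
    using G.pow_eq_id[OF xG] by (simp add: Multiplicative_Group.nat_pow_mult_of)
  moreover have "\<not> G.ord x dvd 3 ^ l"
    using G.pow_eq_id[OF xG, of "3 ^ l"] \<open>y \<noteq> \<one>\<close> by (simp add: Multiplicative_Group.nat_pow_mult_of y_def q)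
  \<comment> \<open>A divisor of \<open>3 ^ Suc l\<close> is a power of 3, and all but the largest
    of these divide \<open>3 ^ l\<close>.\<close>
  moreover obtain i where "i \<le> Suc l" "G.ord x = 3 ^ i"
    using calculation(1) divides_primepow_nat[of 3 "G.ord x" "Suc l"] by auto
  ultimately have "G.ord x = 3 ^ Suc l"
    using le_imp_power_dvd[of i l "3::nat"] by (cases "i = Suc l") auto
  moreover have "finite (carrier R)"
    using card by (metis card.infinite power_not_zero zero_neq_numeral)
  ultimately show ?thesis
    using G.ord_dvd_group_order[OF xG] order_mult_of card by (simp add: Coset.order_def)
qed

lemma length_trinomial:
  assumes "q \<ge> 1"
  shows "length (bits (2 ^ (2 * q) + 2 ^ q + 1)) = Suc (2 * q)"
proof -
  have "(2::nat) \<le> 2 ^ q" using assms power_increasing[of 1 q "2::nat"] by simp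
  then have "(2::nat) ^ q + 1 < 2 ^ Suc q" by simp
  also have "(2::nat) ^ Suc q \<le> 2 ^ (2 * q)" using assms by (intro power_increasing) auto
  finally have "(2::nat) ^ (2 * q) + 2 ^ q + 1 < 2 ^ Suc (2 * q)" by simp
  then have "floorlog 2 (2 ^ (2 * q) + 2 ^ q + 1) \<le> Suc (2 * q)"
    by (intro floorlog_leI) auto
  moreover have "Suc (2 * q) \<le> floorlog 2 (2 ^ (2 * q) + 2 ^ q + 1)"
    by (intro floorlog_ge_SucI) auto
  ultimately show ?thesis by (simp add: length_bits)
qed

context gf2
begin

lemma bits_power: "map int (bits (2 ^ n)) = monom \<one> n"
proof (induction n)
  case (Suc n)
  have "bits (2 ^ Suc n) = bits (2 ^ n) @ [0]"
    by (subst bits.simps) simp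
  then show ?case
    using Suc by (simp add: monom_def gf2_simps replicate_append_same)
qed (simp add: monom_def gf2_simps)

text \<open>The three powers of two are distinct since \<open>q\<close> is positive. Their sum as
  numbers has no carries and equals their XOR, which names the sum of the three monomials.\<close>

lemma trinomial_bits:
  assumes "q \<ge> 1"
  shows "map int (bits (2 ^ (2 * q) + 2 ^ q + 1)) =
    X [^]\<^bsub>poly_ring R\<^esub> (2 * q) \<oplus>\<^bsub>poly_ring R\<^esub> (X [^]\<^bsub>poly_ring R\<^esub> q \<oplus>\<^bsub>poly_ring R\<^esub> \<one>\<^bsub>poly_ring R\<^esub>)"
proof -
  have 1: "(2::nat) ^ q + 1 = 2 ^ q XOR 2 ^ 0"
    using assms by (subst disjunctive_add_eq_xor) (auto intro!: bit_eqI simp: bit_simps bit_1_iff)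
  have "(2::nat) ^ (2 * q) + (2 ^ q + 1) = 2 ^ (2 * q) XOR (2 ^ q + 1)"
    unfolding 1
    using assms by (subst disjunctive_add_eq_xor) (auto intro!: bit_eqI simp: bit_simps bit_1_iff)
  then have "(2::nat) ^ (2 * q) + 2 ^ q + 1 = 2 ^ (2 * q) XOR (2 ^ q XOR 2 ^ 0)"
    using 1 by simp
  then have "map int (bits (2 ^ (2 * q) + 2 ^ q + 1)) =
      monom \<one> (2 * q) \<oplus>\<^bsub>poly_ring R\<^esub> (monom \<one> q \<oplus>\<^bsub>poly_ring R\<^esub> monom \<one> 0)"
    by (simp only: bits_xor[symmetric] bits_power)
  then show ?thesis
    by (simp add: unitary_monom_eq_var_pow[OF carrier_is_subring])
qed

lemma nonzero_factors:
  assumes "b \<in> carrier (poly_ring R)" "c \<in> carrier (poly_ring R)" "b \<otimes>\<^bsub>poly_ring R\<^esub> c \<noteq> []"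
  shows "b \<noteq> []" "c \<noteq> []"
proof -
  interpret UP: Ring.domain "poly_ring R"
    by (rule univ_poly_is_domain[OF carrier_is_subring])
  have zero: "\<zero>\<^bsub>poly_ring R\<^esub> = []" by (rule univ_poly_zero)
  show "b \<noteq> []" using UP.l_null[OF assms(2)] assms(3) unfolding zero by auto
  show "c \<noteq> []" using UP.r_null[OF assms(1)] assms(3) unfolding zero by auto
qed

lemma exists_irreducible_divisor:
  assumes "a \<in> carrier (poly_ring R)" "(length a - 1) \<ge> 1"
  shows "\<exists>g\<in>carrier (poly_ring R). pirreducible (carrier R) g \<and> g divides\<^bsub>poly_ring R\<^esub> a"
  using assms
proof (induction "(length a - 1)" arbitrary: a rule: less_induct)
  case (less a)
  interpret UP: Ring.domain "poly_ring R"
    by (rule univ_poly_is_domain[OF carrier_is_subring])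
  note units = univ_poly_units'[OF carrier_is_subfield]
  show ?case
  proof (cases "pirreducible (carrier R) a")
    case True
    then show ?thesis using less.prems(1) UP.divides_refl by blast
  next
    case False
    have a: "a \<noteq> []" "a \<notin> Units (poly_ring R)" using less.prems(2) unfolding units by auto
    then obtain b c where bc: "b \<in> carrier (poly_ring R)" "c \<in> carrier (poly_ring R)"
      "a = b \<otimes>\<^bsub>poly_ring R\<^esub> c" "b \<notin> Units (poly_ring R)" "c \<notin> Units (poly_ring R)"
      using False pirreducibleI[OF carrier_is_subring less.prems(1) a] by blast
    have ne: "b \<noteq> []" "c \<noteq> []"
      using nonzero_factors[OF bc(1,2)] bc(3) \<open>a \<noteq> []\<close> by blast+
    then have d: "(length b - 1) \<ge> 1" "(length c - 1) \<ge> 1" using bc units by (auto simp: Suc_le_eq)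
    have "(length a - 1) = (length b - 1) + (length c - 1)"
      using bc ne poly_mult_degree_eq[OF carrier_is_subring, of b c] by (simp add: univ_poly_mult univ_poly_carrier)
    then have "length b - 1 < length a - 1" using d by linarith
    then obtain g where g: "g\<in>carrier (poly_ring R)" "pirreducible (carrier R) g" "g divides\<^bsub>poly_ring R\<^esub> b"
      using less.hyps[OF _ bc(1) d(1)] by blast
    have "g divides\<^bsub>poly_ring R\<^esub> a"
      unfolding bc(3) by (rule UP.divides_prod_r[OF g(3,1) bc(2)])
    then show ?thesis using g by blast
  qed
qed

text \<open>The quotient by \<open>g\<close> is a field with \<open>2 ^ e\<close> elements, where
  \<open>e\<close> is the degree of \<open>g\<close>, and the class of \<open>X\<close> in it is a
  root of the trinomial. So \<open>3 ^ Suc l\<close> divides \<open>2 ^ e - 1\<close>, which makes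
  \<open>e\<close> a positive multiple of \<open>2 * q\<close>.\<close>

lemma irreducible_divisor_of_trinomial:
  assumes g: "g \<in> carrier (poly_ring R)" "pirreducible (carrier R) g"
    and q: "q = 3 ^ l" and dvd: "g divides\<^bsub>poly_ring R\<^esub> map int (bits (2 ^ (2 * q) + 2 ^ q + 1))"
  shows "2 * q \<le> (length g - 1)"
proof -
  define F where "F = Rupt (carrier R) g"
  define h where "h = rupture_surj (carrier R) g"
  define e where "e = (length g - 1)"
  have e: "e \<ge> 1" "length g = Suc e"
    using pirreducible_degree[OF carrier_is_subfield g] by (auto simp: e_def)
  interpret UP: Ring.domain "poly_ring R"
    by (rule univ_poly_is_domain[OF carrier_is_subring])
  interpret F: Ring.field F
    unfolding F_def using rupture_is_field_iff_pirreducible[OF carrier_is_subfield g(1)] g(2) by simp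
  interpret h: ring_hom_ring "poly_ring R" F h
    unfolding F_def h_def by (rule rupture_surj_hom[OF carrier_is_subring g(1)])
  have "carrier F = h ` ((\<lambda>q. q pmod g) ` carrier (poly_ring R))"
    unfolding F_def h_def using rupture_carrier_as_pmod_image[OF carrier_is_subfield g(1)] by simp
  moreover have "inj_on h ((\<lambda>q. q pmod g) ` carrier (poly_ring R))"
    unfolding h_def by (rule rupture_surj_inj_on[OF carrier_is_subfield g(1)])
  ultimately have "card (carrier F) = card ((\<lambda>x. map int (bits x)) ` {..<2 ^ e})"
    unfolding pmod_image[OF g(1) e(2)] by (simp add: card_image)
  also have "\<dots> = 2 ^ e"
    by (subst card_image) (auto intro!: inj_onI simp: bits_inj inj_map_eq_map)
  finally have card: "card (carrier F) = 2 ^ e" .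
  have X: "X \<in> carrier (poly_ring R)" by (rule var_closed[OF carrier_is_subring])
  have "h (\<one>\<^bsub>poly_ring R\<^esub> \<oplus>\<^bsub>poly_ring R\<^esub> \<one>\<^bsub>poly_ring R\<^esub>) = h \<zero>\<^bsub>poly_ring R\<^esub>"
    using bits_xor[of 1 1] by (simp add: univ_poly_one univ_poly_zero gf2_simps)
  then have two: "\<one>\<^bsub>F\<^esub> \<oplus>\<^bsub>F\<^esub> \<one>\<^bsub>F\<^esub> = \<zero>\<^bsub>F\<^esub>" by simp
  obtain b where b: "b \<in> carrier (poly_ring R)" "map int (bits (2 ^ (2 * q) + 2 ^ q + 1)) = g \<otimes>\<^bsub>poly_ring R\<^esub> b"
    using dvd unfolding factor_def by blast
  have "h g = h \<zero>\<^bsub>poly_ring R\<^esub>"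
    unfolding h_def rupture_surj_composed_with_pmod[OF carrier_is_subfield g(1) g(1)]
    using pmod_zero_iff_pdivides[OF carrier_is_subfield g(1) g(1)] UP.divides_refl[OF g(1)]
    by (simp add: pdivides_def univ_poly_zero)
  then have "h (map int (bits (2 ^ (2 * q) + 2 ^ q + 1))) = \<zero>\<^bsub>F\<^esub>"
    using b g by simp
  moreover have h_pow: "h (X [^]\<^bsub>poly_ring R\<^esub> n) = h X [^]\<^bsub>F\<^esub> n" for n :: nat
    using X by (induction n) simp_all
  moreover have "1 \<le> q" using q by simp
  ultimately have "h X [^]\<^bsub>F\<^esub> (2 * q) \<oplus>\<^bsub>F\<^esub> (h X [^]\<^bsub>F\<^esub> q \<oplus>\<^bsub>F\<^esub> \<one>\<^bsub>F\<^esub>) = \<zero>\<^bsub>F\<^esub>"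
    using X unfolding trinomial_bits[OF \<open>1 \<le> q\<close>] by (simp add: h_pow)
  then have "3 ^ Suc l dvd (2::nat) ^ e - 1"
    using F.cyclotomic_root_order[OF card h.hom_closed[OF X] two q] by blast
  then have "2 * 3 ^ l dvd e" by (rule three_power_dvd_two_power)
  then have "2 * 3 ^ l \<le> e" by (rule dvd_imp_le) (use e in simp)
  then show ?thesis by (simp add: q e_def)
qed

text \<open>In a factorization, an irreducible divisor of one factor already has degree at least
  \<open>2 * q\<close>, the degree of the whole trinomial. This leaves degree 0 for the other
  factor.\<close>

lemma trinomial_irreducible:
  assumes q: "q = 3 ^ l"
  shows "pirreducible (carrier R) (map int (bits (2 ^ (2 * q) + 2 ^ q + 1)))" (is "pirreducible _ ?f")
proof -
  interpret UP: Ring.domain "poly_ring R"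
    by (rule univ_poly_is_domain[OF carrier_is_subring])
  note units = univ_poly_units'[OF carrier_is_subfield]
  have f: "?f \<in> carrier (poly_ring R)" by (rule bits_in_poly_ring)
  have q1: "q \<ge> 1" using q by simp
  have len: "length ?f = Suc (2 * q)" using length_trinomial[OF q1] by simp
  show ?thesis
  proof (rule pirreducibleI[OF carrier_is_subring f])
    show "?f \<noteq> []" using len by auto
    then show "?f \<notin> Units (poly_ring R)" using units len q1 by simp
    fix b c assume bc: "b \<in> carrier (poly_ring R)" "c \<in> carrier (poly_ring R)" "?f = b \<otimes>\<^bsub>poly_ring R\<^esub> c"
    show "b \<in> Units (poly_ring R) \<or> c \<in> Units (poly_ring R)"
    proof (rule ccontr)
      assume nu: "\<not> (b \<in> Units (poly_ring R) \<or> c \<in> Units (poly_ring R))"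
      have ne: "b \<noteq> []" "c \<noteq> []"
        using nonzero_factors[OF bc(1,2)] bc(3) \<open>?f \<noteq> []\<close> by metis+
      then have d: "(length b - 1) \<ge> 1" "(length c - 1) \<ge> 1" using bc nu units by (auto simp: Suc_le_eq)
      have dd: "2 * q = (length b - 1) + (length c - 1)"
        using bc ne poly_mult_degree_eq[OF carrier_is_subring, of b c] len
        by (simp add: univ_poly_mult univ_poly_carrier)
      obtain g where g: "g\<in>carrier (poly_ring R)" "pirreducible (carrier R) g" "g divides\<^bsub>poly_ring R\<^esub> b"
        using exists_irreducible_divisor[OF bc(1) d(1)] by blast
      then have "g divides\<^bsub>poly_ring R\<^esub> ?f"
        unfolding bc(3) by (intro UP.divides_prod_r[OF _ g(1) bc(2)] g(3))
      then have "2 * q \<le> (length g - 1)"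
        by (rule irreducible_divisor_of_trinomial[OF g(1,2) q])
      also have "\<dots> \<le> (length b - 1)"
        using pdivides_imp_degree_le[OF carrier_is_subring g(1) bc(1) ne(1)] g(3)
        by (simp add: pdivides_def)
      finally show False using dd d by simp
    qed
  qed
qed

end

section \<open>Bases and nonsingular submatrices\<close>

text \<open>A trivial kernel replaces the nonzero determinant: it needs no order on the index sets
  and has the shape of \<open>indep_columns\<close>. It means nonsingularity if \<open>P\<close> and
  \<open>Q\<close> have equal size, as demanded in \<open>minors\<close>; the empty submatrix is
  nonsingular.\<close>

definition nonsingular_sub :: "('a, 'b) ring_scheme \<Rightarrow> (nat \<Rightarrow> nat \<Rightarrow> 'a) \<Rightarrow> nat set \<Rightarrow> nat set \<Rightarrow> bool" where
  "nonsingular_sub R a P Q \<longleftrightarrow>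
    (\<forall>c\<in>Q \<rightarrow> carrier R. (\<forall>i\<in>P. (\<Oplus>\<^bsub>R\<^esub>j\<in>Q. c j \<otimes>\<^bsub>R\<^esub> a i j) = \<zero>\<^bsub>R\<^esub>) \<longrightarrow> (\<forall>j\<in>Q. c j = \<zero>\<^bsub>R\<^esub>))"

definition minors :: "('a, 'b) ring_scheme \<Rightarrow> nat \<Rightarrow> nat \<Rightarrow> (nat \<Rightarrow> nat \<Rightarrow> 'a) \<Rightarrow> (nat set \<times> nat set) set" where
  "minors R n m a = {(P, Q). P \<subseteq> {..<n} \<and> Q \<subseteq> {..<m} \<and> card P = card Q \<and> nonsingular_sub R a P Q}"

lemma nonsingular_subD:
  "nonsingular_sub R a P Q \<Longrightarrow> c \<in> Q \<rightarrow> carrier R \<Longrightarrow>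
    (\<And>i. i \<in> P \<Longrightarrow> (\<Oplus>\<^bsub>R\<^esub>j\<in>Q. c j \<otimes>\<^bsub>R\<^esub> a i j) = \<zero>\<^bsub>R\<^esub>) \<Longrightarrow> j \<in> Q \<Longrightarrow> c j = \<zero>\<^bsub>R\<^esub>"
  unfolding nonsingular_sub_def by blast

lemma nonsingular_subI:
  "(\<And>c j. c \<in> Q \<rightarrow> carrier R \<Longrightarrow> (\<And>i. i \<in> P \<Longrightarrow> (\<Oplus>\<^bsub>R\<^esub>j\<in>Q. c j \<otimes>\<^bsub>R\<^esub> a i j) = \<zero>\<^bsub>R\<^esub>) \<Longrightarrow>
    j \<in> Q \<Longrightarrow> c j = \<zero>\<^bsub>R\<^esub>) \<Longrightarrow> nonsingular_sub R a P Q"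
  unfolding nonsingular_sub_def by blast

definition standard_mat :: "('a, 'b) ring_scheme \<Rightarrow> nat \<Rightarrow> nat \<Rightarrow> (nat \<Rightarrow> nat \<Rightarrow> 'a) \<Rightarrow> 'a mat" where
  "standard_mat R n m a =
    mat n (n + m) (\<lambda>(i, j). if j < n then if i = j then \<one>\<^bsub>R\<^esub> else \<zero>\<^bsub>R\<^esub> else a i (j - n))"

context Ring.field
begin

text \<open>The sum of all \<open>y i * a i j * c j\<close> is evaluated in two ways. If
  \<open>y\<close> is a vanishing combination of rows with \<open>y i0\<close> nonzero, then
  omitting row \<open>i0\<close> leaves fewer equations than unknowns, hence a nonzero
  \<open>c\<close> that the other rows annihilate. Column by column the sum is 0; row by row it is
  \<open>y i0\<close> times the value of row \<open>i0\<close> on \<open>c\<close>. So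
  \<open>c\<close> is in the kernel.\<close>

lemma nonsingular_sub_transpose:
  assumes fin: "finite P" "finite Q" and card: "card P = card Q"
    and a: "\<And>i j. i \<in> P \<Longrightarrow> j \<in> Q \<Longrightarrow> a i j \<in> carrier R"
    and ns: "nonsingular_sub R a P Q"
  shows "nonsingular_sub R (\<lambda>j i. a i j) Q P"
proof (rule nonsingular_subI, rule ccontr)
  fix y i0
  assume y: "y \<in> P \<rightarrow> carrier R" and i0: "i0 \<in> P" "y i0 \<noteq> \<zero>"
    and eqs: "\<And>j. j \<in> Q \<Longrightarrow> (\<Oplus>i\<in>P. y i \<otimes> a i j) = \<zero>"
  have yc: "y i \<in> carrier R" if "i \<in> P" for i using y that by blast
  have "card (P - {i0}) < card Q"
    using fin i0 card by (metis card_Diff1_less)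
  then have "\<exists>c\<in>Q \<rightarrow> carrier R. (\<exists>j\<in>Q. c j \<noteq> \<zero>) \<and> (\<forall>i\<in>P - {i0}. (\<Oplus>j\<in>Q. c j \<otimes> a i j) = \<zero>)"
    by (intro homogeneous_solution) (use fin a in auto)
  then obtain c where c: "c \<in> Q \<rightarrow> carrier R" "\<exists>j\<in>Q. c j \<noteq> \<zero>"
      "\<And>i. i \<in> P - {i0} \<Longrightarrow> (\<Oplus>j\<in>Q. c j \<otimes> a i j) = \<zero>"
    by blast
  have cc: "c j \<in> carrier R" if "j \<in> Q" for j using c(1) that by blast
  define r where "r i = (\<Oplus>j\<in>Q. c j \<otimes> a i j)" for i
  have r: "r i \<in> carrier R" if "i \<in> P" for i
    unfolding r_def using cc a that by (intro finsum_closed) auto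
  have "(\<Oplus>i\<in>P. y i \<otimes> r i) = (\<Oplus>i\<in>P. \<Oplus>j\<in>Q. y i \<otimes> (c j \<otimes> a i j))"
    unfolding r_def using yc cc a fin
    by (intro finsum_cong') (auto intro!: finsum_rdistr finsum_closed)
  also have "\<dots> = (\<Oplus>j\<in>Q. \<Oplus>i\<in>P. y i \<otimes> (c j \<otimes> a i j))"
    using yc cc a fin by (intro finsum_finsum_swap) auto
  also have "\<dots> = (\<Oplus>j\<in>Q. \<zero>)"
  proof (rule finsum_cong')
    fix j assume j: "j \<in> Q"
    have "(\<Oplus>i\<in>P. y i \<otimes> (c j \<otimes> a i j)) = (\<Oplus>i\<in>P. c j \<otimes> (y i \<otimes> a i j))"
      using yc cc a j by (intro finsum_cong') (auto simp: m_lcomm)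
    also have "\<dots> = c j \<otimes> (\<Oplus>i\<in>P. y i \<otimes> a i j)"
      using yc cc a j fin by (intro finsum_rdistr[symmetric]) auto
    finally show "(\<Oplus>i\<in>P. y i \<otimes> (c j \<otimes> a i j)) = \<zero>"
      using eqs[OF j] cc[OF j] by simp
  qed auto
  finally have "(\<Oplus>i\<in>P. y i \<otimes> r i) = \<zero>" by simp
  moreover have "(\<Oplus>i\<in>P. y i \<otimes> r i) = (\<Oplus>i\<in>P. if i0 = i then y i \<otimes> r i else \<zero>)"
    using yc r c(3) by (intro finsum_cong') (auto simp: r_def)
  moreover have "\<dots> = y i0 \<otimes> r i0"
    using yc r i0 fin by (intro finsum_singleton) auto
  ultimately have "r i0 = \<zero>"
    using integral_iff i0 yc r by metis
  then have "(\<Oplus>j\<in>Q. c j \<otimes> a i j) = \<zero>" if "i \<in> P" for i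
    using c(3) that by (cases "i = i0") (auto simp: r_def)
  then show False
    using nonsingular_subD[OF ns c(1)] c(2) by blast
qed

lemma nonsingular_sub_transpose_iff:
  assumes "finite P" "finite Q" "card P = card Q"
    and "\<And>i j. i \<in> P \<Longrightarrow> j \<in> Q \<Longrightarrow> a i j \<in> carrier R"
  shows "nonsingular_sub R (\<lambda>j i. a i j) Q P \<longleftrightarrow> nonsingular_sub R a P Q"
  using nonsingular_sub_transpose[of P Q a] nonsingular_sub_transpose[of Q P "\<lambda>j i. a i j"] assms
  by auto

text \<open>This turns the count for \<open>K + 1\<close> rows into the count for
  \<open>K + 1\<close> columns, so that one argument serves both rank and nullity.\<close>

lemma card_minors_transpose:
  assumes "\<And>i j. i < n \<Longrightarrow> j < m \<Longrightarrow> a i j \<in> carrier R"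
  shows "card (minors R m n (\<lambda>j i. a i j)) = card (minors R n m a)"
proof -
  have "nonsingular_sub R (\<lambda>j i. a i j) Q P \<longleftrightarrow> nonsingular_sub R a P Q"
    if "P \<subseteq> {..<n}" "Q \<subseteq> {..<m}" "card P = card Q" for P Q
    using that assms by (intro nonsingular_sub_transpose_iff) (auto intro: finite_subset)
  then have "minors R m n (\<lambda>j i. a i j) = prod.swap ` minors R n m a"
    unfolding minors_def by (auto simp: image_def)
  then show ?thesis
    by (simp add: card_image)
qed

text \<open>The coefficients of the unit columns in \<open>S\<close> can absorb any value in their
  rows. What remains are the equations in the rows whose unit column is missing, for the chosen
  columns of \<open>a\<close>.\<close>

lemma indep_columns_standard_mat:
  assumes a: "\<And>i j. i < n \<Longrightarrow> j < m \<Longrightarrow> a i j \<in> carrier R" and S: "S \<subseteq> {..<n + m}"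
  shows "indep_columns R (standard_mat R n m a) S \<longleftrightarrow>
    nonsingular_sub R a {i. i < n \<and> i \<notin> S} {j. n + j \<in> S}"
    (is "_ \<longleftrightarrow> nonsingular_sub R a ?P ?Q")
proof -
  let ?M = "standard_mat R n m a"
  have fS: "finite S" using S finite_subset by blast
  have Sn: "S = (S \<inter> {..<n}) \<union> (\<lambda>j. n + j) ` ?Q"
    by (auto simp: image_iff) (metis le_add_diff_inverse not_le)
  have Q: "?Q \<subseteq> {..<m}" using S by auto
  then have fQ: "finite ?Q" using finite_subset by blast
  have row: "(\<Oplus>j\<in>S. d j \<otimes> ?M $$ (i, j)) =
      (if i \<in> S then d i else \<zero>) \<oplus> (\<Oplus>j\<in>?Q. d (n + j) \<otimes> a i j)"
    if d: "d \<in> S \<rightarrow> carrier R" and i: "i < n" for d i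
  proof -
    have dc: "d j \<in> carrier R" if "j \<in> S" for j using d that by blast
    have M1: "?M $$ (i, j) = (if i = j then \<one> else \<zero>)" if "j < n" for j
      using that i by (simp add: standard_mat_def)
    have M2: "?M $$ (i, n + j) = a i j" if "j < m" for j
      using that i by (simp add: standard_mat_def)
    have "(\<Oplus>j\<in>S. d j \<otimes> ?M $$ (i, j)) = (\<Oplus>j\<in>(S \<inter> {..<n}) \<union> (\<lambda>j. n + j) ` ?Q. d j \<otimes> ?M $$ (i, j))"
      using Sn by simp
    also have "\<dots> = (\<Oplus>j\<in>S \<inter> {..<n}. d j \<otimes> ?M $$ (i, j)) \<oplus>
        (\<Oplus>j\<in>(\<lambda>j. n + j) ` ?Q. d j \<otimes> ?M $$ (i, j))"
    proof (rule finsum_Un_disjoint)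
      show "(\<lambda>j. d j \<otimes> ?M $$ (i, j)) \<in> (\<lambda>j. n + j) ` ?Q \<rightarrow> carrier R"
        using dc M2 a i Q by auto
    qed (use fS fQ dc M1 in auto)
    also have "(\<Oplus>j\<in>S \<inter> {..<n}. d j \<otimes> ?M $$ (i, j)) = (if i \<in> S then d i else \<zero>)"
    proof -
      have "(\<Oplus>j\<in>S \<inter> {..<n}. d j \<otimes> ?M $$ (i, j)) = (\<Oplus>j\<in>S \<inter> {..<n}. if i = j then d j else \<zero>)"
        using dc M1 by (intro finsum_cong') auto
      also have "\<dots> = (if i \<in> S then d i else \<zero>)"
      proof (cases "i \<in> S")
        case True
        then show ?thesis
          using i dc fS finsum_singleton[of i "S \<inter> {..<n}" d] by auto
      next
        case False
        then have "(\<Oplus>j\<in>S \<inter> {..<n}. if i = j then d j else \<zero>) = (\<Oplus>j\<in>S \<inter> {..<n}. \<zero>)"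
          by (intro finsum_cong') auto
        with False show ?thesis by simp
      qed
      finally show ?thesis .
    qed
    also have "(\<Oplus>j\<in>(\<lambda>j. n + j) ` ?Q. d j \<otimes> ?M $$ (i, j)) = (\<Oplus>j\<in>?Q. d (n + j) \<otimes> ?M $$ (i, n + j))"
      using dc M2 a i Q by (intro finsum_reindex) (auto simp: inj_on_def)
    also have "\<dots> = (\<Oplus>j\<in>?Q. d (n + j) \<otimes> a i j)"
      using dc M2 a i Q by (intro finsum_cong') auto
    finally show ?thesis .
  qed
  have dim: "dim_row ?M = n" by (simp add: standard_mat_def)
  show ?thesis
  proof
    assume indep: "indep_columns R ?M S"
    show "nonsingular_sub R a ?P ?Q"
    proof (rule nonsingular_subI)
      fix c j
      assume c: "c \<in> ?Q \<rightarrow> carrier R" and j: "j \<in> ?Q"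
        and eqs: "\<And>i. i \<in> ?P \<Longrightarrow> (\<Oplus>j\<in>?Q. c j \<otimes> a i j) = \<zero>"
      have cc: "c j \<in> carrier R" if "n + j \<in> S" for j using c that by blast
      define r where "r i = (\<Oplus>j\<in>?Q. c j \<otimes> a i j)" for i
      have r: "r i \<in> carrier R" if "i < n" for i
        unfolding r_def using cc a that Q by (intro finsum_closed) auto
      \<comment> \<open>The unit columns cancel the contribution of \<open>c\<close> in their own
        rows; the rows without a unit column vanish by \<open>eqs\<close>.\<close>
      define d where "d j = (if j < n then \<ominus> r j else c (j - n))" for j
      have d: "d \<in> S \<rightarrow> carrier R"
      proof
        fix j assume "j \<in> S"
        then show "d j \<in> carrier R"
          using r[of j] cc[of "j - n"] by (cases "j < n") (auto simp: d_def)
      qed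
      have "(\<Oplus>j\<in>S. d j \<otimes> ?M $$ (i, j)) = \<zero>" if i: "i < n" for i
      proof -
        have "(\<Oplus>j\<in>?Q. d (n + j) \<otimes> a i j) = r i"
          unfolding r_def by (simp add: d_def)
        then show ?thesis
          using eqs[of i] i r[OF i] unfolding row[OF d i] by (auto simp: d_def r_def[symmetric] l_neg)
      qed
      then have "d (n + j) = \<zero>"
        using indep d j unfolding indep_columns_def dim by blast
      then show "c j = \<zero>" by (simp add: d_def)
    qed
  next
    assume ns: "nonsingular_sub R a ?P ?Q"
    show "indep_columns R ?M S"
      unfolding indep_columns_def dim
    proof (intro ballI impI)
      fix d s
      assume d: "d \<in> S \<rightarrow> carrier R" and eqs: "\<forall>i<n. (\<Oplus>j\<in>S. d j \<otimes> ?M $$ (i, j)) = \<zero>"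
        and s: "s \<in> S"
      have dc: "d j \<in> carrier R" if "j \<in> S" for j using d that by blast
      have sum: "(\<Oplus>j\<in>?Q. d (n + j) \<otimes> a i j) \<in> carrier R" if "i < n" for i
        using dc a that Q by (intro finsum_closed) auto
      have eqs': "(if i \<in> S then d i else \<zero>) \<oplus> (\<Oplus>j\<in>?Q. d (n + j) \<otimes> a i j) = \<zero>" if "i < n" for i
        using eqs row[OF d that] that by auto
      have dQ: "d (n + j) = \<zero>" if "j \<in> ?Q" for j
      proof (rule nonsingular_subD[OF ns _ _ that])
        show "(\<lambda>j. d (n + j)) \<in> ?Q \<rightarrow> carrier R" using dc by auto
        show "(\<Oplus>j\<in>?Q. d (n + j) \<otimes> a i j) = \<zero>" if "i \<in> ?P" for i
          using eqs'[of i] sum[of i] that by auto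
      qed
      show "d s = \<zero>"
      proof (cases "s < n")
        case True
        have "(\<Oplus>j\<in>?Q. d (n + j) \<otimes> a s j) = (\<Oplus>j\<in>?Q. \<zero>)"
          using dQ a True Q by (intro finsum_cong') auto
        then show ?thesis using eqs'[OF True] s dc by simp
      next
        case False
        then show ?thesis using dQ[of "s - n"] s by simp
      qed
    qed
  qed
qed

lemma matroid_standard_mat:
  assumes a: "\<And>i j. i < n \<Longrightarrow> j < m \<Longrightarrow> a i j \<in> carrier R"
  shows "matroid {..<n + m} (column_matroid R (standard_mat R n m a))"
  using matroid_column_matroid[of "standard_mat R n m a"] a
  by (auto simp: standard_mat_def)

lemma bases_standard_mat:
  assumes a: "\<And>i j. i < n \<Longrightarrow> j < m \<Longrightarrow> a i j \<in> carrier R"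
  shows "matroid_rank (column_matroid R (standard_mat R n m a)) = n" 
    and "bases (column_matroid R (standard_mat R n m a)) = {S. S \<subseteq> {..<n + m} \<and> card S = n \<and>
      nonsingular_sub R a {i. i < n \<and> i \<notin> S} {j. n + j \<in> S}}"
proof -
  let ?I = "column_matroid R (standard_mat R n m a)"
  let ?M = "standard_mat R n m a"
  have dim: "dim_row ?M = n" "dim_col ?M = n + m" by (simp_all add: standard_mat_def)
  have I: "?I = {S. S \<subseteq> {..<n + m} \<and> nonsingular_sub R a {i. i < n \<and> i \<notin> S} {j. n + j \<in> S}}"
    unfolding column_matroid_def dim using indep_columns_standard_mat[OF a] by auto
  have le: "card S \<le> n" if "S \<in> ?I" for S
  proof (rule ccontr)
    assume gt: "\<not> card S \<le> n"
    have S: "S \<subseteq> {..<n + m}" "indep_columns R ?M S" "finite S"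
      using that finite_subset by (auto simp: column_matroid_def dim)
    obtain c where "c \<in> S \<rightarrow> carrier R" "\<exists>j\<in>S. c j \<noteq> \<zero>" "\<forall>i\<in>{..<n}. (\<Oplus>j\<in>S. c j \<otimes> ?M $$ (i, j)) = \<zero>"
    proof -
      have "?M $$ (i, j) \<in> carrier R" if "i < n" "j \<in> S" for i j
        using that S(1) a by (auto simp: standard_mat_def subset_eq)
      then show ?thesis
        using homogeneous_solution[of "{..<n}" S "\<lambda>i j. ?M $$ (i, j)"] gt S(3) that by auto
    qed
    then show False using S(2) unfolding indep_columns_def dim by blast
  qed
  \<comment> \<open>The unit columns alone select no column of \<open>a\<close>. They are therefore
    independent, and the rank is \<open>n\<close> whatever the entries are.\<close>
  have "{j. n + j \<in> {..<n}} = {}" by auto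
  then have n: "{..<n} \<in> ?I"
    unfolding I by (auto simp: nonsingular_sub_def)
  have basis: "S \<in> bases ?I" if "S \<in> ?I" "card S = n" for S
  proof -
    have "T = S" if T: "T \<in> ?I" "S \<subseteq> T" for T
    proof -
      have "finite T" using T(1) finite_subset by (auto simp: I)
      then show ?thesis using card_seteq[OF _ T(2)] le[OF T(1)] \<open>card S = n\<close> by simp
    qed
    with that show ?thesis by (auto simp: bases_def)
  qed
  then show rank: "matroid_rank ?I = n"
    using matroid_card_basis[OF matroid_standard_mat[OF a] basis[OF n]] by simp
  have "card S = n" "S \<in> ?I" if "S \<in> bases ?I" for S
    using matroid_card_basis[OF matroid_standard_mat[OF a] that] rank that by (auto simp: bases_def)
  with basis have "bases ?I = {S \<in> ?I. card S = n}" by auto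
  also have "\<dots> = {S. S \<subseteq> {..<n + m} \<and> card S = n \<and>
      nonsingular_sub R a {i. i < n \<and> i \<notin> S} {j. n + j \<in> S}}"
    unfolding I by auto
  finally show "bases ?I = \<dots>" .
qed

text \<open>A set of \<open>n\<close> columns misses as many unit columns as it takes columns of
  \<open>a\<close>, so \<open>split\<close> yields exactly the square submatrices.\<close>

lemma card_bases_standard_mat:
  assumes a: "\<And>i j. i < n \<Longrightarrow> j < m \<Longrightarrow> a i j \<in> carrier R"
  shows "card (bases (column_matroid R (standard_mat R n m a))) = card (minors R n m a)"
proof -
  define split where "split S = ({i. i < n \<and> i \<notin> S}, {j. n + j \<in> S})" for S :: "nat set"
  define join where "join PQ = ({..<n} - fst PQ) \<union> (\<lambda>j. n + j) ` snd PQ" for PQ :: "nat set \<times> nat set"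
  have B: "bases (column_matroid R (standard_mat R n m a)) = {S. S \<subseteq> {..<n + m} \<and> card S = n \<and>
      nonsingular_sub R a {i. i < n \<and> i \<notin> S} {j. n + j \<in> S}}"
    by (rule bases_standard_mat(2)) (rule a)
  have js: "join (split S) = S" if "S \<subseteq> {..<n + m}" for S
    using that unfolding join_def split_def
    by (auto simp: image_iff) (metis le_add_diff_inverse not_le)
  have sj: "split (join (P, Q)) = (P, Q)" if "P \<subseteq> {..<n}" for P Q
    using that unfolding join_def split_def by auto
  have card: "card (join (P, Q)) = n - card P + card Q" if "P \<subseteq> {..<n}" "Q \<subseteq> {..<m}" for P Q
  proof -
    have "card (join (P, Q)) = card ({..<n} - P) + card ((\<lambda>j. n + j) ` Q)"
      unfolding join_def using that finite_subset by (subst card_Un_disjoint) auto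
    then show ?thesis using that by (simp add: card_image card_Diff_subset finite_subset[OF that(1)])
  qed
  have le: "card P \<le> n" if "P \<subseteq> {..<n}" for P
    using card_mono[OF _ that] by simp
  have "bij_betw split (bases (column_matroid R (standard_mat R n m a))) (minors R n m a)"
  proof (rule bij_betw_byWitness[where f' = join])
    show "\<forall>S\<in>bases (column_matroid R (standard_mat R n m a)). join (split S) = S"
      using js by (auto simp: B)
    show "\<forall>PQ\<in>minors R n m a. split (join PQ) = PQ"
      using sj by (auto simp: minors_def)
    show "split ` bases (column_matroid R (standard_mat R n m a)) \<subseteq> minors R n m a"
    proof (rule image_subsetI)
      fix S assume "S \<in> bases (column_matroid R (standard_mat R n m a))"
      then obtain P Q where S: "S \<in> bases (column_matroid R (standard_mat R n m a))" "split S = (P, Q)"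
        by (cases "split S") auto
      then have S': "S \<subseteq> {..<n + m}" "card S = n" "nonsingular_sub R a P Q"
        by (auto simp: B split_def)
      have PQ: "P \<subseteq> {..<n}" "Q \<subseteq> {..<m}" using S S'(1) by (auto simp: split_def)
      have "n - card P + card Q = n" using card[OF PQ] js[OF S'(1)] S(2) S'(2) by simp
      then have "card P = card Q" using le[OF PQ(1)] by simp
      with PQ S' show "split S \<in> minors R n m a" by (simp add: minors_def S(2))
    qed
    show "join ` minors R n m a \<subseteq> bases (column_matroid R (standard_mat R n m a))"
    proof (clarify)
      fix P Q assume "(P, Q) \<in> minors R n m a"
      then have PQ: "P \<subseteq> {..<n}" "Q \<subseteq> {..<m}" "card P = card Q" "nonsingular_sub R a P Q"
        by (auto simp: minors_def)
      have "join (P, Q) \<subseteq> {..<n + m}" using PQ by (auto simp: join_def)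
      moreover have "card (join (P, Q)) = n" using card[OF PQ(1,2)] le[OF PQ(1)] PQ(3) by simp
      moreover have "{i. i < n \<and> i \<notin> join (P, Q)} = P" "{j. n + j \<in> join (P, Q)} = Q"
        using sj[OF PQ(1), of Q] by (simp_all add: split_def)
      ultimately show "join (P, Q) \<in> bases (column_matroid R (standard_mat R n m a))"
        using PQ(4) unfolding B by auto
    qed
  qed
  then show ?thesis by (rule bij_betw_same_card)
qed

end

section \<open>The entry that decides about selections\<close>

definition selection_entry ::
  "('a, 'b) ring_scheme \<Rightarrow> nat \<Rightarrow> nat \<Rightarrow> (nat \<Rightarrow> nat) \<Rightarrow> (nat \<Rightarrow> 'a) \<Rightarrow> 'a \<Rightarrow> nat \<Rightarrow> nat \<Rightarrow> 'a" where
  "selection_entry R K N ty x s i j =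
    (if i < K then if j < N \<and> ty j \<noteq> i then \<zero>\<^bsub>R\<^esub> else \<one>\<^bsub>R\<^esub> else if j < N then x j else s)"

text \<open>Types may be left out here. Incomplete selections are excluded later, by the type bits
  of the target sum.\<close>

definition selections ::
  "('a, 'b) ring_scheme \<Rightarrow> nat \<Rightarrow> (nat \<Rightarrow> nat) \<Rightarrow> (nat \<Rightarrow> 'a) \<Rightarrow> 'a \<Rightarrow> nat set set" where
  "selections R N ty x s = {Q. Q \<subseteq> {..<N} \<and> inj_on ty Q \<and> (\<Oplus>\<^bsub>R\<^esub>j\<in>Q. x j) = s}"

context Ring.field
begin

lemma selection_entry_closed:
  "(\<And>j. j < N \<Longrightarrow> x j \<in> carrier R) \<Longrightarrow> s \<in> carrier R \<Longrightarrow> selection_entry R K N ty x s i j \<in> carrier R"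
  by (simp add: selection_entry_def)

text \<open>For a kernel vector \<open>c\<close>, row \<open>ty k\<close> reads
  \<open>c N + c k = 0\<close>. So \<open>c\<close> is determined by \<open>c N\<close>, and the
  last row says that \<open>c N\<close> times the difference of \<open>s\<close> and the sum of the
  weights is 0.\<close>

lemma nonsingular_selection:
  assumes x: "\<And>j. j < N \<Longrightarrow> x j \<in> carrier R" and s: "s \<in> carrier R"
    and ty: "\<And>j. j < N \<Longrightarrow> ty j < K"
    and Q: "Q \<subseteq> {..<N}" and inj: "inj_on ty Q"
  shows "nonsingular_sub R (selection_entry R K N ty x s) (insert K (ty ` Q)) (insert N Q) \<longleftrightarrow>
    (\<Oplus>j\<in>Q. x j) \<noteq> s"
proof -
  let ?a = "selection_entry R K N ty x s"
  have fQ: "finite Q" "N \<notin> Q" using Q finite_subset by auto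
  have xQ: "x j \<in> carrier R" if "j \<in> Q" for j using that Q x by auto
  have xs: "(\<Oplus>j\<in>Q. x j) \<in> carrier R" using xQ by (intro finsum_closed) auto
  have ty_row: "(\<Oplus>j\<in>insert N Q. c j \<otimes> ?a (ty k) j) = c N \<oplus> c k"
    if c: "c \<in> insert N Q \<rightarrow> carrier R" and k: "k \<in> Q" for c k
  proof -
    have cc: "c N \<in> carrier R" "\<And>j. j \<in> Q \<Longrightarrow> c j \<in> carrier R" using c by auto
    have "ty k < K" using k Q ty by auto
    have "(\<Oplus>j\<in>insert N Q. c j \<otimes> ?a (ty k) j) = c N \<otimes> ?a (ty k) N \<oplus> (\<Oplus>j\<in>Q. c j \<otimes> ?a (ty k) j)"
      using fQ cc selection_entry_closed[OF x s] by (intro finsum_insert) auto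
    also have "(\<Oplus>j\<in>Q. c j \<otimes> ?a (ty k) j) = (\<Oplus>j\<in>Q. if k = j then c j else \<zero>)"
      using cc Q \<open>ty k < K\<close> inj k
      by (intro finsum_cong') (auto simp: selection_entry_def inj_on_def)
    also have "\<dots> = c k" using fQ cc k by (intro finsum_singleton) auto
    finally show ?thesis using cc \<open>ty k < K\<close> by (simp add: selection_entry_def)
  qed
  have last_row: "(\<Oplus>j\<in>insert N Q. c j \<otimes> ?a K j) = c N \<otimes> s \<oplus> (\<Oplus>j\<in>Q. c j \<otimes> x j)"
    if c: "c \<in> insert N Q \<rightarrow> carrier R" for c
  proof -
    have cc: "c N \<in> carrier R" "\<And>j. j \<in> Q \<Longrightarrow> c j \<in> carrier R" using c by auto
    have "(\<Oplus>j\<in>insert N Q. c j \<otimes> ?a K j) = c N \<otimes> ?a K N \<oplus> (\<Oplus>j\<in>Q. c j \<otimes> ?a K j)"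
      using fQ cc selection_entry_closed[OF x s] by (intro finsum_insert) auto
    also have "(\<Oplus>j\<in>Q. c j \<otimes> ?a K j) = (\<Oplus>j\<in>Q. c j \<otimes> x j)"
      using cc Q x by (intro finsum_cong') (auto simp: selection_entry_def)
    finally show ?thesis by (simp add: selection_entry_def)
  qed
  show ?thesis
  proof
    assume ns: "nonsingular_sub R ?a (insert K (ty ` Q)) (insert N Q)"
    show "(\<Oplus>j\<in>Q. x j) \<noteq> s"
    proof
      assume sum: "(\<Oplus>j\<in>Q. x j) = s"
      define c where "c j = (if j = N then \<one> else \<ominus> \<one>)" for j
      have c: "c \<in> insert N Q \<rightarrow> carrier R" by (auto simp: c_def)
      have "(\<Oplus>j\<in>insert N Q. c j \<otimes> ?a i j) = \<zero>" if i: "i \<in> insert K (ty ` Q)" for i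
      proof (cases "i = K")
        case True
        have "(\<Oplus>j\<in>Q. c j \<otimes> x j) = (\<Oplus>j\<in>Q. \<ominus> \<one> \<otimes> x j)"
          using fQ xQ by (intro finsum_cong') (auto simp: c_def)
        also have "\<dots> = \<ominus> \<one> \<otimes> s"
          unfolding sum[symmetric] using fQ xQ by (intro finsum_rdistr[symmetric]) auto
        finally show ?thesis unfolding True last_row[OF c] using s by (simp add: c_def l_minus r_neg)
      next
        case False
        then obtain k where "k \<in> Q" "i = ty k" using i by auto
        then show ?thesis using ty_row[OF c] fQ by (auto simp: c_def r_neg)
      qed
      then have "c N = \<zero>" using nonsingular_subD[OF ns c] by blast
      then show False by (simp add: c_def)
    qed
  next
    assume sum: "(\<Oplus>j\<in>Q. x j) \<noteq> s"
    show "nonsingular_sub R ?a (insert K (ty ` Q)) (insert N Q)"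
    proof (rule nonsingular_subI)
      fix c j
      assume c: "c \<in> insert N Q \<rightarrow> carrier R" and j: "j \<in> insert N Q"
        and eqs: "\<And>i. i \<in> insert K (ty ` Q) \<Longrightarrow> (\<Oplus>j\<in>insert N Q. c j \<otimes> ?a i j) = \<zero>"
      have cc: "c N \<in> carrier R" "\<And>j. j \<in> Q \<Longrightarrow> c j \<in> carrier R" using c by auto
      have ck: "c k = \<ominus> c N" if "k \<in> Q" for k
        using eqs[of "ty k"] ty_row[OF c that] that cc by (metis image_eqI insertI2 add.m_comm minus_equality)
      have "(\<Oplus>j\<in>Q. c j \<otimes> x j) = (\<Oplus>j\<in>Q. \<ominus> c N \<otimes> x j)"
        using cc xQ ck by (intro finsum_cong') auto
      also have "\<dots> = \<ominus> c N \<otimes> (\<Oplus>j\<in>Q. x j)"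
        using fQ xQ cc by (intro finsum_rdistr[symmetric]) auto
      finally have "c N \<otimes> s \<oplus> \<ominus> c N \<otimes> (\<Oplus>j\<in>Q. x j) = \<zero>"
        using eqs[of K] last_row[OF c] by simp
      moreover have "c N \<otimes> s \<oplus> \<ominus> c N \<otimes> (\<Oplus>j\<in>Q. x j) = c N \<otimes> (s \<ominus> (\<Oplus>j\<in>Q. x j))"
        using s xs cc(1) by algebra
      ultimately have "c N = \<zero> \<or> s \<ominus> (\<Oplus>j\<in>Q. x j) = \<zero>"
        using integral_iff[OF cc(1), of "s \<ominus> (\<Oplus>j\<in>Q. x j)"] s xs by simp
      then have "c N = \<zero>"
        using sum s xs by (metis r_right_minus_eq)
      then show "c j = \<zero>" using ck j by auto
    qed
  qed
qed

text \<open>The entry is visible only if the last row and the last column are both selected. Then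
  some other row of \<open>P\<close> meets no item of \<open>Q\<close> and reads
  \<open>c N = 0\<close> for a kernel vector \<open>c\<close>, so both values of the entry are
  multiplied by 0. The implication is symmetric in \<open>s\<close> and \<open>s'\<close>.\<close>

lemma nonsingular_selection_indep_target:
  assumes x: "\<And>j. j < N \<Longrightarrow> x j \<in> carrier R" and s: "s \<in> carrier R" "s' \<in> carrier R"
    and ty: "\<And>j. j < N \<Longrightarrow> ty j < K"
    and P: "P \<subseteq> {..<Suc K}" and Q: "Q \<subseteq> {..<Suc N}" and card: "card P = card Q"
    and no: "\<not> (K \<in> P \<and> N \<in> Q \<and> inj_on ty (Q - {N}) \<and> P - {K} = ty ` (Q - {N}))"
    and ns: "nonsingular_sub R (selection_entry R K N ty x s) P Q"
  shows "nonsingular_sub R (selection_entry R K N ty x s') P Q"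
proof -
  let ?a = "selection_entry R K N ty x"
  have fin: "finite P" "finite Q" using P Q finite_subset by auto
  show ?thesis
  proof (rule nonsingular_subI)
    fix c j
    assume c: "c \<in> Q \<rightarrow> carrier R" and j: "j \<in> Q"
      and eqs: "\<And>i. i \<in> P \<Longrightarrow> (\<Oplus>j\<in>Q. c j \<otimes> ?a s' i j) = \<zero>"
    have cc: "c j \<in> carrier R" if "j \<in> Q" for j using c that by blast
    have "N \<in> Q \<Longrightarrow> K \<in> P \<Longrightarrow> c N = \<zero>"
    proof -
      assume NQ: "N \<in> Q" and KP: "K \<in> P"
      \<comment> \<open>Pigeonhole: the two index sets have equal size, so if every row were met,
        \<open>ty\<close> would be a bijection between them, which \<open>no\<close>
        excludes.\<close>
      have "\<not> P - {K} \<subseteq> ty ` (Q - {N})"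
      proof
        assume sub: "P - {K} \<subseteq> ty ` (Q - {N})"
        have eq: "card (P - {K}) = card (Q - {N})" using card NQ KP by simp
        have "card (P - {K}) \<le> card (ty ` (Q - {N}))" using sub fin by (intro card_mono) auto
        then have "card (ty ` (Q - {N})) = card (Q - {N})"
          using eq card_image_le[of "Q - {N}" ty] fin by simp
        then have "inj_on ty (Q - {N})" using fin by (intro eq_card_imp_inj_on) auto
        moreover have "P - {K} = ty ` (Q - {N})"
          using sub fin eq card_image_le[of "Q - {N}" ty] by (intro card_seteq) auto
        ultimately show False using no NQ KP by simp
      qed
      then obtain t where t: "t \<in> P" "t \<noteq> K" "t \<notin> ty ` (Q - {N})" by blast
      have "t < K" using t P by auto
      have "(\<Oplus>j\<in>Q. c j \<otimes> ?a s' t j) = (\<Oplus>j\<in>Q. if N = j then c j else \<zero>)"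
        using cc Q t \<open>t < K\<close> by (intro finsum_cong') (auto simp: selection_entry_def)
      also have "\<dots> = c N" using fin cc NQ by (intro finsum_singleton) auto
      finally show "c N = \<zero>" using eqs[OF t(1)] by simp
    qed
    then have "c j \<otimes> ?a s i j = c j \<otimes> ?a s' i j" if "i \<in> P" "j \<in> Q" for i j
      using that s P Q by (cases "i = K"; cases "j = N") (auto simp: selection_entry_def)
    then have "(\<Oplus>j\<in>Q. c j \<otimes> ?a s i j) = (\<Oplus>j\<in>Q. c j \<otimes> ?a s' i j)" if "i \<in> P" for i
      using that cc selection_entry_closed[OF x s(2)] by (intro finsum_cong') auto
    then show "c j = \<zero>" using nonsingular_subD[OF ns c _ j] eqs by simp
  qed
qed

text \<open>Only the square submatrices that consist of the last row and column and of one column for each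
  further row feel the entry \<open>s\<close>; they are singular exactly for the selections with sum \<open>s\<close>.\<close>

lemma card_minors_selection:
  assumes x: "\<And>j. j < N \<Longrightarrow> x j \<in> carrier R" and s: "s \<in> carrier R" "s' \<in> carrier R"
    and ty: "\<And>j. j < N \<Longrightarrow> ty j < K"
  shows "card (minors R (Suc K) (Suc N) (selection_entry R K N ty x s)) + card (selections R N ty x s) =
    card (minors R (Suc K) (Suc N) (selection_entry R K N ty x s')) + card (selections R N ty x s')"
proof -
  define Z where "Z = {Q. Q \<subseteq> {..<N} \<and> inj_on ty Q}"
  define U where "U = {(P, Q). P \<subseteq> {..<Suc K} \<and> Q \<subseteq> {..<Suc N} \<and> card P = card Q}"
  define g where "g Q = (insert K (ty ` Q), insert N Q)" for Q
  define A where "A s = {(P, Q). nonsingular_sub R (selection_entry R K N ty x s) P Q}" for s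
  have "Z \<subseteq> Pow {..<N}" by (auto simp: Z_def)
  then have fZ: "finite Z" using finite_subset by blast
  have "U \<subseteq> Pow {..<Suc K} \<times> Pow {..<Suc N}" by (auto simp: U_def)
  then have fU: "finite U" using finite_subset by blast
  have gU: "g ` Z \<subseteq> U"
  proof
    fix PQ assume "PQ \<in> g ` Z"
    then obtain Q where Q: "Q \<subseteq> {..<N}" "inj_on ty Q" "PQ = g Q" by (auto simp: Z_def)
    have "finite Q" using Q(1) finite_subset by blast
    moreover have "ty ` Q \<subseteq> {..<K}" using Q(1) ty by auto
    moreover from this have "K \<notin> ty ` Q" by auto
    moreover have "N \<notin> Q" using Q(1) by auto
    ultimately have "card (insert K (ty ` Q)) = card (insert N Q)"
      using Q(2) by (simp add: card_image)
    then show "PQ \<in> U"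
      using Q \<open>ty ` Q \<subseteq> {..<K}\<close> by (auto simp: U_def g_def)
  qed
  have injg: "inj_on g Z"
  proof (rule inj_onI)
    fix Q Q' assume "Q \<in> Z" "Q' \<in> Z" "g Q = g Q'"
    then show "Q = Q'" unfolding g_def Z_def by (metis (no_types, lifting) Pair_inject insert_ident lessThan_iff less_irrefl mem_Collect_eq subsetD)
  qed
  \<comment> \<open>Within the image of \<open>Z\<close> under \<open>g\<close>, the singular pairs
    are those of the selections with sum \<open>u\<close>. Adding their number completes this part
    to \<open>card Z\<close> for every \<open>u\<close>; sums on both sides also avoid truncated
    subtraction.\<close>
  have key: "card (minors R (Suc K) (Suc N) (selection_entry R K N ty x u)) + card (selections R N ty x u) =
      card ((U - g ` Z) \<inter> A u) + card Z" if u: "u \<in> carrier R" for u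
  proof -
    have "minors R (Suc K) (Suc N) (selection_entry R K N ty x u) = U \<inter> A u"
      by (auto simp: minors_def U_def A_def)
    also have "\<dots> = ((U - g ` Z) \<inter> A u) \<union> (g ` Z \<inter> A u)"
      using gU by blast
    finally have "card (minors R (Suc K) (Suc N) (selection_entry R K N ty x u)) =
        card ((U - g ` Z) \<inter> A u) + card (g ` Z \<inter> A u)"
      using fU fZ by (simp add: card_Un_disjoint Int_Un_distrib disjoint_iff)
    moreover have "g ` Z \<inter> A u = g ` {Q \<in> Z. (\<Oplus>j\<in>Q. x j) \<noteq> u}"
      using nonsingular_selection[OF x u ty] by (auto simp: Z_def A_def g_def)
    moreover have "card (g ` {Q \<in> Z. (\<Oplus>j\<in>Q. x j) \<noteq> u}) = card {Q \<in> Z. (\<Oplus>j\<in>Q. x j) \<noteq> u}"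
      using injg by (intro card_image) (auto intro: inj_on_subset)
    moreover have "selections R N ty x u = {Q \<in> Z. (\<Oplus>j\<in>Q. x j) = u}"
      by (auto simp: selections_def Z_def)
    moreover have "card {Q \<in> Z. (\<Oplus>j\<in>Q. x j) \<noteq> u} + card {Q \<in> Z. (\<Oplus>j\<in>Q. x j) = u} = card Z"
      using fZ by (subst card_Un_disjoint[symmetric]) (auto intro: arg_cong[of _ _ card])
    ultimately show ?thesis by simp
  qed
  have sub: "(U - g ` Z) \<inter> A u \<subseteq> (U - g ` Z) \<inter> A u'" if u: "u \<in> carrier R" "u' \<in> carrier R" for u u'
  proof (clarify)
    fix P Q assume PQ: "(P, Q) \<in> U" "(P, Q) \<notin> g ` Z" "(P, Q) \<in> A u"
    have "\<not> (K \<in> P \<and> N \<in> Q \<and> inj_on ty (Q - {N}) \<and> P - {K} = ty ` (Q - {N}))"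
    proof
      assume *: "K \<in> P \<and> N \<in> Q \<and> inj_on ty (Q - {N}) \<and> P - {K} = ty ` (Q - {N})"
      then have "(P, Q) = g (Q - {N})" by (auto simp: g_def)
      moreover have "Q - {N} \<in> Z" using PQ(1) * by (auto simp: Z_def U_def)
      ultimately show False using PQ(2) by blast
    qed
    then have "nonsingular_sub R (selection_entry R K N ty x u') P Q"
      using PQ(1,3) by (intro nonsingular_selection_indep_target[OF x u ty]) (auto simp: U_def A_def)
    then show "(P, Q) \<in> (U - g ` Z) \<inter> A u'" using PQ by (simp add: A_def)
  qed
  have "(U - g ` Z) \<inter> A s = (U - g ` Z) \<inter> A s'"
    using sub[OF s] sub[OF s(2,1)] by (rule subset_antisym)
  then show ?thesis using key[OF s(1)] key[OF s(2)] by simp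
qed

end

section \<open>Selections of items and cliques\<close>

text \<open>Cancellation modulo 2 among three items: the parity is the exclusive or of the
  memberships.\<close>

lemma odd_card_three:
  assumes "A \<subseteq> {x, y, z}" "x \<noteq> y" "x \<noteq> z" "y \<noteq> z"
  shows "odd (card A) \<longleftrightarrow> (x \<in> A) \<noteq> ((y \<in> A) \<noteq> (z \<in> A))"
proof -
  have "A = (if x \<in> A then {x} else {}) \<union> (if y \<in> A then {y} else {}) \<union> (if z \<in> A then {z} else {})"
    using assms(1) by auto
  then show ?thesis
    using assms(2-) by (cases "x \<in> A"; cases "y \<in> A"; cases "z \<in> A") (simp_all del: Un_insert_left Un_insert_right, auto)
qed

lemma bit_add_shifted:
  assumes "a < (2::nat) ^ d"
  shows "bit (a + c * 2 ^ d) i \<longleftrightarrow> (if i < d then bit a i else bit c (i - d))"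
proof -
  have a: "bit a j \<Longrightarrow> j < d" for j
    using assms by (metis bit_take_bit_iff take_bit_nat_eq_self)
  have c: "bit (c * 2 ^ d) j \<longleftrightarrow> d \<le> j \<and> bit c (j - d)" for j
    using bit_push_bit_iff_nat[of d c j] by (simp add: push_bit_eq_mult)
  have "a AND (c * 2 ^ d) = 0"
    by (intro bit_eqI) (auto simp: bit_and_iff c dest: a)
  then have "a + c * 2 ^ d = a XOR (c * 2 ^ d)"
    by (rule disjunctive_add_eq_xor)
  then show ?thesis using a[of i] c[of i] by (auto simp: bit_xor_iff)
qed

lemma digit_sum_less:
  assumes "\<And>b. b < K \<Longrightarrow> d b < W"
  shows "(\<Sum>b<K. d b * W ^ b) < (W::nat) ^ K"
  using assms
proof (induction K)
  case (Suc K)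
  then have "(\<Sum>b<Suc K. d b * W ^ b) < (1 + d K) * W ^ K" by simp
  also have "\<dots> \<le> W * W ^ K" using Suc.prems[of K] by (intro mult_right_mono) auto
  finally show ?case by simp
qed simp

text \<open>Every digit fits its block of \<open>w\<close> bits, so no carries occur. Bit positions
  can then be addressed by a block \<open>b\<close> and an offset \<open>r\<close>, as is done for
  all weights.\<close>

lemma bit_digit_sum:
  assumes "\<And>b. b < K \<Longrightarrow> d b < (2::nat) ^ w" and r: "r < w"
  shows "bit (\<Sum>b<K. d b * (2 ^ w) ^ b) (b * w + r) = (b < K \<and> bit (d b) r)"
  using assms(1)
proof (induction K)
  case (Suc K)
  have "(\<Sum>b<K. d b * (2 ^ w) ^ b) < 2 ^ (w * K)"
    unfolding power_mult using Suc.prems by (intro digit_sum_less) auto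
  then have "bit (\<Sum>b<Suc K. d b * (2 ^ w) ^ b) (b * w + r) \<longleftrightarrow>
      (if b * w + r < w * K then bit (\<Sum>b<K. d b * (2 ^ w) ^ b) (b * w + r) else bit (d K) (b * w + r - w * K))"
    using bit_add_shifted[of "\<Sum>b<K. d b * (2 ^ w) ^ b" "w * K" "d K" "b * w + r"] by (simp add: power_mult)
  also have "\<dots> \<longleftrightarrow> b < Suc K \<and> bit (d b) r"
  proof (cases "b < K")
    case True
    then have "Suc b * w \<le> K * w" by (intro mult_right_mono) auto
    then have "b * w + r < w * K" using r by (simp add: mult.commute)
    then show ?thesis using True Suc by simp
  next
    case False
    then obtain c where c: "b = K + c" by (metis le_add_diff_inverse not_less)
    then have "\<not> b * w + r < w * K" "b * w + r - w * K = c * w + r" by (simp_all add: algebra_simps)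
    moreover have "\<not> bit (d K) (c * w + r)" if "c > 0"
    proof -
      have "w \<le> c * w + r" using that by (cases c) auto
      moreover have "d K < 2 ^ w" using Suc.prems by simp
      ultimately show ?thesis by (metis bit_take_bit_iff leD take_bit_nat_eq_self)
    qed
    ultimately show ?thesis using c by (cases "c = 0") auto
  qed
  finally show ?case .
qed simp

text \<open>
  An item of type \<open>t = i * k + j\<close> with \<open>i, j < k\<close> proposes \<open>u\<close> for the \<open>i\<close>-th and \<open>v\<close> for the \<open>j\<close>-th
  vertex of an increasingly ordered clique. Its weight is a number with one digit in base \<open>B\<close> for
  each type; sums of weights are taken without carries. The least significant bit of digit \<open>b\<close> says
  whether the item has type \<open>b\<close>. The remaining bits compare, for \<open>b = i * k + j\<close> with \<open>i \<noteq> j\<close>, the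
  proposal \<open>(u, v)\<close> of the item of type \<open>b\<close> with those of the diagonal items of types \<open>i * (k + 1)\<close>
  and \<open>j * (k + 1)\<close>, which have \<open>u = v\<close>. An invalid item gets weight 0 and cannot contribute its
  type bit.
\<close>

locale clique_items =
  fixes n k m :: nat and adj :: "nat \<Rightarrow> nat \<Rightarrow> bool"
  assumes n_less: "n < 2 ^ m"
begin

text \<open>As \<open>h\<close> is a power of two, \<open>u + h * v\<close> concatenates two strings
  of \<open>m\<close> bits. A digit consists of a type bit and such a pair, whence
  \<open>B = 2 * h * h\<close> and \<open>w = 2 * m + 1\<close>; \<open>N\<close> counts the triples
  of a type and two proposals. Proposals from \<open>n\<close> up to \<open>h - 1\<close> occur in
  items, but in no solution for \<open>target\<close>.\<close>

definition "h = (2::nat) ^ m"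
definition "B = 2 * h * h"
definition "K = k * k"
definition "w = 2 * m + 1"
definition "N = K * (h * h)"

definition type_of :: "nat \<Rightarrow> nat" where "type_of e = e div (h * h)"
definition src_of :: "nat \<Rightarrow> nat" where "src_of e = e div h mod h"
definition tgt_of :: "nat \<Rightarrow> nat" where "tgt_of e = e mod h"
definition item :: "nat \<Rightarrow> nat \<Rightarrow> nat \<Rightarrow> nat" where "item t u v = (t * h + u) * h + v"

text \<open>Edges are demanded above the diagonal only, together with \<open>u < v\<close>, so that
  a clique is met in one order instead of all its permutations. Below the diagonal every item is
  valid and the comparison bits alone fix it.\<close>

definition valid_item :: "nat \<Rightarrow> nat \<Rightarrow> nat \<Rightarrow> bool" where
  "valid_item t u v \<longleftrightarrow>
    (if t div k = t mod k then u = v \<and> u < n else t div k < t mod k \<longrightarrow> u < v \<and> adj u v)"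

text \<open>The factor 2 skips the type bit. In an off-diagonal block the item of that type adds
  \<open>u + h * v\<close>, the diagonal item of the first index adds its \<open>u\<close>, and that
  of the second index adds \<open>h\<close> times its \<open>v\<close>; the three cancel modulo 2
  iff the proposals agree.\<close>

definition digit :: "nat \<Rightarrow> nat \<Rightarrow> nat \<Rightarrow> nat \<Rightarrow> nat" where
  "digit b t u v = of_bool (b = t) + of_bool (b div k \<noteq> b mod k) * (2 *
    (of_bool (b = t \<or> t = b div k * (k + 1)) * u + of_bool (b = t \<or> t = b mod k * (k + 1)) * (h * v)))"

definition weight :: "nat \<Rightarrow> nat" where
  "weight e = (if valid_item (type_of e) (src_of e) (tgt_of e)
    then \<Sum>b<K. digit b (type_of e) (src_of e) (tgt_of e) * B ^ b else 0)"

text \<open>All type bits are set and all comparison bits are clear.\<close>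

definition target :: nat where "target = (\<Sum>b<K. B ^ b)"

lemma h_pos: "h > 0" and n_less_h: "n < h" and B_eq: "B = 2 ^ w"
  using n_less by (simp_all add: h_def B_def w_def power_add power_mult power2_eq_square mult_2 algebra_simps)

lemma one_less_base: "Suc 0 < 2 ^ w"
proof -
  have "0 < w" by (simp add: w_def)
  then show ?thesis using one_less_power[of "2::nat" w] by simp
qed

lemma item_simps [simp]:
  assumes "u < h" "v < h"
  shows "type_of (item t u v) = t" "src_of (item t u v) = u" "tgt_of (item t u v) = v"
  using assms h_pos
  by (simp_all add: type_of_def src_of_def tgt_of_def item_def div_mult2_eq)

lemma item_of: "item (type_of e) (src_of e) (tgt_of e) = e"
  by (simp add: type_of_def src_of_def tgt_of_def item_def div_mult2_eq)

lemma src_less: "src_of e < h" and tgt_less: "tgt_of e < h"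
  using h_pos by (simp_all add: src_of_def tgt_of_def)

lemma type_less: "e < N \<Longrightarrow> type_of e < K"
  using h_pos by (simp add: type_of_def N_def less_mult_imp_div_less)

lemma item_less:
  assumes "t < K" "u < h" "v < h"
  shows "item t u v < N"
proof -
  have "item t u v div (h * h) < K"
    using item_simps(1)[OF assms(2,3), of t] assms(1) by (simp add: type_of_def)
  then show ?thesis unfolding N_def using h_pos by (simp add: div_less_iff_less_mult)
qed

lemma diagonal: "a < k \<Longrightarrow> a * (k + 1) < K" "a < k \<Longrightarrow> a * (k + 1) div k = a" "a < k \<Longrightarrow> a * (k + 1) mod k = a"
proof -
  assume a: "a < k"
  have eq: "a * (k + 1) = a * k + a" by simp
  have "a * k + a < (a + 1) * k" using a by simp
  also have "\<dots> \<le> k * k" using a by (intro mult_right_mono) auto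
  finally show "a * (k + 1) < K" by (simp add: K_def)
  show "a * (k + 1) div k = a" "a * (k + 1) mod k = a" unfolding eq using a by simp_all
qed

lemma diagonal_iff: "t < K \<Longrightarrow> t div k = t mod k \<Longrightarrow> t = t div k * (k + 1)"
  by (metis add.commute distrib_left div_mult_mod_eq mult.commute mult.right_neutral)

lemma index_less: "t < K \<Longrightarrow> t div k < k" "t < K \<Longrightarrow> t mod k < k"
  by (auto simp: K_def less_mult_imp_div_less intro!: mod_less_divisor gr0I)

lemma digit_less:
  assumes "u < h" "v < h"
  shows "digit b t u v < B"
proof -
  have "u + h * v < h * h"
  proof -
    have "u + h * v < h * Suc v" using assms(1) by simp
    also have "\<dots> \<le> h * h" using assms(2) by (intro mult_left_mono) auto
    finally show ?thesis .
  qed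
  then have "1 + 2 * (u + h * v) < B" by (simp add: B_def)
  moreover have "digit b t u v \<le> 1 + 2 * (u + h * v)"
    unfolding digit_def by (intro add_mono) (auto simp: of_bool_def)
  ultimately show ?thesis by linarith
qed

lemma bit_digit_0: "bit (digit b t u v) 0 \<longleftrightarrow> b = t"
  by (simp add: digit_def bit_0)

lemma bit_digit_Suc:
  "bit (digit b t u v) (Suc r) \<longleftrightarrow> b div k \<noteq> b mod k \<and>
    bit (of_bool (b = t \<or> t = b div k * (k + 1)) * u + of_bool (b = t \<or> t = b mod k * (k + 1)) * (h * v)) r"
  by (auto simp: digit_def bit_Suc)

text \<open>The summands use disjoint bits, so the sum is an XOR. This merges the contributions of
  two diagonal items into one pair.\<close>

lemma bit_pair:
  assumes "u < h"
  shows "bit (u + h * v) r \<longleftrightarrow> bit u r \<noteq> bit (h * v) r"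
proof -
  have "bit u i \<Longrightarrow> i < m" for i
    using assms by (metis h_def bit_take_bit_iff take_bit_nat_eq_self)
  moreover have "bit (h * v) i \<Longrightarrow> m \<le> i" for i
    using bit_push_bit_iff_nat[of m v i] by (simp add: h_def push_bit_eq_mult mult.commute)
  ultimately have "u AND (h * v) = 0"
    by (intro bit_eqI) (auto simp: bit_and_iff dest: leD)
  then have "u + h * v = u XOR (h * v)"
    by (intro disjunctive_add_eq_xor)
  then show ?thesis by (simp add: bit_xor_iff)
qed

lemma pair_inject:
  assumes "u < h" "u' < h" "u + h * v = u' + h * v'"
  shows "u = u'" "v = v'"
proof -
  have "(u + h * v) mod h = (u' + h * v') mod h" "(u + h * v) div h = (u' + h * v') div h"
    using assms(3) by simp_all
  then show "u = u'" "v = v'" using assms(1,2) h_pos by simp_all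
qed

lemma bit_weight:
  assumes "r < w"
  shows "bit (weight e) (b * w + r) \<longleftrightarrow> valid_item (type_of e) (src_of e) (tgt_of e) \<and>
    b < K \<and> bit (digit b (type_of e) (src_of e) (tgt_of e)) r"
  unfolding weight_def B_eq
  using bit_digit_sum[of K "\<lambda>b. digit b (type_of e) (src_of e) (tgt_of e)" w r b] assms
    digit_less[OF src_less tgt_less] by (simp add: B_eq)

lemma bit_target: "r < w \<Longrightarrow> bit target (b * w + r) \<longleftrightarrow> b < K \<and> r = 0"
  unfolding target_def B_eq
  using bit_digit_sum[of K "\<lambda>b. 1" w r b] one_less_base by (simp add: bit_Suc_0_iff)

lemma weight_less: "weight e < B ^ K"
  unfolding weight_def B_eq
  using digit_sum_less[of K "\<lambda>b. digit b (type_of e) (src_of e) (tgt_of e)" "2 ^ w"]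
    digit_less[OF src_less tgt_less] by (simp add: B_eq)

lemma target_less: "target < B ^ K"
  unfolding target_def B_eq using digit_sum_less[of K "\<lambda>b. 1" "2 ^ w"] one_less_base by simp

text \<open>The parity condition says that the XOR of the weights in \<open>Q\<close> is
  \<open>s\<close>. The field enters only later, through its addition.\<close>

definition solutions :: "nat \<Rightarrow> nat set set" where
  "solutions s = {Q. Q \<subseteq> {..<N} \<and> inj_on type_of Q \<and> (\<forall>i. odd (card {e \<in> Q. bit (weight e) i}) \<longleftrightarrow> bit s i)}"

text \<open>The single bit of \<open>B ^ K\<close> lies in block \<open>K\<close>, which no weight
  reaches. This makes \<open>B ^ K\<close> the reference value that is never a sum.\<close>

lemma solutions_bound: "solutions (B ^ K) = {}"
proof -
  have "\<not> bit (weight e) (K * w)" for e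
    using bit_weight[of 0 e K] by (simp add: w_def)
  then have "{e \<in> Q. bit (weight e) (K * w)} = {}" for Q by blast
  moreover have "bit (B ^ K) (K * w)"
    by (simp add: B_eq power_mult[symmetric] mult.commute bit_exp_iff)
  ultimately have "\<not> (odd (card {e \<in> Q. bit (weight e) (K * w)}) \<longleftrightarrow> bit (B ^ K) (K * w))" for Q
    by (simp only: card.empty) simp
  then show ?thesis unfolding solutions_def by blast
qed

text \<open>With one valid item per type, at most three items reach the comparison bits of block
  \<open>b\<close>: those of type \<open>b\<close> and of the diagonal types of its two indices.
  These types are distinct because \<open>b\<close> is off the diagonal.\<close>

lemma parity_block:
  assumes f: "\<And>t. t < K \<Longrightarrow> type_of (f t) = t \<and> valid_item t (src_of (f t)) (tgt_of (f t))"
    and b: "b < K" and r: "r < w"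
  shows "odd (card {e \<in> f ` {..<K}. bit (weight e) (b * w + r)}) \<longleftrightarrow>
    (case r of 0 \<Rightarrow> True | Suc r' \<Rightarrow> b div k \<noteq> b mod k \<and>
      bit (src_of (f b) + h * tgt_of (f b)) r' \<noteq>
      bit (src_of (f (b div k * (k + 1))) + h * tgt_of (f (b mod k * (k + 1)))) r')"
proof -
  have inj: "inj_on f {..<K}"
    by (rule inj_on_inverseI[of _ type_of]) (use f in simp)
  let ?T = "{t \<in> {..<K}. bit (digit b t (src_of (f t)) (tgt_of (f t))) r}"
  have "{e \<in> f ` {..<K}. bit (weight e) (b * w + r)} = f ` ?T"
    using f b by (auto simp: bit_weight[OF r])
  moreover have "inj_on f ?T" using inj by (rule inj_on_subset) auto
  ultimately have card: "card {e \<in> f ` {..<K}. bit (weight e) (b * w + r)} = card ?T"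
    by (simp add: card_image)
  show ?thesis
  proof (cases r)
    case 0
    then have "?T = {b}" using b by (auto simp: bit_digit_0)
    then show ?thesis using card 0 by simp
  next
    case (Suc r')
    show ?thesis
    proof (cases "b div k = b mod k")
      case True
      then have T: "?T = {}" by (auto simp: Suc bit_digit_Suc)
      show ?thesis unfolding card T using Suc True by simp
    next
      case False
      define x y where "x = b div k * (k + 1)" and "y = b mod k * (k + 1)"
      have lt: "b div k < k" "b mod k < k" using index_less b by auto
      have xy: "x < K" "y < K" "x div k = b div k" "x mod k = b div k" "y div k = b mod k" "y mod k = b mod k"
        using diagonal lt by (simp_all add: x_def y_def)
      have ne: "b \<noteq> x" "b \<noteq> y" "x \<noteq> y" using xy False by auto
      have T: "t \<in> ?T \<longleftrightarrow> t < K \<and> bit (of_bool (b = t \<or> t = x) * src_of (f t) +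
          of_bool (b = t \<or> t = y) * (h * tgt_of (f t))) r'" for t
        using False by (simp add: Suc bit_digit_Suc x_def y_def)
      have "?T \<subseteq> {b, x, y}" unfolding subset_iff T by auto
      then have "odd (card ?T) \<longleftrightarrow> (b \<in> ?T) \<noteq> ((x \<in> ?T) \<noteq> (y \<in> ?T))"
        using ne by (intro odd_card_three) auto
      also have "\<dots> \<longleftrightarrow> bit (src_of (f b) + h * tgt_of (f b)) r' \<noteq>
          (bit (src_of (f x)) r' \<noteq> bit (h * tgt_of (f y)) r')"
        unfolding T using b xy ne by simp
      also have "\<dots> \<longleftrightarrow> bit (src_of (f b) + h * tgt_of (f b)) r' \<noteq>
          bit (src_of (f x) + h * tgt_of (f y)) r'"
        using bit_pair[OF src_less] by simp
      finally show ?thesis using card Suc False by (simp add: x_def y_def)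
    qed
  qed
qed

lemma pair_less: "u < h \<Longrightarrow> v < h \<Longrightarrow> u + h * v < 2 ^ (2 * m)"
proof -
  assume "u < h" "v < h"
  then have "u + h * v < h * Suc v" by simp
  also have "\<dots> \<le> h * h" using \<open>v < h\<close> by (intro mult_left_mono) auto
  finally show ?thesis by (simp add: h_def mult_2 power_add)
qed

definition clique_selection :: "nat set \<Rightarrow> nat set" where
  "clique_selection C = (\<lambda>t. item t (sorted_list_of_set C ! (t div k)) (sorted_list_of_set C ! (t mod k))) ` {..<K}"

text \<open>The parities are read back: type bits give a valid item of each type, diagonal items
  define \<open>v\<close>, comparison bits force every other item to propose the same vertices, and
  validity above the diagonal gives order and adjacency.\<close>

lemma solutions_target:
  assumes "Q \<in> solutions target"
  obtains v where "strict_mono_on {..<k} v" "\<And>p. p < k \<Longrightarrow> v p < n"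
    "\<And>p q. p < q \<Longrightarrow> q < k \<Longrightarrow> adj (v p) (v q)" "Q = (\<lambda>t. item t (v (t div k)) (v (t mod k))) ` {..<K}"
proof -
  have Q: "Q \<subseteq> {..<N}" "inj_on type_of Q"
    and par: "\<And>i. odd (card {e \<in> Q. bit (weight e) i}) \<longleftrightarrow> bit target i"
    using assms by (auto simp: solutions_def)
  have "\<exists>e\<in>Q. type_of e = t \<and> valid_item t (src_of e) (tgt_of e)" if t: "t < K" for t
  proof -
    \<comment> \<open>The type bit of block \<open>t\<close> is set in \<open>target\<close>, and
      only valid items of type \<open>t\<close> carry it.\<close>
    have "odd (card {e \<in> Q. bit (weight e) (t * w + 0)})"
      unfolding par using t bit_target[of 0 t] by (simp add: w_def)
    then have "{e \<in> Q. bit (weight e) (t * w + 0)} \<noteq> {}" by (rule contrapos_pn) (simp only: card.empty, simp)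
    then obtain e where e: "e \<in> Q" "bit (weight e) (t * w + 0)" by blast
    then have "valid_item (type_of e) (src_of e) (tgt_of e)" "t = type_of e"
      using bit_weight[of 0 e t] by (simp_all add: w_def bit_digit_0)
    then show ?thesis using e by auto
  qed
  then have "\<forall>t\<in>{..<K}. \<exists>e. e \<in> Q \<and> type_of e = t \<and> valid_item t (src_of e) (tgt_of e)"
    by blast
  from bchoice[OF this] obtain f where
    f: "\<And>t. t < K \<Longrightarrow> f t \<in> Q \<and> type_of (f t) = t \<and> valid_item t (src_of (f t)) (tgt_of (f t))"
    by blast
  \<comment> \<open>No type occurs twice in \<open>Q\<close>, so the chosen items exhaust
    it.\<close>
  have Qf: "Q = f ` {..<K}"
  proof (intro equalityI subsetI)
    fix e assume e: "e \<in> Q"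
    then have t: "type_of e < K" using Q(1) type_less by blast
    have "f (type_of e) = e"
      by (rule inj_onD[OF Q(2) _ _ e]) (use f[OF t] in blast)+
    then have "e = f (type_of e)" by (rule sym)
    then show "e \<in> f ` {..<K}" using t by blast
  qed (use f in auto)
  define v where "v p = src_of (f (p * (k + 1)))" for p
  have diag: "tgt_of (f (p * (k + 1))) = v p" "v p < n" if "p < k" for p
    using f[of "p * (k + 1)"] diagonal[OF that] by (auto simp: valid_item_def v_def)
  have uv: "src_of (f t) = v (t div k) \<and> tgt_of (f t) = v (t mod k)" if t: "t < K" for t
  proof (cases "t div k = t mod k")
    case True
    have eq: "f t = f (t div k * (k + 1))"
      by (rule arg_cong[OF diagonal_iff[OF t True]])
    have "src_of (f t) = v (t div k)"
      unfolding v_def by (rule arg_cong[OF eq])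
    moreover have "tgt_of (f t) = v (t div k)"
      using arg_cong[OF eq, of tgt_of] diag(1)[OF index_less(1)[OF t]] by (rule trans)
    ultimately show ?thesis using True by simp
  next
    case False
    have "bit (src_of (f t) + h * tgt_of (f t)) r = bit (v (t div k) + h * v (t mod k)) r" for r
    proof (cases "r < 2 * m")
      case True
      then have r: "Suc r < w" by (simp add: w_def)
      \<comment> \<open>Offset \<open>Suc r\<close> is a comparison bit, which is clear in
        \<open>target\<close>; hence the three contributions cancel there.\<close>
      have "\<not> odd (card {e \<in> f ` {..<K}. bit (weight e) (t * w + Suc r)})"
        unfolding Qf[symmetric] par using bit_target[OF r] by simp
      then show ?thesis
        using parity_block[of f t "Suc r"] t r f False diag(1)[OF index_less(2)[OF t]] by (simp add: v_def)
    next
      case False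
      have "\<not> bit x r" if "x < 2 ^ (2 * m)" for x :: nat
      proof -
        have "take_bit (2 * m) x = x" using that by (rule take_bit_nat_eq_self)
        then show ?thesis using False bit_take_bit_iff[of "2 * m" x r] by simp
      qed
      moreover have "v p < h" for p by (simp add: v_def src_less)
      ultimately show ?thesis using pair_less src_less tgt_less by simp
    qed
    then have eq: "src_of (f t) + h * tgt_of (f t) = v (t div k) + h * v (t mod k)"
      by (intro bit_eqI)
    have "v (t div k) < h" unfolding v_def by (rule src_less)
    then show ?thesis using pair_inject[OF src_less _ eq] by blast
  qed
  have lt: "v p < v q \<and> adj (v p) (v q)" if "p < q" "q < k" for p q
  proof -
    \<comment> \<open>For \<open>p < q\<close> the type \<open>p * k + q\<close> lies above the
      diagonal, where validity includes \<open>u < v\<close> and adjacency.\<close>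
    have "p * k + q < Suc p * k" using that by simp
    also have "\<dots> \<le> k * k" using that by (intro mult_right_mono) auto
    finally have t: "p * k + q < K" by (simp add: K_def)
    have "(p * k + q) div k = p" "(p * k + q) mod k = q" using that by simp_all
    then show ?thesis using f[OF t] uv[OF t] that by (simp add: valid_item_def)
  qed
  show thesis
  proof (rule that)
    show "strict_mono_on {..<k} v"
      by (rule strict_mono_onI) (use lt in blast)
    show "Q = (\<lambda>t. item t (v (t div k)) (v (t mod k))) ` {..<K}"
      unfolding Qf
    proof (rule image_cong)
      fix t assume "t \<in> {..<K}"
      then show "f t = item t (v (t div k)) (v (t mod k))"
        using item_of[of "f t"] f[of t] uv[of t] by simp
    qed simp
    show "v p < n" if "p < k" for p by (rule diag(2)[OF that])
    show "adj (v p) (v q)" if "p < q" "q < k" for p q using lt[OF that] by blast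
  qed
qed

text \<open>All items take their proposals from the same \<open>v\<close>, so the contributions in
  every comparison bit cancel, and each type bit is met once.\<close>

lemma solutions_targetI:
  assumes mono: "strict_mono_on {..<k} v" and v: "\<And>p. p < k \<Longrightarrow> v p < n"
    and adj: "\<And>p q. p < q \<Longrightarrow> q < k \<Longrightarrow> adj (v p) (v q)"
  shows "(\<lambda>t. item t (v (t div k)) (v (t mod k))) ` {..<K} \<in> solutions target"
proof -
  define f where "f t = item t (v (t div k)) (v (t mod k))" for t
  have vh: "v p < h" if "p < k" for p using v[OF that] n_less_h by simp
  have f: "type_of (f t) = t" "src_of (f t) = v (t div k)" "tgt_of (f t) = v (t mod k)" if "t < K" for t
    using vh index_less[OF that] by (simp_all add: f_def)
  have valid: "valid_item t (src_of (f t)) (tgt_of (f t))" if t: "t < K" for t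
    using f[OF t] index_less[OF t] v adj mono by (auto simp: valid_item_def strict_mono_on_def)
  have "odd (card {e \<in> f ` {..<K}. bit (weight e) i}) \<longleftrightarrow> bit target i" for i
  proof -
    define b r where "b = i div w" and "r = i mod w"
    have i: "i = b * w + r" unfolding b_def r_def by simp
    have r: "r < w" by (simp add: r_def w_def)
    show ?thesis
    proof (cases "b < K")
      case True
      note lt = index_less[OF True]
      have diag: "src_of (f (b div k * (k + 1))) = v (b div k)" "tgt_of (f (b mod k * (k + 1))) = v (b mod k)"
        using f diagonal lt by simp_all
      show ?thesis
        unfolding i bit_target[OF r] using parity_block[of f b r] f(1) valid True r diag f[OF True]
        by (simp split: nat.split)
    next
      case False
      then have "{e \<in> f ` {..<K}. bit (weight e) i} = {}"
        unfolding i bit_weight[OF r] by simp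
      then show ?thesis using False bit_target[OF r, of b] by (simp only: card.empty i) simp
    qed
  qed
  moreover have "inj_on type_of (f ` {..<K})"
    using f by (auto simp: inj_on_def)
  moreover have "f ` {..<K} \<subseteq> {..<N}"
    using item_less vh index_less by (auto simp: f_def)
  ultimately show ?thesis
    unfolding solutions_def f_def by simp
qed

text \<open>A clique corresponds to its unique increasing enumeration, which is the \<open>v\<close>
  of the two preceding lemmas.\<close>

lemma card_solutions_target:
  assumes adj: "\<And>u v. u \<noteq> v \<Longrightarrow> adj u v \<longleftrightarrow> {u, v} \<in> E"
  shows "card (solutions target) = card (cliques (n, E) k)"
proof -
  have cl: "strict_mono_on {..<k} ((!) (sorted_list_of_set C))" "\<And>p. p < k \<Longrightarrow> sorted_list_of_set C ! p \<in> C"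
    "finite C" "length (sorted_list_of_set C) = k" "set (sorted_list_of_set C) = C"
    if C: "C \<in> cliques (n, E) k" for C
  proof -
    have "C \<subseteq> {..<n}" "card C = k" using C by (auto simp: cliques_def)
    then show fin: "finite C" using finite_subset by blast
    then show len: "length (sorted_list_of_set C) = k" "set (sorted_list_of_set C) = C"
      using \<open>card C = k\<close> by simp_all
    then show "p < k \<Longrightarrow> sorted_list_of_set C ! p \<in> C" for p by (metis nth_mem)
    show "strict_mono_on {..<k} ((!) (sorted_list_of_set C))"
      using sorted_wrt_nth_less[OF strict_sorted_list_of_set[of C]] len
      by (auto simp: strict_mono_on_def)
  qed
  have "bij_betw clique_selection (cliques (n, E) k) (solutions target)"
  proof (rule bij_betw_imageI)
    show "inj_on clique_selection (cliques (n, E) k)"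
    \<comment> \<open>The clique is recovered as the set of the first proposals; each vertex occurs
      there through its diagonal item.\<close>
    proof (rule inj_on_inverseI)
      fix C assume C: "C \<in> cliques (n, E) k"
      let ?l = "sorted_list_of_set C"
      have "C \<subseteq> {..<n}" using C by (auto simp: cliques_def)
      then have lt: "?l ! p < h" if "p < k" for p using cl(2)[OF C that] n_less_h by auto
      have "src_of ` clique_selection C = (\<lambda>t. ?l ! (t div k)) ` {..<K}"
        unfolding clique_selection_def image_image using lt index_less by (intro image_cong) auto
      also have "\<dots> = (!) ?l ` {..<k}"
      proof (intro equalityI subsetI)
        fix x assume "x \<in> (!) ?l ` {..<k}"
        then obtain p where "p < k" "x = ?l ! p" by auto
        then show "x \<in> (\<lambda>t. ?l ! (t div k)) ` {..<K}"
          using diagonal[of p] by (intro image_eqI[of _ _ "p * (k + 1)"]) auto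
      qed (use index_less in auto)
      also have "\<dots> = C" using cl(4,5)[OF C] by (metis atLeast_upt image_set map_nth set_upt atLeast0LessThan)
      finally show "src_of ` clique_selection C = C" .
    qed
    show "clique_selection ` cliques (n, E) k = solutions target"
    proof (intro equalityI subsetI)
      fix Q assume "Q \<in> clique_selection ` cliques (n, E) k"
      then obtain C where C: "C \<in> cliques (n, E) k" "Q = clique_selection C" by blast
      have C': "C \<subseteq> {..<n}" "\<And>u v. u \<in> C \<Longrightarrow> v \<in> C \<Longrightarrow> u \<noteq> v \<Longrightarrow> adj u v"
        using C(1) adj by (auto simp: cliques_def)
      show "Q \<in> solutions target"
        unfolding C(2) clique_selection_def
      proof (rule solutions_targetI)
        show "strict_mono_on {..<k} ((!) (sorted_list_of_set C))" by (rule cl(1)[OF C(1)])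
        then show "adj (sorted_list_of_set C ! p) (sorted_list_of_set C ! q)" if "p < q" "q < k" for p q
        proof -
          have "sorted_list_of_set C ! p < sorted_list_of_set C ! q"
            using strict_mono_onD[OF cl(1)[OF C(1)], of p q] that by simp
          then show ?thesis using that cl(2)[OF C(1)] by (intro C'(2)) auto
        qed
        show "sorted_list_of_set C ! p < n" if "p < k" for p using cl(2)[OF C(1) that] C'(1) by auto
      qed
    next
      fix Q assume "Q \<in> solutions target"
      then obtain v where v: "strict_mono_on {..<k} v" "\<And>p. p < k \<Longrightarrow> v p < n"
        "\<And>p q. p < q \<Longrightarrow> q < k \<Longrightarrow> adj (v p) (v q)" "Q = (\<lambda>t. item t (v (t div k)) (v (t mod k))) ` {..<K}"
        by (rule solutions_target) blast
      define C where "C = v ` {..<k}"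
      have inj: "inj_on v {..<k}" using v(1) by (rule strict_mono_on_imp_inj_on)
      have "sorted_list_of_set C = map v [0..<k]"
      proof (rule sorted_list_of_set.idem_if_sorted_distinct[of "map v [0..<k]", simplified, folded atLeast0LessThan, unfolded atLeast0LessThan, folded C_def])
      qed (use v(1) inj in \<open>auto simp: sorted_wrt_iff_nth_less strict_mono_on_def distinct_map atLeast0LessThan intro: less_imp_le\<close>)
      then have l: "sorted_list_of_set C ! p = v p" if "p < k" for p using that by simp
      \<comment> \<open>Adjacency was obtained for increasing pairs only; it is symmetric for
        distinct vertices, being given by an unordered pair.\<close>
      have "adj (v p) (v q)" if "p < k" "q < k" "p \<noteq> q" for p q
      proof (cases "p < q")
        case False
        then have "adj (v q) (v p)" using v(3) that by simp
        moreover have "v p \<noteq> v q" using inj that by (auto simp: inj_on_def)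
        ultimately show ?thesis using adj by (metis insert_commute)
      qed (use v(3) that in auto)
      then have "{v p, v q} \<in> E" if "p < k" "q < k" "v p \<noteq> v q" for p q
        using adj[OF that(3)] that by (cases "p = q") auto
      moreover have "card C = k" unfolding C_def using inj by (simp add: card_image)
      ultimately have "C \<in> cliques (n, E) k"
        using v(2) adj unfolding cliques_def by (auto simp: C_def)
      moreover have "clique_selection C = Q"
        unfolding clique_selection_def v(4) using l index_less by (intro image_cong) auto
      ultimately show "Q \<in> clique_selection ` cliques (n, E) k" by blast
    qed
  qed
  then show ?thesis by (metis bij_betw_same_card)
qed

end

section \<open>Matrices over an explicit field of characteristic 2\<close>

context gf2
begin

lemma finite_field_elem_xor:
  assumes "map int f \<in> carrier (poly_ring R)"
  shows "finite_field_elem 2 f (bits (x XOR y)) =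
    finite_field_elem 2 f (bits x) \<oplus>\<^bsub>finite_field 2 f\<^esub> finite_field_elem 2 f (bits y)"
proof -
  interpret h: ring_hom_ring "poly_ring R" "finite_field 2 f" "rupture_surj (carrier R) (map int f)"
    unfolding finite_field_def R_def[symmetric] by (rule rupture_surj_hom[OF carrier_is_subring assms])
  show ?thesis
    unfolding finite_field_elem_gf2 bits_xor[symmetric] by (rule h.hom_add[OF bits_in_poly_ring bits_in_poly_ring])
qed

lemma finite_field_elem_0_1:
  assumes "map int f \<in> carrier (poly_ring R)"
  shows "finite_field_elem 2 f [] = \<zero>\<^bsub>finite_field 2 f\<^esub>" "finite_field_elem 2 f [1] = \<one>\<^bsub>finite_field 2 f\<^esub>"
proof -
  interpret h: ring_hom_ring "poly_ring R" "finite_field 2 f" "rupture_surj (carrier R) (map int f)"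
    unfolding finite_field_def R_def[symmetric] by (rule rupture_surj_hom[OF carrier_is_subring assms])
  show "finite_field_elem 2 f [] = \<zero>\<^bsub>finite_field 2 f\<^esub>" "finite_field_elem 2 f [1] = \<one>\<^bsub>finite_field 2 f\<^esub>"
    using h.hom_zero h.hom_one
    by (simp_all add: finite_field_elem_gf2 univ_poly_zero univ_poly_one gf2_simps)
qed

end

lemma gf2_prime_field: "gf2 (prime_field 2)"
  by (simp add: gf2_def gf2_axioms_def field_prime_field)

definition trinomial :: "nat \<Rightarrow> nat list" where
  "trinomial q = bits (2 ^ (2 * q) + 2 ^ q + 1)"

text \<open>The entries are the numbers that name field elements. One matrix thus yields the field
  matrix, through \<open>elem\<close>, and its encoding, through \<open>bits\<close>.\<close>

definition standard_nat_mat :: "nat \<Rightarrow> nat \<Rightarrow> (nat \<Rightarrow> nat \<Rightarrow> nat) \<Rightarrow> nat mat" where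
  "standard_nat_mat n m a = mat n (n + m) (\<lambda>(i, j). if j < n then of_bool (i = j) else a i (j - n))"

definition bits_repr :: "nat \<Rightarrow> nat \<Rightarrow> nat \<Rightarrow> (nat \<Rightarrow> nat \<Rightarrow> nat) \<Rightarrow> matrix_repr" where
  "bits_repr q n m a = Over_Finite_Field 2 (trinomial q) (map_mat bits (standard_nat_mat n m a))"

locale power3_field =
  fixes q l :: nat
  assumes q: "q = 3 ^ l"
begin

sublocale gf2 "prime_field 2"
  by (rule gf2_prime_field)

definition GF :: "int list set ring" where "GF = finite_field 2 (trinomial q)"
definition elem :: "nat \<Rightarrow> int list set" where "elem x = finite_field_elem 2 (trinomial q) (bits x)"

lemma q_pos: "q \<ge> 1"
  by (simp add: q)

lemma trinomial_closed: "map int (trinomial q) \<in> carrier (poly_ring (prime_field 2))"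
  unfolding trinomial_def by (rule bits_in_poly_ring)

lemma length_trinomial': "length (trinomial q) = Suc (2 * q)"
  unfolding trinomial_def by (rule length_trinomial[OF q_pos])

lemma valid_bits_repr:
  assumes "\<And>i j. i < n \<Longrightarrow> j < m \<Longrightarrow> a i j < 2 ^ (2 * q)"
  shows "valid_repr (bits_repr q n m a)"
proof -
  have "length (bits (standard_nat_mat n m a $$ (i, j))) < length (trinomial q)"
    if "i < n" "j < n + m" for i j
  proof -
    have "(1::nat) < 2 ^ (2 * q)" using q_pos by (intro one_less_power) auto
    then have "standard_nat_mat n m a $$ (i, j) < 2 ^ (2 * q)"
      using that assms[of i "j - n"] by (auto simp: standard_nat_mat_def)
    then show ?thesis using length_bits_le length_trinomial' by (simp add: le_imp_less_Suc)
  qed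
  then show ?thesis
    using trinomial_irreducible[OF q] trinomial_closed bits_in_poly_ring
    by (auto simp: bits_repr_def trinomial_def elements_mat_def standard_nat_mat_def)
qed

text \<open>\<open>field_finite_field\<close> asks for a valid representation; the matrix without
  rows and columns provides one.\<close>

lemma field_GF: "Ring.field GF"
  using field_finite_field[of 2 "trinomial q" "map_mat bits (standard_nat_mat 0 0 (\<lambda>_ _. 0))"] valid_bits_repr[of 0 0 "\<lambda>_ _. 0"]
  by (simp add: GF_def bits_repr_def)

lemma bij_elem: "bij_betw elem {..<2 ^ (2 * q)} (carrier GF)"
  unfolding elem_def GF_def by (rule bij_betw_gf2_extension[OF trinomial_closed length_trinomial'])

lemma elem_closed: "x < 2 ^ (2 * q) \<Longrightarrow> elem x \<in> carrier GF"
  using bij_elem by (auto simp: bij_betw_def)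

lemma elem_inject: "x < 2 ^ (2 * q) \<Longrightarrow> y < 2 ^ (2 * q) \<Longrightarrow> elem x = elem y \<longleftrightarrow> x = y"
  using bij_elem by (auto simp: bij_betw_def inj_on_def)

lemma elem_xor: "elem (x XOR y) = elem x \<oplus>\<^bsub>GF\<^esub> elem y"
  unfolding elem_def GF_def by (rule finite_field_elem_xor[OF trinomial_closed])

lemma elem_0: "elem 0 = \<zero>\<^bsub>GF\<^esub>" and elem_1: "elem (Suc 0) = \<one>\<^bsub>GF\<^esub>"
  using finite_field_elem_0_1[OF trinomial_closed] by (simp_all add: elem_def GF_def)

text \<open>Addition is XOR, so a bit of the sum is the parity of the number of summands with that
  bit. The bound on \<open>Y\<close> puts the result where \<open>elem\<close> is injective.\<close>

lemma finsum_elem: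
  assumes "finite Q" "\<And>j. j \<in> Q \<Longrightarrow> x j < 2 ^ (2 * q)"
  shows "\<exists>Y<2 ^ (2 * q). (\<Oplus>\<^bsub>GF\<^esub>j\<in>Q. elem (x j)) = elem Y \<and> (\<forall>i. bit Y i \<longleftrightarrow> odd (card {j \<in> Q. bit (x j) i}))"
  using assms
proof (induction Q rule: finite_induct)
  case empty
  interpret F: Ring.field GF by (rule field_GF)
  show ?case by (intro exI[of _ 0]) (simp add: elem_0)
next
  case (insert y Q)
  interpret F: Ring.field GF by (rule field_GF)
  obtain Y where Y: "Y < 2 ^ (2 * q)" "(\<Oplus>\<^bsub>GF\<^esub>j\<in>Q. elem (x j)) = elem Y" "\<And>i. bit Y i \<longleftrightarrow> odd (card {j \<in> Q. bit (x j) i})"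
    using insert.IH insert.prems by auto
  have "(\<Oplus>\<^bsub>GF\<^esub>j\<in>insert y Q. elem (x j)) = elem (x y) \<oplus>\<^bsub>GF\<^esub> elem Y"
    unfolding Y(2)[symmetric] using insert.hyps insert.prems elem_closed by (intro F.finsum_insert) auto
  also have "\<dots> = elem (x y XOR Y)" by (rule elem_xor[symmetric])
  finally have 1: "(\<Oplus>\<^bsub>GF\<^esub>j\<in>insert y Q. elem (x j)) = elem (x y XOR Y)" .
  have 2: "x y XOR Y < 2 ^ (2 * q)"
  proof -
    have "take_bit (2 * q) (x y XOR Y) = x y XOR Y"
      using insert.prems[of y] Y(1) by (simp add: take_bit_xor take_bit_nat_eq_self)
    then show ?thesis by (rule take_bit_nat_eq_self_iff[THEN iffD1])
  qed
  have 3: "bit (x y XOR Y) i \<longleftrightarrow> odd (card {j \<in> insert y Q. bit (x j) i})" for i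
  proof (cases "bit (x y) i")
    case True
    then have "{j \<in> insert y Q. bit (x j) i} = insert y {j \<in> Q. bit (x j) i}" by auto
    moreover have "card (insert y {j \<in> Q. bit (x j) i}) = Suc (card {j \<in> Q. bit (x j) i})"
      using insert.hyps by simp
    ultimately show ?thesis using True by (simp add: bit_xor_iff Y(3))
  next
    case False
    then have "{j \<in> insert y Q. bit (x j) i} = {j \<in> Q. bit (x j) i}" by auto
    then show ?thesis using False by (simp add: bit_xor_iff Y(3))
  qed
  show ?case using 1 2 3 by blast
qed

lemma indep_sets_bits_repr:
  "indep_sets (bits_repr q n m a) = column_matroid GF (standard_mat GF n m (\<lambda>i j. elem (a i j)))"
proof -
  have "map_mat (finite_field_elem 2 (trinomial q)) (map_mat bits (standard_nat_mat n m a)) =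
      standard_mat GF n m (\<lambda>i j. elem (a i j))"
    by (rule eq_matI) (auto simp: standard_nat_mat_def standard_mat_def elem_def[symmetric] elem_0 elem_1
        simp flip: bits_0)
  then show ?thesis by (simp add: bits_repr_def GF_def[symmetric])
qed

lemma bits_repr_parameters:
  assumes a: "\<And>i j. i < n \<Longrightarrow> j < m \<Longrightarrow> a i j < 2 ^ (2 * q)"
  shows "matroid_rank (indep_sets (bits_repr q n m a)) = n"
    and "matroid_nullity (ground_set (bits_repr q n m a)) (indep_sets (bits_repr q n m a)) = m"
    and "card (bases (indep_sets (bits_repr q n m a))) = card (minors GF n m (\<lambda>i j. elem (a i j)))"
proof -
  interpret F: Ring.field GF by (rule field_GF)
  have cl: "elem (a i j) \<in> carrier GF" if "i < n" "j < m" for i j using a[OF that] by (rule elem_closed)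
  show rank: "matroid_rank (indep_sets (bits_repr q n m a)) = n"
    unfolding indep_sets_bits_repr by (rule F.bases_standard_mat(1)) (rule cl)
  show "matroid_nullity (ground_set (bits_repr q n m a)) (indep_sets (bits_repr q n m a)) = m"
    unfolding matroid_nullity_def rank by (simp add: bits_repr_def standard_nat_mat_def)
  show "card (bases (indep_sets (bits_repr q n m a))) = card (minors GF n m (\<lambda>i j. elem (a i j)))"
    unfolding indep_sets_bits_repr by (rule F.card_bases_standard_mat) (rule cl)
qed

end

context clique_items
begin

definition entry :: "nat \<Rightarrow> nat \<Rightarrow> nat \<Rightarrow> nat" where
  "entry s i j = (if i < K then of_bool (\<not> (j < N \<and> type_of j \<noteq> i)) else if j < N then weight j else s)"

definition query_repr :: "bool \<Rightarrow> nat \<Rightarrow> nat \<Rightarrow> matrix_repr" where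
  "query_repr dual q s =
    (if dual then bits_repr q (Suc N) (Suc K) (\<lambda>j i. entry s i j) else bits_repr q (Suc K) (Suc N) (entry s))"

lemma entry_less:
  assumes "s < 2 ^ d" "B ^ K < 2 ^ d"
  shows "entry s i j < 2 ^ d"
proof -
  have "1 < (2::nat) ^ d" using assms(2) h_pos by (metis B_eq one_le_numeral one_le_power order_le_less_trans)
  then show ?thesis using assms weight_less[of j] by (auto simp: entry_def)
qed

end

text \<open>The bound by \<open>2 ^ q\<close> is the condition on which the loop in
  \<open>modulus\<close> stops.\<close>

locale clique_reduction = clique_items + power3_field +
  assumes B_less: "B ^ K < 2 ^ q"
begin

abbreviation count_bases :: "bool \<Rightarrow> nat \<Rightarrow> nat" where
  "count_bases dual s \<equiv> card (bases (indep_sets (query_repr dual q s)))"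

lemma bound_less: "B ^ K < 2 ^ (2 * q)"
  using B_less power_increasing[of q "2 * q" "2::nat"] by linarith

lemma query_repr_props:
  assumes s: "s < 2 ^ (2 * q)"
  shows "valid_repr (query_repr dual q s)" "field_char (query_repr dual q s) = 2"
    and "\<not> dual \<Longrightarrow> matroid_rank (indep_sets (query_repr dual q s)) = Suc K"
    and "dual \<Longrightarrow> matroid_nullity (ground_set (query_repr dual q s)) (indep_sets (query_repr dual q s)) = Suc K"
    and "count_bases dual s = card (minors GF (Suc K) (Suc N) (\<lambda>i j. elem (entry s i j)))"
proof -
  interpret F: Ring.field GF by (rule field_GF)
  note less = entry_less[OF s bound_less]
  show "valid_repr (query_repr dual q s)"
    by (cases dual) (auto simp: query_repr_def intro!: valid_bits_repr less)
  show "field_char (query_repr dual q s) = 2" by (simp add: query_repr_def bits_repr_def)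
  show "\<not> dual \<Longrightarrow> matroid_rank (indep_sets (query_repr dual q s)) = Suc K"
    using bits_repr_parameters(1)[of "Suc K" "Suc N" "entry s"] less by (simp add: query_repr_def)
  show "dual \<Longrightarrow> matroid_nullity (ground_set (query_repr dual q s)) (indep_sets (query_repr dual q s)) = Suc K"
    using bits_repr_parameters(2)[of "Suc N" "Suc K" "\<lambda>j i. entry s i j"] less by (simp add: query_repr_def)
  show "count_bases dual s = card (minors GF (Suc K) (Suc N) (\<lambda>i j. elem (entry s i j)))"
  proof (cases dual)
    case True
    then have "count_bases dual s =
        card (minors GF (Suc N) (Suc K) (\<lambda>j i. elem (entry s i j)))"
      using bits_repr_parameters(3)[of "Suc N" "Suc K" "\<lambda>j i. entry s i j"] less by (simp add: query_repr_def)
    also have "\<dots> = card (minors GF (Suc K) (Suc N) (\<lambda>i j. elem (entry s i j)))"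
      by (rule F.card_minors_transpose) (rule elem_closed[OF less])
    finally show ?thesis .
  next
    case False
    then show ?thesis
      using bits_repr_parameters(3)[of "Suc K" "Suc N" "entry s"] less by (simp add: query_repr_def)
  qed
qed

lemma elem_entry:
  "elem (entry s i j) = selection_entry GF K N type_of (\<lambda>j. elem (weight j)) (elem s) i j"
  by (auto simp: entry_def selection_entry_def elem_0 elem_1)

lemma selections_solutions:
  assumes s: "s < 2 ^ (2 * q)"
  shows "selections GF N type_of (\<lambda>j. elem (weight j)) (elem s) = solutions s"
proof -
  have "(\<Oplus>\<^bsub>GF\<^esub>j\<in>Q. elem (weight j)) = elem s \<longleftrightarrow> (\<forall>i. odd (card {e \<in> Q. bit (weight e) i}) \<longleftrightarrow> bit s i)"
    if "Q \<subseteq> {..<N}" for Q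
  proof -
    have "weight j < 2 ^ (2 * q)" for j using weight_less[of j] bound_less by linarith
    moreover have "finite Q" using that finite_subset by blast
    ultimately obtain Y where Y: "Y < 2 ^ (2 * q)" "(\<Oplus>\<^bsub>GF\<^esub>j\<in>Q. elem (weight j)) = elem Y"
        "\<And>i. bit Y i \<longleftrightarrow> odd (card {j \<in> Q. bit (weight j) i})"
      using finsum_elem[of Q weight] by blast
    show ?thesis unfolding Y(2) elem_inject[OF Y(1) s] Y(3)[symmetric] by (simp add: bit_eq_iff)
  qed
  then show ?thesis unfolding selections_def solutions_def by blast
qed

text \<open>No selection is lost for \<open>B ^ K\<close>, so its count is the larger one and the
  truncated subtraction is exact.\<close>

lemma bases_difference:
  assumes adj: "\<And>u v. u \<noteq> v \<Longrightarrow> adj u v \<longleftrightarrow> {u, v} \<in> E"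
  shows "count_bases dual (B ^ K) - count_bases dual target =
    card (cliques (n, E) k)"
proof -
  interpret F: Ring.field GF by (rule field_GF)
  have s: "target < 2 ^ (2 * q)" "B ^ K < 2 ^ (2 * q)" using target_less bound_less by linarith+
  have w: "elem (weight j) \<in> carrier GF" for j
    using weight_less[of j] bound_less by (intro elem_closed) linarith
  have "count_bases dual target + card (solutions target) =
      count_bases dual (B ^ K) + card (solutions (B ^ K))"
    unfolding query_repr_props(5)[OF s(1)] query_repr_props(5)[OF s(2)] elem_entry
      selections_solutions[OF s(1), symmetric] selections_solutions[OF s(2), symmetric]
    by (intro F.card_minors_selection w elem_closed s type_less)
  then show ?thesis
    using card_solutions_target[of E] adj unfolding solutions_bound by simp
qed

end

section \<open>Running times of programs\<close>

fun regs :: "expr \<Rightarrow> nat set" where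
  "regs (Reg x) = {x}"
| "regs e = (\<Union>a\<in>set (subexprs e). regs a)"

text \<open>If all registers read by \<open>e\<close> have size at most \<open>V\<close>, then the value of \<open>e\<close> has size at most
  \<open>growth e * V\<close> and its evaluation costs at most \<open>work e * V\<close>.\<close>

fun growth :: "expr \<Rightarrow> nat" where
  "growth (Reg x) = 1"
| "growth (Const c) = c + 1"
| "growth (MkCell a b) = 1 + growth a + growth b"
| "growth (LeftOf a) = growth a"
| "growth (RightOf a) = growth a"
| "growth (Plus a b) = growth a + growth b"
| "growth (Minus a b) = growth a"
| "growth (Times a b) = growth a + growth b"
| "growth (IntDiv a b) = growth a"
| "growth e = 2"

fun work :: "expr \<Rightarrow> nat" where
  "work e = growth e + (\<Sum>a\<leftarrow>subexprs e. work a)"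

declare work.simps [simp del]

text \<open>The defining equation of \<open>work\<close> matches every expression and would be
  unfolded forever; these instances replace it in the simplifier.\<close>

lemma work_simps [simp]:
  "work (Reg x) = 1" "work (Const c) = c + 1"
  "work (MkCell a b) = 1 + growth a + growth b + work a + work b"
  "work (LeftOf a) = growth a + work a" "work (RightOf a) = growth a + work a" "work (IsCell a) = 2 + work a"
  "work (Equal a b) = 2 + work a + work b" "work (Less a b) = 2 + work a + work b"
  "work (Plus a b) = growth a + growth b + work a + work b" "work (Minus a b) = growth a + work a + work b"
  "work (Times a b) = growth a + growth b + work a + work b" "work (IntDiv a b) = growth a + work a + work b"
  by (subst work.simps, simp)+

lemma floorlog_le_self: "floorlog 2 n \<le> n"
  by (rule floorlog_leI) auto

lemma less_power_floorlog: "x < 2 ^ floorlog 2 x"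
  using floorlog_bounds[of x 2] by (cases "x = 0") auto

lemma floorlog_add_le: "floorlog 2 (x + y) \<le> Suc (floorlog 2 x + floorlog 2 y)"
proof (rule floorlog_leI)
  have "x + y < 2 ^ floorlog 2 x + 2 ^ floorlog 2 y"
    using less_power_floorlog[of x] less_power_floorlog[of y] by simp
  also have "\<dots> \<le> 2 ^ (floorlog 2 x + floorlog 2 y) + 2 ^ (floorlog 2 x + floorlog 2 y)"
    by (intro add_mono power_increasing) auto
  finally show "x + y < 2 ^ Suc (floorlog 2 x + floorlog 2 y)" by simp
qed auto

lemma floorlog_mult_le: "floorlog 2 (x * y) \<le> floorlog 2 x + floorlog 2 y"
proof (rule floorlog_leI)
  show "x * y < 2 ^ (floorlog 2 x + floorlog 2 y)"
    unfolding power_add using less_power_floorlog[of x] less_power_floorlog[of y] by (intro mult_strict_mono) auto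
qed auto

lemma val_size_ge_1: "1 \<le> val_size v"
  by (cases v) auto

lemma val_size_num_of: "Suc (floorlog 2 (num_of v)) \<le> val_size v"
  by (cases v) (auto simp: floorlog_def)

lemma floorlog_bit [simp]: "floorlog 2 0 = 0" "floorlog 2 (Suc 0) = Suc 0"
  by (simp_all add: floorlog_def)

lemma val_size_children: "val_size (left_of v) \<le> val_size v" "val_size (right_of v) \<le> val_size v"
  by (cases v; simp)+

lemma val_size_expr_val:
  assumes "1 \<le> V" "\<And>r. r \<in> regs e \<Longrightarrow> val_size (s r) \<le> V"
  shows "val_size (expr_val e s) \<le> growth e * V"
  using assms(2)
proof (induction e)
  case (Const c)
  have "1 + floorlog 2 c \<le> (c + 1) * 1" using floorlog_le_self[of c] by simp
  also have "\<dots> \<le> (c + 1) * V" by (rule mult_le_mono2) (rule assms(1))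
  finally show ?case by simp
next
  case (MkCell a b)
  then have "val_size (expr_val a s) \<le> growth a * V" "val_size (expr_val b s) \<le> growth b * V" by simp_all
  then show ?case using assms(1) by (simp add: distrib_right)
next
  case (LeftOf a)
  then have "val_size (expr_val a s) \<le> growth a * V" by simp
  then show ?case using val_size_children(1)[of "expr_val a s"] by simp
next
  case (RightOf a)
  then have "val_size (expr_val a s) \<le> growth a * V" by simp
  then show ?case using val_size_children(2)[of "expr_val a s"] by simp
next
  case (Plus a b)
  then have "val_size (expr_val a s) \<le> growth a * V" "val_size (expr_val b s) \<le> growth b * V" by simp_all
  then show ?case
    using floorlog_add_le[of "num_of (expr_val a s)" "num_of (expr_val b s)"]
      val_size_num_of[of "expr_val a s"] val_size_num_of[of "expr_val b s"] by (simp add: distrib_right)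
next
  case (Times a b)
  then have "val_size (expr_val a s) \<le> growth a * V" "val_size (expr_val b s) \<le> growth b * V" by simp_all
  then show ?case
    using floorlog_mult_le[of "num_of (expr_val a s)" "num_of (expr_val b s)"]
      val_size_num_of[of "expr_val a s"] val_size_num_of[of "expr_val b s"] by (simp add: distrib_right)
next
  case (Minus a b)
  then have "val_size (expr_val a s) \<le> growth a * V" by simp
  then show ?case
    using floorlog_mono[of "num_of (expr_val a s) - num_of (expr_val b s)" "num_of (expr_val a s)" 2]
      val_size_num_of[of "expr_val a s"] by simp
next
  case (IntDiv a b)
  then have "val_size (expr_val a s) \<le> growth a * V" by simp
  then show ?case
    using floorlog_mono[of "num_of (expr_val a s) div num_of (expr_val b s)" "num_of (expr_val a s)" 2]
      val_size_num_of[of "expr_val a s"] by simp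
next
  case (Reg x)
  then show ?case by simp
qed (use assms(1) in \<open>simp_all add: of_bool_def\<close>)

lemma regs_subexprs: "a \<in> set (subexprs e) \<Longrightarrow> regs a \<subseteq> regs e"
  by (cases e) auto

lemma expr_cost_le:
  assumes "1 \<le> V" "\<And>r. r \<in> regs e \<Longrightarrow> val_size (s r) \<le> V"
  shows "expr_cost e s \<le> work e * V"
  using assms(2)
proof (induction e rule: work.induct)
  case (1 e)
  have "(\<Sum>a\<leftarrow>subexprs e. expr_cost a s) \<le> (\<Sum>a\<leftarrow>subexprs e. work a * V)"
    using 1 regs_subexprs by (intro sum_list_mono) blast
  also have "\<dots> = (\<Sum>a\<leftarrow>subexprs e. work a) * V"
    by (simp add: sum_list_mult_const)
  finally have "(\<Sum>a\<leftarrow>subexprs e. expr_cost a s) \<le> (\<Sum>a\<leftarrow>subexprs e. work a) * V" .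
  moreover have "val_size (expr_val e s) \<le> growth e * V"
    using "1.prems" by (intro val_size_expr_val[OF assms(1)])
  ultimately show ?case
    by (subst expr_cost.simps, subst work.simps) (simp add: distrib_right)
qed

text \<open>Since all registers have size at most \<open>V\<close>, costs are counted in units of \<open>V\<close>.\<close>

definition runs :: "(val \<Rightarrow> nat) \<Rightarrow> nat \<Rightarrow> com \<Rightarrow> state \<Rightarrow> nat \<Rightarrow> val list \<Rightarrow> state \<Rightarrow> bool" where
  "runs orc V c s m Q s' \<longleftrightarrow> (\<exists>t. exec orc c s t Q s' \<and> t \<le> m * V)"

abbreviation fits :: "nat \<Rightarrow> state \<Rightarrow> nat set \<Rightarrow> bool" where
  "fits V s A \<equiv> 1 \<le> V \<and> (\<forall>r\<in>A. val_size (s r) \<le> V)"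

lemma runs_mono: "runs orc V c s m Q s' \<Longrightarrow> m \<le> m' \<Longrightarrow> runs orc V c s m' Q s'"
  unfolding runs_def by (meson le_trans mult_le_mono1)

lemma runs_Assign:
  assumes "fits V s (regs e)" "Suc (work e) \<le> m"
  shows "runs orc V (Assign x e) s m [] (s(x := expr_val e s))"
  unfolding runs_def
proof (intro exI conjI)
  show "exec orc (Assign x e) s (1 + expr_cost e s) [] (s(x := expr_val e s))" by (rule exec.Assign)
  have "1 + expr_cost e s \<le> V + work e * V" using expr_cost_le[of V e s] assms(1) by (intro add_mono) auto
  also have "\<dots> = Suc (work e) * V" by simp
  also have "\<dots> \<le> m * V" using assms(2) by (rule mult_le_mono1)
  finally show "1 + expr_cost e s \<le> m * V" .
qed

lemma runs_Query:
  assumes "fits V s (regs e)" "val_size (Num (orc (expr_val e s))) \<le> V" "Suc (Suc (work e)) \<le> m"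
  shows "runs orc V (Query x e) s m [expr_val e s] (s(x := Num (orc (expr_val e s))))"
  unfolding runs_def
proof (intro exI conjI)
  show "exec orc (Query x e) s (1 + expr_cost e s + val_size (Num (orc (expr_val e s)))) [expr_val e s]
      (s(x := Num (orc (expr_val e s))))"
    by (rule exec.Query) auto
  have "1 + expr_cost e s + val_size (Num (orc (expr_val e s))) \<le> V + work e * V + V"
    using expr_cost_le[of V e s] assms(1,2) by (intro add_mono) auto
  also have "\<dots> = Suc (Suc (work e)) * V" by simp
  also have "\<dots> \<le> m * V" using assms(3) by (rule mult_le_mono1)
  finally show "1 + expr_cost e s + val_size (Num (orc (expr_val e s))) \<le> m * V" .
qed

lemma runs_Seq:
  assumes "runs orc V c s m Q s'" "runs orc V d s' m' Q' s''" "1 \<le> V" "Suc (m + m') \<le> M"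
  shows "runs orc V (Seq c d) s M (Q @ Q') s''"
proof -
  obtain t t' where t: "exec orc c s t Q s'" "t \<le> m * V" "exec orc d s' t' Q' s''" "t' \<le> m' * V"
    using assms(1,2) by (auto simp: runs_def)
  have "1 + t + t' \<le> V + m * V + m' * V" using t assms(3) by (intro add_mono) auto
  also have "\<dots> = Suc (m + m') * V" by (simp add: algebra_simps)
  also have "\<dots> \<le> M * V" using assms(4) by (rule mult_le_mono1)
  finally show ?thesis unfolding runs_def using exec.Seq[OF t(1,3)] by blast
qed

lemma runs_Cond:
  assumes "fits V s (regs b)" "expr_val b s \<noteq> Num 0 \<Longrightarrow> runs orc V c s m Q s'"
    "expr_val b s = Num 0 \<Longrightarrow> runs orc V d s m Q s'" "Suc (work b + m) \<le> M"
  shows "runs orc V (Cond b c d) s M Q s'"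
proof -
  obtain t where t: "exec orc (if expr_val b s \<noteq> Num 0 then c else d) s t Q s'" "t \<le> m * V"
    using assms(2,3) by (cases "expr_val b s = Num 0") (auto simp: runs_def)
  have ex: "exec orc (Cond b c d) s (1 + expr_cost b s + t) Q s'"
  proof (cases "expr_val b s = Num 0")
    case True
    then have "exec orc d s t Q s'" using t(1) by simp
    then show ?thesis by (rule exec.CondFalse[OF True])
  next
    case False
    then have "exec orc c s t Q s'" using t(1) by simp
    then show ?thesis by (rule exec.CondTrue[OF False])
  qed
  have "1 + expr_cost b s + t \<le> V + work b * V + m * V"
    using expr_cost_le[of V b s] assms(1) t(2) by (intro add_mono) auto
  also have "\<dots> = Suc (work b + m) * V" by (simp add: algebra_simps)
  also have "\<dots> \<le> M * V" using assms(4) by (rule mult_le_mono1)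
  finally show ?thesis unfolding runs_def using ex by blast
qed

text \<open>The invariant is indexed by the number of completed rounds, since every loop has a
  number of rounds known in advance. The guard is evaluated once more than the body, whence
  \<open>Suc n\<close>. Loops make no queries, so the list is empty.\<close>

lemma runs_While:
  assumes I: "I 0 s" and fits: "\<And>i s. I i s \<Longrightarrow> fits V s (regs b)"
    and step: "\<And>i s. i < n \<Longrightarrow> I i s \<Longrightarrow> expr_val b s \<noteq> Num 0 \<and> (\<exists>s'. runs orc V c s m [] s' \<and> I (Suc i) s')"
    and stop: "\<And>s. I n s \<Longrightarrow> expr_val b s = Num 0"
    and M: "Suc n * Suc (work b + m) \<le> M"
  shows "\<exists>s'. runs orc V (While b c) s M [] s' \<and> I n s'"
proof -
  have cost: "1 + expr_cost b s \<le> Suc (work b) * V" if "I i s" for i s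
    using expr_cost_le[of V b s] fits[OF that] by (simp add: add_mono)
  \<comment> \<open>The induction is on the number \<open>d\<close> of rounds still to go.\<close>
  have "\<exists>s'. runs orc V (While b c) s (Suc d * Suc (work b + m)) [] s' \<and> I n s'" if "I i s" "i + d = n" for i d s
    using that
  proof (induction d arbitrary: i s)
    case 0
    then have In: "I n s" by simp
    have "exec orc (While b c) s (1 + expr_cost b s) [] s" by (rule exec.WhileFalse[OF stop[OF In]])
    moreover have "1 + expr_cost b s \<le> Suc 0 * Suc (work b + m) * V"
    proof -
      have "Suc 0 * Suc (work b + m) * V = Suc (work b) * V + m * V" by (simp add: algebra_simps)
      then show ?thesis using cost[OF 0(1)] by linarith
    qed
    ultimately show ?case using In unfolding runs_def by blast
  next
    case (Suc d)
    then obtain s1 where s1: "expr_val b s \<noteq> Num 0" "runs orc V c s m [] s1" "I (Suc i) s1"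
      using step[of i s] by auto
    obtain s2 where s2: "runs orc V (While b c) s1 (Suc d * Suc (work b + m)) [] s2" "I n s2"
      using Suc.IH[OF s1(3)] Suc.prems(2) by auto
    obtain t t' where t: "exec orc c s t [] s1" "t \<le> m * V" "exec orc (While b c) s1 t' [] s2"
        "t' \<le> Suc d * Suc (work b + m) * V"
      using s1(2) s2(1) by (auto simp: runs_def)
    have "exec orc (While b c) s (1 + expr_cost b s + t + t') ([] @ []) s2"
      by (rule exec.WhileTrue[OF s1(1) t(1,3)])
    moreover have "1 + expr_cost b s + t + t' \<le> Suc (Suc d) * Suc (work b + m) * V"
    proof -
      have "Suc (Suc d) * Suc (work b + m) * V = Suc (work b) * V + m * V + Suc d * Suc (work b + m) * V"
        by (simp add: algebra_simps)
      then show ?thesis using cost[OF Suc.prems(1)] t(2,4) by linarith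
    qed
    ultimately show ?case using s2(2) unfolding runs_def append_Nil by blast
  qed
  then have "\<exists>s'. runs orc V (While b c) s (Suc n * Suc (work b + m)) [] s' \<and> I n s'"
    using I by (metis add_0)
  then obtain s' where "runs orc V (While b c) s (Suc n * Suc (work b + m)) [] s'" "I n s'"
    by blast
  from runs_mono[OF this(1) M] this(2) show ?thesis by blast
qed

lemma val_size_Num_le: "x < 2 ^ d \<Longrightarrow> d < V \<Longrightarrow> val_size (Num x) \<le> V"
  using floorlog_leI[of x 2 d] by simp

section \<open>Programs\<close>

lemma runs_Seq_Assign:
  assumes "fits V s (regs e)" "runs orc V d (s(x := expr_val e s)) m Q s'" "Suc (Suc (work e) + m) \<le> M"
  shows "runs orc V (Seq (Assign x e) d) s M Q s'"
  using runs_Seq[OF runs_Assign[OF assms(1) order_refl] assms(2) _ assms(3)] assms(1) by simp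

text \<open>\<open>A\<close> contains the registers that may change. Loop invariants use it to keep
  all facts on the other registers without listing them.\<close>

definition frame :: "nat set \<Rightarrow> state \<Rightarrow> state \<Rightarrow> bool" where
  "frame A s s' \<longleftrightarrow> (\<forall>r. r \<notin> A \<longrightarrow> s' r = s r)"

lemma frameD: "frame A s s' \<Longrightarrow> r \<notin> A \<Longrightarrow> s' r = s r"
  by (simp add: frame_def)

lemma frame_refl: "frame A s s"
  by (simp add: frame_def)

lemma frame_upd: "frame A s s' \<Longrightarrow> x \<in> A \<Longrightarrow> frame A s (s'(x := v))"
  by (simp add: frame_def)

lemma frame_trans: "frame A s s' \<Longrightarrow> frame B s' s'' \<Longrightarrow> A \<subseteq> C \<Longrightarrow> B \<subseteq> C \<Longrightarrow> frame C s s''"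
  unfolding frame_def by (metis subsetD)

section \<open>Access to list elements and binary expansion\<close>

definition walk_step :: com where
  "walk_step = Seq (Assign 31 (RightOf (Reg 31))) (Assign 30 (Minus (Reg 30) (Const 1)))"

definition walk :: com where
  "walk = While (Reg 30) walk_step"

lemma val_size_right_iter: "val_size ((right_of ^^ i) v) \<le> val_size v"
proof (induction i)
  case (Suc i)
  then show ?case using val_size_children(2)[of "(right_of ^^ i) v"] by simp
qed simp

lemma run_walk:
  assumes s: "s 30 = Num c" "c < 2 ^ d" "d < V" and v: "val_size (s 31) \<le> V"
  shows "\<exists>s'. runs orc V walk s (20 * Suc c) [] s' \<and> s' 31 = (right_of ^^ c) (s 31) \<and> frame {30, 31} s s'"
proof -
  define I where "I i s' \<longleftrightarrow> i \<le> c \<and> s' 30 = Num (c - i) \<and> s' 31 = (right_of ^^ i) (s 31) \<and> frame {30, 31} s s'" for i s'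
  have V: "1 \<le> V" using s by simp
  have size: "val_size (Num (c - i)) \<le> V" for i
    using s by (intro val_size_Num_le[of _ d]) (auto intro: le_less_trans[of _ c])
  have size31: "val_size ((right_of ^^ i) (s 31)) \<le> V" for i
    using val_size_right_iter[of i "s 31"] v by simp
  have "\<exists>s'. runs orc V walk s (20 * Suc c) [] s' \<and> I c s'"
    unfolding walk_def
  proof (rule runs_While[where m = 10])
    show "I 0 s" using s by (simp add: I_def frame_refl)
    show "fits V s' (regs (Reg 30))" if "I i s'" for i s'
      using that size[of i] V by (simp add: I_def del: val_size.simps)
    show "expr_val (Reg 30) s' = Num 0" if "I c s'" for s' using that by (simp add: I_def)
    fix i s' assume i: "i < c" "I i s'"
    let ?s1 = "s'(31 := (right_of ^^ Suc i) (s 31))"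
    have regs: "s' 30 = Num (c - i)" "s' 31 = (right_of ^^ i) (s 31)" "frame {30, 31} s s'"
      using i by (simp_all add: I_def)
    have "runs orc V walk_step s' 10 [] (?s1(30 := Num (c - Suc i)))"
      unfolding walk_step_def
    proof (rule runs_Seq_Assign[where m = 5])
      have "runs orc V (Assign 30 (Minus (Reg 30) (Const 1))) ?s1 5 []
          (?s1(30 := expr_val (Minus (Reg 30) (Const 1)) ?s1))"
        by (rule runs_Assign) (use regs size[of i] V in \<open>simp_all del: val_size.simps\<close>)
      then show "runs orc V (Assign 30 (Minus (Reg 30) (Const 1))) (s'(31 := expr_val (RightOf (Reg 31)) s')) 5 []
          (?s1(30 := Num (c - Suc i)))"
        using regs by simp
    qed (use regs size31[of i] V in simp_all)
    moreover have "I (Suc i) (?s1(30 := Num (c - Suc i)))"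
      using i regs by (simp add: I_def frame_upd)
    ultimately show "expr_val (Reg 30) s' \<noteq> Num 0 \<and> (\<exists>s''. runs orc V
        walk_step s' 10 [] s'' \<and> I (Suc i) s'')"
      using regs i by auto
  qed auto
  then show ?thesis unfolding I_def by auto
qed

lemma bits_eq_Nil: "bits x = [] \<longleftrightarrow> x = 0"
  by (subst bits.simps) simp

text \<open>The language has no remainder, so \<open>x mod 2\<close> is obtained as
  \<open>x - 2 * (x div 2)\<close>. Low bits are put in front first, which leaves the highest bit at
  the head, as \<open>bits\<close> requires.\<close>

definition conv_step :: com where
  "conv_step = Seq (Assign 35 (MkCell (Minus (Reg 36) (Times (Const 2) (IntDiv (Reg 36) (Const 2)))) (Reg 35)))
    (Assign 36 (IntDiv (Reg 36) (Const 2)))"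

definition conv :: com where
  "conv = Seq (Assign 35 (Const 0)) (While (Reg 36) conv_step)"

text \<open>Each bit takes size at most 2 and its cell 1 more; the end of the list takes 1.\<close>

lemma val_size_enc_bits: "set ys \<subseteq> {0, 1} \<Longrightarrow> val_size (enc_list Num ys) \<le> 3 * length ys + 1"
  by (induction ys) auto

lemma run_conv:
  assumes s: "s 36 = Num x" "x < 2 ^ d" and V: "3 * d + 2 \<le> V"
  shows "\<exists>s'. runs orc V conv s (50 * Suc d) [] s' \<and> s' 35 = enc_list Num (bits x) \<and> frame {35, 36} s s'"
proof -
  define l where "l = length (bits x)"
  have l: "l \<le> d" unfolding l_def using s(2) by (rule length_bits_le)
  \<comment> \<open>The digits \<open>ys\<close> split off so far complete those of the remaining
    quotient \<open>y\<close> to \<open>bits x\<close>.\<close>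
  define I where "I i s' \<longleftrightarrow> (\<exists>y ys. s' 36 = Num y \<and> s' 35 = enc_list Num ys \<and> bits x = bits y @ ys \<and>
    length ys = i \<and> y < 2 ^ d) \<and> frame {35, 36} s s'" for i s'
  have V1: "1 \<le> V" "d < V" using V by auto
  have size: "val_size (Num y) \<le> V" if "y < 2 ^ d" for y
    using that V1(2) by (rule val_size_Num_le)
  have size35: "val_size (enc_list Num ys) \<le> V" if "bits x = bits y @ ys" for y ys
  proof -
    have "set ys \<subseteq> {0, 1}" using set_bits[of x] that by auto
    then have "val_size (enc_list Num ys) \<le> 3 * length ys + 1" by (rule val_size_enc_bits)
    moreover have "length ys \<le> l" using that by (simp add: l_def)
    ultimately show ?thesis using l V by linarith
  qed
  have "\<exists>s'. runs orc V (While (Reg 36) conv_step) (s(35 := Num 0)) (45 * Suc d) [] s' \<and> I l s'"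
  proof (rule runs_While[where m = 40])
    show "I 0 (s(35 := Num 0))" using s by (auto simp: I_def intro!: frame_upd frame_refl)
    show "fits V s' (regs (Reg 36))" if "I i s'" for i s'
      using that size V1 by (auto simp: I_def simp del: val_size.simps)
    show "expr_val (Reg 36) s' = Num 0" if st: "I l s'" for s'
    proof -
      obtain y ys where y: "s' 36 = Num y" "bits x = bits y @ ys" "length ys = l" using st unfolding I_def by blast
      then have "bits y = []" by (simp add: l_def)
      then show ?thesis using y(1) by (simp add: bits_eq_Nil)
    qed
    fix i s' assume i: "i < l" "I i s'"
    then obtain y ys where y: "s' 36 = Num y" "s' 35 = enc_list Num ys" "bits x = bits y @ ys" "length ys = i" "y < 2 ^ d"
      and fr: "frame {35, 36} s s'" unfolding I_def by blast
    have "bits y \<noteq> []" using y i(1) by (auto simp: l_def)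
    then have "y \<noteq> 0" by (simp add: bits_eq_Nil)
    then have by': "bits y = bits (y div 2) @ [y mod 2]" by (simp add: bits.simps[of y])
    have mod: "y - 2 * (y div 2) = y mod 2" by (simp add: minus_mult_div_eq_mod)
    have sy: "val_size (s' 36) \<le> V" "val_size (s' 35) \<le> V" using y size size35 by (simp_all del: val_size.simps)
    let ?s1 = "s'(35 := Cell (Num (y mod 2)) (enc_list Num ys))"
    have I': "I (Suc i) (?s1(36 := Num (y div 2)))"
      unfolding I_def using y by' fr
      by (intro conjI exI[of _ "y div 2"] exI[of _ "(y mod 2) # ys"] frame_upd) auto
    have "runs orc V conv_step s' 40 [] (?s1(36 := Num (y div 2)))"
      unfolding conv_step_def
    proof (rule runs_Seq_Assign[where m = 10], goal_cases)
      case 2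
      have "runs orc V (Assign 36 (IntDiv (Reg 36) (Const 2))) ?s1 10 [] (?s1(36 := expr_val (IntDiv (Reg 36) (Const 2)) ?s1))"
        by (rule runs_Assign) (use sy V1 in \<open>simp_all del: val_size.simps\<close>)
      then show ?case using y mod by simp
    qed (use sy V1 in \<open>simp_all del: val_size.simps\<close>)
    then show "expr_val (Reg 36) s' \<noteq> Num 0 \<and> (\<exists>s''. runs orc V conv_step s' 40 [] s'' \<and> I (Suc i) s'')"
      using I' y \<open>y \<noteq> 0\<close> by auto
  qed (use l in \<open>simp add: algebra_simps\<close>)
  then obtain s' where s': "runs orc V (While (Reg 36) conv_step) (s(35 := Num 0)) (45 * Suc d) [] s'" "I l s'" by blast
  have "runs orc V conv s (50 * Suc d) [] s'"
    unfolding conv_def by (rule runs_Seq_Assign[OF _ s'(1)[folded expr_val.simps(2)[of 0 s]]]) (use V1 in simp_all)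
  moreover have "s' 35 = enc_list Num (bits x)"
    using s'(2) by (auto simp: I_def l_def)
  ultimately show ?thesis using s'(2) by (auto simp: I_def)
qed

definition select :: "nat \<Rightarrow> com" where
  "select x = Seq (Assign 30 (Reg x)) (Seq walk (Assign 31 (LeftOf (Reg 31))))"

definition lookup :: com where
  "lookup = Seq (Assign 31 (Reg 1)) (Seq (select 28) (select 29))"

lemma nth_enc_list: "left_of ((right_of ^^ i) (enc_list e xs)) = (if i < length xs then e (xs ! i) else Num 0)"
proof (induction xs arbitrary: i)
  case Nil
  have "(right_of ^^ i) (Num 0) = Num 0" by (induction i) auto
  then show ?case by simp
next
  case (Cons x xs)
  then show ?case by (cases i) (auto simp: funpow_Suc_right simp del: funpow.simps)
qed

text \<open>Nothing bounds \<open>u\<close> and \<open>v\<close> by \<open>n\<close>: proposals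
  range up to \<open>h - 1\<close>. Walking off a list yields \<open>Num 0\<close>, which is the
  right answer since such pairs are not edges.\<close>

lemma lookup_enc_graph:
  assumes "simple_graph (n, E)"
  shows "left_of ((right_of ^^ v) (left_of ((right_of ^^ u) (enc_graph (n, E))))) = Num (of_bool ({u, v} \<in> E))"
proof -
  have less: "u < n \<and> v < n" if "{u, v} \<in> E" for u v
    using assms that unfolding simple_graph_def by (fastforce simp: doubleton_eq_iff)
  have z: "left_of ((right_of ^^ v) (Num 0)) = Num 0"
    using nth_enc_list[of v Num "[]"] by simp
  show ?thesis
    unfolding enc_graph_def nth_enc_list using less[of u v] z by (auto simp: nth_enc_list)
qed

lemma run_select:
  assumes s: "s x = Num u" "u < 2 ^ d" "d < V" and v: "val_size (s 31) \<le> V"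
  shows "\<exists>s'. runs orc V (select x) s (20 * u + 40) [] s' \<and>
    s' 31 = left_of ((right_of ^^ u) (s 31)) \<and> frame {30, 31} s s'"
proof -
  have V: "1 \<le> V" using s by simp
  have size: "val_size (Num u) \<le> V" using s(2,3) by (rule val_size_Num_le)
  have "\<exists>s2. runs orc V walk (s(30 := Num u)) (20 * Suc u) [] s2 \<and> s2 31 = (right_of ^^ u) ((s(30 := Num u)) 31) \<and>
      frame {30, 31} (s(30 := Num u)) s2"
    by (rule run_walk[of _ u d]) (use s v in simp_all)
  then obtain s2 where s2: "runs orc V walk (s(30 := Num u)) (20 * Suc u) [] s2" "s2 31 = (right_of ^^ u) (s 31)"
    "frame {30, 31} (s(30 := Num u)) s2" by auto
  have "val_size (s2 31) \<le> V"
    using val_size_right_iter[of u "s 31"] v s2(2) by simp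
  then have a3: "runs orc V (Assign 31 (LeftOf (Reg 31))) s2 5 [] (s2(31 := left_of (s2 31)))"
    using runs_Assign[of V "LeftOf (Reg 31)" s2 5] V by simp
  have a2: "runs orc V (Seq walk (Assign 31 (LeftOf (Reg 31)))) (s(30 := Num u)) (20 * u + 30) [] (s2(31 := left_of (s2 31)))"
    using runs_Seq[OF s2(1) a3 V, of "20 * u + 30"] by simp
  have "runs orc V (select x) s (20 * u + 40) [] (s2(31 := left_of (s2 31)))"
    unfolding select_def by (rule runs_Seq_Assign[where m = "20 * u + 30"]) (use a2 s size V in simp_all)
  moreover have "frame {30, 31} s (s2(31 := left_of (s2 31)))"
  proof -
    have "frame {30, 31} s (s(30 := Num u))" by (intro frame_upd frame_refl) auto
    then show ?thesis using frame_trans[OF _ s2(3)] by (intro frame_upd) auto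
  qed
  ultimately show ?thesis using s2(2) by (intro exI conjI) auto
qed

lemma run_lookup:
  assumes s: "s 28 = Num u" "s 29 = Num v" "u < 2 ^ d" "v < 2 ^ d" "d < V" and g: "val_size (s 1) \<le> V"
  shows "\<exists>s'. runs orc V lookup s (50 * (u + v + 2)) [] s' \<and>
    s' 31 = left_of ((right_of ^^ v) (left_of ((right_of ^^ u) (s 1)))) \<and> frame {30, 31} s s'"
proof -
  have V: "1 \<le> V" using s by simp
  let ?s1 = "s(31 := s 1)"
  obtain s2 where s2: "runs orc V (select 28) ?s1 (20 * u + 40) [] s2" "s2 31 = left_of ((right_of ^^ u) (s 1))"
      "frame {30, 31} ?s1 s2"
    using run_select[of ?s1 28 u d V orc] s g by auto
  have "val_size (s2 31) \<le> V"
    using val_size_right_iter[of u "s 1"] val_size_children(1)[of "(right_of ^^ u) (s 1)"] g s2(2) by simp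
  moreover have "s2 29 = Num v" using frameD[OF s2(3), of 29] s by simp
  ultimately obtain s3 where s3: "runs orc V (select 29) s2 (20 * v + 40) [] s3" "s3 31 = left_of ((right_of ^^ v) (s2 31))"
      "frame {30, 31} s2 s3"
    using run_select[of s2 29 v d V orc] s by auto
  have a2: "runs orc V (Seq (select 28) (select 29)) ?s1 (20 * (u + v) + 85) [] s3"
    using runs_Seq[OF s2(1) s3(1) V, of "20 * (u + v) + 85"] by simp
  have "runs orc V lookup s (50 * (u + v + 2)) [] s3"
    unfolding lookup_def by (rule runs_Seq_Assign[where m = "20 * (u + v) + 85"]) (use a2 g V in simp_all)
  moreover have "frame {30, 31} s s3"
  proof -
    have "frame {30, 31} s ?s1" by (intro frame_upd frame_refl) auto
    then have "frame {30, 31} s s2" using s2(3) by (rule frame_trans) auto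
    then show ?thesis using s3(3) by (rule frame_trans) auto
  qed
  ultimately show ?thesis using s3(2) s2(2) by auto
qed

section \<open>Digits, weights and matrix entries\<close>

abbreviation "src_block \<equiv> IntDiv (Reg 33) (Reg 2)"
abbreviation "tgt_block \<equiv> Minus (Reg 33) (Times (Reg 2) (IntDiv (Reg 33) (Reg 2)))"
abbreviation "either a b \<equiv> Less (Const 0) (Plus a b)"

text \<open>Truth values are numbers: negation is subtraction from 1, conjunction is a product, and
  \<open>either\<close> tests whether a sum is positive. Register 33 holds the block, 27 the type,
  28 and 29 the two proposals.\<close>

definition digit_expr :: expr where
  "digit_expr = Plus (Equal (Reg 33) (Reg 27)) (Times (Minus (Const 1) (Equal src_block tgt_block)) (Times (Const 2)
    (Plus (Times (either (Equal (Reg 33) (Reg 27)) (Equal (Reg 27) (Times src_block (Plus (Reg 2) (Const 1))))) (Reg 28))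
      (Times (either (Equal (Reg 33) (Reg 27)) (Equal (Reg 27) (Times tgt_block (Plus (Reg 2) (Const 1)))))
        (Times (Reg 4) (Reg 29))))))"

definition horner :: com where
  "horner = Seq (Assign 24 (Const 0)) (Seq (Assign 33 (Reg 5)) (While (Reg 33)
    (Seq (Assign 33 (Minus (Reg 33) (Const 1))) (Assign 24 (Plus (Times (Reg 24) (Reg 6)) digit_expr)))))"

definition validity :: com where
  "validity = Cond (Equal (IntDiv (Reg 27) (Reg 2)) (Minus (Reg 27) (Times (Reg 2) (IntDiv (Reg 27) (Reg 2)))))
    (Assign 32 (Times (Equal (Reg 28) (Reg 29)) (Less (Reg 28) (Reg 3))))
    (Cond (Less (IntDiv (Reg 27) (Reg 2)) (Minus (Reg 27) (Times (Reg 2) (IntDiv (Reg 27) (Reg 2)))))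
      (Assign 32 (Times (Less (Reg 28) (Reg 29)) (Reg 31)))
      (Assign 32 (Const 1)))"

definition weigh :: com where
  "weigh = Seq (Assign 27 (IntDiv (Reg 26) (Times (Reg 4) (Reg 4))))
    (Seq (Assign 28 (Minus (IntDiv (Reg 26) (Reg 4)) (Times (Reg 4) (IntDiv (IntDiv (Reg 26) (Reg 4)) (Reg 4)))))
    (Seq (Assign 29 (Minus (Reg 26) (Times (Reg 4) (IntDiv (Reg 26) (Reg 4)))))
    (Seq lookup (Seq validity (Cond (Reg 32) horner (Assign 24 (Const 0)))))))"

definition compute_entry :: com where
  "compute_entry = Cond (Less (Reg 25) (Reg 5))
    (Assign 24 (Minus (Const 1) (Times (Less (Reg 26) (Reg 10))
      (Minus (Const 1) (Equal (IntDiv (Reg 26) (Times (Reg 4) (Reg 4))) (Reg 25))))))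
    (Cond (Less (Reg 26) (Reg 10)) weigh (Assign 24 (Reg 11)))"

text \<open>\<open>d\<close> bounds the bit lengths of the numbers that occur in the arithmetic, and
  \<open>V\<close> the sizes of the registers that are read. A list of \<open>d\<close> bits has
  size at most \<open>3 * d + 1\<close>, hence \<open>d_V\<close>.\<close>

locale reduction_run = clique_items n k m "\<lambda>u v. {u, v} \<in> E" for n k m :: nat and E :: "nat set set" +
  fixes V d :: nat
  assumes graph: "simple_graph (n, E)" and graph_size: "val_size (enc_graph (n, E)) \<le> V"
    and d_V: "3 * d + 2 \<le> V"
    and small: "k < 2 ^ d" "n < 2 ^ d" "h < 2 ^ d" "K < 2 ^ d" "B < 2 ^ d" "N + K + 2 < 2 ^ d" "B ^ K < 2 ^ d"
begin

definition env :: "state \<Rightarrow> bool" where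
  "env s \<longleftrightarrow> s 1 = enc_graph (n, E) \<and> s 2 = Num k \<and> s 3 = Num n \<and> s 4 = Num h \<and> s 5 = Num K \<and>
    s 6 = Num B \<and> s 10 = Num N"

lemma V1: "1 \<le> V" "d < V"
  using d_V by auto

lemma fit: "x < 2 ^ d \<Longrightarrow> val_size (Num x) \<le> V"
  using V1(2) by (rule val_size_Num_le[rotated])

lemma env_sizes:
  assumes "env s"
  shows "val_size (s 1) \<le> V" "val_size (s 2) \<le> V" "val_size (s 3) \<le> V" "val_size (s 4) \<le> V"
    "val_size (s 5) \<le> V" "val_size (s 6) \<le> V" "val_size (s 10) \<le> V"
  using assms small graph_size fit by (simp_all add: env_def del: val_size.simps)

lemma env_frame: "env s \<Longrightarrow> frame A s s' \<Longrightarrow> {1, 2, 3, 4, 5, 6, 10} \<inter> A = {} \<Longrightarrow> env s'"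
  unfolding env_def frame_def by (metis disjoint_iff insertCI)

lemma digit_expr_val:
  assumes "env s" "s 33 = Num b" "s 27 = Num t" "s 28 = Num u" "s 29 = Num v"
  shows "expr_val digit_expr s = Num (digit b t u v)"
proof -
  have [simp]: "Suc 0 - of_bool P = of_bool (\<not> P)" "0 < (of_bool P + of_bool Q :: nat) \<longleftrightarrow> P \<or> Q" for P Q
    by (auto simp: of_bool_def)
  have [simp]: "b - k * (b div k) = b mod k" by (simp add: minus_mult_div_eq_mod)
  show ?thesis
    using assms by (simp add: env_def digit_expr_def digit_def)
qed

lemma run_horner:
  assumes s: "env s" "s 27 = Num t" "s 28 = Num u" "s 29 = Num v"
    and less: "t < 2 ^ d" "u < h" "v < h"
  shows "\<exists>s'. runs orc V horner s (500 * Suc K) [] s' \<and> s' 24 = Num (\<Sum>b<K. digit b t u v * B ^ b) \<and>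
    frame {24, 33} s s'"
proof -
  \<comment> \<open>The value of Horner's scheme after \<open>i\<close> rounds: the number formed by
    the \<open>i\<close> highest digits.\<close>
  define acc where "acc i = (\<Sum>b<i. digit (K - i + b) t u v * B ^ b)" for i
  define I where "I i s' \<longleftrightarrow> i \<le> K \<and> s' 33 = Num (K - i) \<and> s' 24 = Num (acc i) \<and> frame {24, 33} s s'" for i s'
  have acc_less: "acc i < 2 ^ d" if "i \<le> K" for i
  proof -
    have "acc i < B ^ i" unfolding acc_def using less by (intro digit_sum_less digit_less) auto
    also have "\<dots> \<le> B ^ K" using that h_pos by (intro power_increasing) (auto simp: B_def)
    finally show ?thesis using small(7) by simp
  qed
  have step: "acc (Suc i) = acc i * B + digit (K - Suc i) t u v" if "i < K" for i
  proof -
    have "K - Suc i + Suc b = K - i + b" for b using that by simp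
    then show ?thesis
      unfolding acc_def by (simp add: sum.lessThan_Suc_shift sum_distrib_left mult_ac del: sum.lessThan_Suc)
  qed
  have K_fit: "K - i < 2 ^ d" for i using small(4) by (rule le_less_trans[rotated]) simp
  have uv: "u < 2 ^ d" "v < 2 ^ d" using less small(3) by auto
  let ?body = "Seq (Assign 33 (Minus (Reg 33) (Const 1))) (Assign 24 (Plus (Times (Reg 24) (Reg 6)) digit_expr))"
  let ?s0 = "s(24 := Num 0, 33 := Num K)"
  have "\<exists>s'. runs orc V (While (Reg 33) ?body) ?s0 (450 * Suc K) [] s' \<and> I K s'"
  proof (rule runs_While[where m = 400])
    show "I 0 ?s0" by (simp add: I_def acc_def frame_upd frame_refl)
    show "fits V s' (regs (Reg 33))" if "I i s'" for i s'
      using that fit[OF K_fit[of i]] V1 by (simp add: I_def del: val_size.simps)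
    show "expr_val (Reg 33) s' = Num 0" if "I K s'" for s' using that by (simp add: I_def)
    fix i s' assume i: "i < K" "I i s'"
    then have fr: "frame {24, 33} s s'" and regs: "s' 33 = Num (K - i)" "s' 24 = Num (acc i)"
      by (simp_all add: I_def)
    define s1 where "s1 = s'(33 := Num (K - Suc i))"
    have fr1: "frame {24, 33} s s1" unfolding s1_def by (rule frame_upd[OF fr]) simp
    then have e1: "env s1" by (rule env_frame[OF s(1)]) simp
    have r1: "s1 33 = Num (K - Suc i)" "s1 24 = Num (acc i)" "s1 27 = Num t" "s1 28 = Num u" "s1 29 = Num v"
      using frameD[OF fr1] s regs by (simp_all add: s1_def)
    have "runs orc V (Assign 24 (Plus (Times (Reg 24) (Reg 6)) digit_expr)) s1 350 []
        (s1(24 := expr_val (Plus (Times (Reg 24) (Reg 6)) digit_expr) s1))"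
    proof (rule runs_Assign)
      show "fits V s1 (regs (Plus (Times (Reg 24) (Reg 6)) digit_expr))"
        using r1 env_sizes[OF e1] fit[OF K_fit[of "Suc i"]] fit[OF acc_less[of i]] fit[OF uv(1)] fit[OF uv(2)]
          fit[OF less(1)] i(1) V1(1)
        by (simp add: digit_expr_def del: val_size.simps)
    qed (simp add: digit_expr_def)
    moreover have "expr_val (Plus (Times (Reg 24) (Reg 6)) digit_expr) s1 = Num (acc (Suc i))"
      using digit_expr_val[OF e1 r1(1,3,4,5)] r1 e1 step[OF i(1)] by (simp add: env_def)
    ultimately have a: "runs orc V (Assign 24 (Plus (Times (Reg 24) (Reg 6)) digit_expr)) s1 350 []
        (s1(24 := Num (acc (Suc i))))" by simp
    have "runs orc V ?body s' 400 [] (s1(24 := Num (acc (Suc i))))"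
    proof (rule runs_Seq_Assign[where m = 350])
      show "runs orc V (Assign 24 (Plus (Times (Reg 24) (Reg 6)) digit_expr)) (s'(33 := expr_val (Minus (Reg 33) (Const 1)) s')) 350 []
          (s1(24 := Num (acc (Suc i))))"
        using a regs by (simp add: s1_def)
    qed (use regs fit[OF K_fit[of i]] V1 in \<open>simp_all del: val_size.simps\<close>)
    moreover have "I (Suc i) (s1(24 := Num (acc (Suc i))))"
      using i r1 frame_upd[OF fr1] by (simp add: I_def)
    ultimately show "expr_val (Reg 33) s' \<noteq> Num 0 \<and> (\<exists>s''. runs orc V ?body s' 400 [] s'' \<and> I (Suc i) s'')"
      using regs i(1) by auto
  qed simp
  then obtain s' where s': "runs orc V (While (Reg 33) ?body) ?s0 (450 * Suc K) [] s'" "I K s'" by blast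
  have K: "s 5 = Num K" using s(1) by (simp add: env_def)
  have "runs orc V horner s (500 * Suc K) [] s'"
    unfolding horner_def
  proof (rule runs_Seq_Assign[where m = "470 * Suc K"])
    show "runs orc V (Seq (Assign 33 (Reg 5)) (While (Reg 33) ?body)) (s(24 := expr_val (Const 0) s)) (470 * Suc K) [] s'"
    proof (rule runs_Seq_Assign[where m = "450 * Suc K"])
      show "runs orc V (While (Reg 33) ?body) ((s(24 := expr_val (Const 0) s))(33 := expr_val (Reg 5) (s(24 := expr_val (Const 0) s))))
          (450 * Suc K) [] s'"
        using s'(1) K by simp
    qed (use env_sizes(5)[OF s(1)] V1 in simp_all)
  qed (use V1 in simp_all)
  moreover have "s' 24 = Num (\<Sum>b<K. digit b t u v * B ^ b)" "frame {24, 33} s s'"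
    using s'(2) by (simp_all add: I_def acc_def)
  ultimately show ?thesis by blast
qed

end

section \<open>Assembling the encoded matrix column by column\<close>

lemma val_size_enc_list:
  "(\<And>x. x \<in> set xs \<Longrightarrow> val_size (e x) \<le> b) \<Longrightarrow> val_size (enc_list e xs) \<le> length xs * (b + 1) + 1"
proof (induction xs)
  case (Cons x xs)
  have "val_size (e x) \<le> b" "val_size (enc_list e xs) \<le> length xs * (b + 1) + 1"
    using Cons by simp_all
  then show ?case by simp
qed simp

definition compute_elem :: "bool \<Rightarrow> com" where
  "compute_elem dual = Cond (Less (Reg 21) (Reg 12)) (Assign 24 (Equal (Reg 20) (Reg 21)))
    (Seq (Assign 25 (if dual then Minus (Reg 21) (Reg 12) else Reg 20))
    (Seq (Assign 26 (if dual then Reg 20 else Minus (Reg 21) (Reg 12))) compute_entry))"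

text \<open>Lists grow at the head, so rows, and likewise columns, are processed from the last to
  the first.\<close>

definition column_step :: "bool \<Rightarrow> com" where
  "column_step dual = Seq (Assign 20 (Minus (Reg 20) (Const 1))) (Seq (compute_elem dual)
    (Seq (Assign 36 (Reg 24)) (Seq conv (Assign 23 (MkCell (Reg 35) (Reg 23))))))"

definition build_column :: "bool \<Rightarrow> com" where
  "build_column dual = Seq (Assign 23 (Const 0)) (Seq (Assign 20 (Reg 12)) (While (Reg 20) (column_step dual)))"

definition matrix_step :: "bool \<Rightarrow> com" where
  "matrix_step dual = Seq (Assign 21 (Minus (Reg 21) (Const 1))) (Seq (build_column dual)
    (Assign 22 (MkCell (Reg 23) (Reg 22))))"

definition build_matrix :: "bool \<Rightarrow> com" where
  "build_matrix dual = Seq (Assign 22 (Const 0)) (Seq (Assign 21 (Plus (Reg 12) (Reg 13)))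
    (While (Reg 21) (matrix_step dual)))"

context reduction_run
begin

abbreviation "scratch \<equiv> {24, 25, 26, 27, 28, 29, 30, 31, 32, 33, 35, 36 :: nat}"

lemma run_validity:
  assumes s: "env s" "s 27 = Num t" "s 28 = Num u" "s 29 = Num v" "s 31 = Num (of_bool ({u, v} \<in> E))"
    and less: "t < 2 ^ d" "u < 2 ^ d" "v < 2 ^ d"
  shows "runs orc V validity s 100 [] (s(32 := Num (of_bool (valid_item t u v))))"
proof -
  have mod: "t - k * (t div k) = t mod k" by (simp add: minus_mult_div_eq_mod)
  have r: "s 2 = Num k" "s 3 = Num n" using s(1) by (simp_all add: env_def)
  have "val_size (Num (of_bool P)) \<le> V" for P using fit[of "of_bool P"] d_V V1 small(6) by (cases P) auto
  then have sz: "val_size (s 2) \<le> V" "val_size (s 3) \<le> V" "val_size (s 27) \<le> V" "val_size (s 28) \<le> V" "val_size (s 29) \<le> V" "val_size (s 31) \<le> V"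
    using s env_sizes[OF s(1)] fit less by (simp_all del: val_size.simps)
  have [simp]: "Num a = Num b \<longleftrightarrow> a = b" for a b by simp
  show ?thesis
    unfolding validity_def
  proof (rule runs_Cond[where m = 70], goal_cases)
    case 1
    then show ?case using sz V1 by simp
  next
    case 2
    then have "t div k = t mod k" using s r mod by (auto split: if_splits)
    then have "expr_val (Times (Equal (Reg 28) (Reg 29)) (Less (Reg 28) (Reg 3))) s = Num (of_bool (valid_item t u v))"
      using s r by (simp add: valid_item_def of_bool_conj)
    then show ?case
      using runs_Assign[of V "Times (Equal (Reg 28) (Reg 29)) (Less (Reg 28) (Reg 3))" s 70 orc 32] sz V1 by simp
  next
    case 3
    then have ne: "t div k \<noteq> t mod k" using s r mod by (auto split: if_splits)
    show ?case
    proof (rule runs_Cond[where m = 30], goal_cases)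
      case 1
      then show ?case using sz V1 by simp
    next
      case 2
      then have "t div k < t mod k" using s r mod by (auto split: if_splits)
      then have "expr_val (Times (Less (Reg 28) (Reg 29)) (Reg 31)) s = Num (of_bool (valid_item t u v))"
        using s r by (simp add: valid_item_def of_bool_conj)
      then show ?case
        using runs_Assign[of V "Times (Less (Reg 28) (Reg 29)) (Reg 31)" s 30 orc 32] sz V1 by simp
    next
      case 3
      then have "\<not> t div k < t mod k" using s r mod by (auto split: if_splits)
      then have "expr_val (Const 1) s = Num (of_bool (valid_item t u v))"
        using ne by (simp add: valid_item_def)
      then show ?case
        using runs_Assign[of V "Const 1" s 30 orc 32] sz V1 by simp
    qed simp
  qed simp
qed

lemma run_weigh:
  assumes s: "env s" "s 26 = Num e" and e: "e < N"
  shows "\<exists>s'. runs orc V weigh s (1000 * (K + h + 1)) [] s' \<and> s' 24 = Num (weight e) \<and> frame scratch s s'"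
proof -
  define t u v where "t = type_of e" and "u = src_of e" and "v = tgt_of e"
  have uv: "u < h" "v < h" by (simp_all add: u_def v_def src_less tgt_less)
  have t: "t < K" unfolding t_def using e by (rule type_less)
  have less: "t < 2 ^ d" "u < 2 ^ d" "v < 2 ^ d" "e < 2 ^ d" using t uv e small by linarith+
  have rh: "s 4 = Num h" using s(1) by (simp add: env_def)
  have sz: "val_size (s 26) \<le> V" "val_size (s 4) \<le> V" using s env_sizes[OF s(1)] fit less by (simp_all del: val_size.simps)
  have eqs: "e div (h * h) = t" "e div h - h * (e div h div h) = u" "e - h * (e div h) = v"
    by (simp_all add: t_def u_def v_def type_of_def src_of_def tgt_of_def minus_mult_div_eq_mod)
  define s1 where "s1 = s(27 := Num t, 28 := Num u, 29 := Num v)"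
  have fr1: "frame scratch s s1" unfolding s1_def by (intro frame_upd frame_refl) auto
  have e1: "env s1" by (rule env_frame[OF s(1) fr1]) simp
  obtain s2 where s2: "runs orc V lookup s1 (50 * (u + v + 2)) [] s2"
    "s2 31 = left_of ((right_of ^^ v) (left_of ((right_of ^^ u) (s1 1))))" "frame {30, 31} s1 s2"
    using run_lookup[of s1 u v d V orc] less V1 env_sizes(1)[OF e1] by (auto simp: s1_def)
  have e2: "env s2" by (rule env_frame[OF e1 s2(3)]) simp
  have r2: "s2 27 = Num t" "s2 28 = Num u" "s2 29 = Num v" using frameD[OF s2(3)] by (simp_all add: s1_def)
  have adj: "s2 31 = Num (of_bool ({u, v} \<in> E))"
    using s2(2) e1 lookup_enc_graph[OF graph] by (simp add: env_def)
  define s3 where "s3 = s2(32 := Num (of_bool (valid_item t u v)))"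
  have v3: "runs orc V validity s2 100 [] s3"
    unfolding s3_def by (rule run_validity[OF e2 r2 adj less(1-3)])
  have fr3: "frame scratch s s3"
    unfolding s3_def by (intro frame_upd frame_trans[OF fr1 s2(3)]) auto
  have e3: "env s3" by (rule env_frame[OF s(1) fr3]) simp
  have r3: "s3 27 = Num t" "s3 28 = Num u" "s3 29 = Num v" "s3 32 = Num (of_bool (valid_item t u v))"
    using r2 by (simp_all add: s3_def)
  have z32: "val_size (s3 32) \<le> V" using r3(4) fit[of 1] fit[of 0] d_V small(6) by (cases "valid_item t u v") auto
  have "\<exists>s'. runs orc V (Cond (Reg 32) horner (Assign 24 (Const 0))) s3 (500 * Suc K + 20) [] s' \<and>
      s' 24 = Num (weight e) \<and> frame {24, 33} s3 s'"
  proof (cases "valid_item t u v")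
    case True
    obtain s' where s': "runs orc V horner s3 (500 * Suc K) [] s'" "s' 24 = Num (\<Sum>b<K. digit b t u v * B ^ b)"
      "frame {24, 33} s3 s'" using run_horner[OF e3 r3(1-3) less(1) uv, of orc] by blast
    have "runs orc V (Cond (Reg 32) horner (Assign 24 (Const 0))) s3 (500 * Suc K + 20) [] s'"
      by (rule runs_Cond[where m = "500 * Suc K"]) (use s'(1) True r3(4) z32 V1 in simp_all)
    then show ?thesis using s' True by (auto simp: weight_def t_def u_def v_def)
  next
    case False
    have "runs orc V (Cond (Reg 32) horner (Assign 24 (Const 0))) s3 (500 * Suc K + 20) [] (s3(24 := Num 0))"
    proof (rule runs_Cond[where m = "500 * Suc K"])
      show "runs orc V (Assign 24 (Const 0)) s3 (500 * Suc K) [] (s3(24 := Num 0))"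
        using runs_Assign[of V "Const 0" s3 "500 * Suc K" orc 24] V1 by simp
    qed (use False r3(4) z32 V1 in simp_all)
    moreover have "frame {24, 33} s3 (s3(24 := Num 0))" by (intro frame_upd frame_refl) auto
    ultimately show ?thesis using False by (intro exI[of _ "s3(24 := Num 0)"]) (auto simp: weight_def t_def u_def v_def)
  qed
  then obtain s' where s': "runs orc V (Cond (Reg 32) horner (Assign 24 (Const 0))) s3 (500 * Suc K + 20) [] s'"
      "s' 24 = Num (weight e)" "frame {24, 33} s3 s'" by blast
  have A: "runs orc V (Seq validity (Cond (Reg 32) horner (Assign 24 (Const 0)))) s2 (500 * Suc K + 150) [] s'"
    using runs_Seq[OF v3 s'(1) V1(1), of "500 * Suc K + 150"] by simp
  have B: "runs orc V (Seq lookup (Seq validity (Cond (Reg 32) horner (Assign 24 (Const 0))))) s1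
      (500 * Suc K + 200 + 100 * h) [] s'"
    using runs_Seq[OF s2(1) A V1(1), of "500 * Suc K + 200 + 100 * h"] uv by simp
  have "runs orc V weigh s (1000 * (K + h + 1)) [] s'"
    unfolding weigh_def
  proof (rule runs_Seq_Assign[where m = "500 * Suc K + 300 + 100 * h"], goal_cases)
    case 2
    show ?case
    proof (rule runs_Seq_Assign[where m = "500 * Suc K + 250 + 100 * h"], goal_cases)
      case 2
      show ?case
      proof (rule runs_Seq_Assign[where m = "500 * Suc K + 200 + 100 * h"], goal_cases)
        case 2
        show ?case using B s(2) rh eqs by (simp add: s1_def)
      qed (use sz V1 in simp_all)
    qed (use sz V1 in simp_all)
  qed (use sz V1 in simp_all)
  moreover have "frame scratch s s'" by (rule frame_trans[OF fr3 s'(3)]) auto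
  ultimately show ?thesis using s'(2) by blast
qed

lemma run_compute_entry:
  assumes s: "env s" "s 11 = Num g" "s 25 = Num i" "s 26 = Num j"
    and less: "g < 2 ^ d" "i < 2 ^ d" "j < 2 ^ d"
  shows "\<exists>s'. runs orc V compute_entry s (1050 * (K + h + 1)) [] s' \<and> s' 24 = Num (entry g i j) \<and> frame scratch s s'"
proof -
  have r: "s 4 = Num h" "s 5 = Num K" "s 10 = Num N" using s(1) by (simp_all add: env_def)
  have sz: "val_size (s 4) \<le> V" "val_size (s 5) \<le> V" "val_size (s 10) \<le> V" "val_size (s 11) \<le> V" "val_size (s 25) \<le> V"
      "val_size (s 26) \<le> V"
    using s env_sizes[OF s(1)] fit less by (simp_all del: val_size.simps)
  have h1: "h \<ge> 1" using h_pos by simp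
  have "\<exists>s'. runs orc V (if i < K then Assign 24 (Minus (Const 1) (Times (Less (Reg 26) (Reg 10))
      (Minus (Const 1) (Equal (IntDiv (Reg 26) (Times (Reg 4) (Reg 4))) (Reg 25)))))
      else Cond (Less (Reg 26) (Reg 10)) weigh (Assign 24 (Reg 11))) s (1000 * (K + h + 1) + 20) [] s' \<and>
      s' 24 = Num (entry g i j) \<and> frame scratch s s'"
  proof (cases "i < K")
    case True
    let ?e = "Minus (Const 1) (Times (Less (Reg 26) (Reg 10))
      (Minus (Const 1) (Equal (IntDiv (Reg 26) (Times (Reg 4) (Reg 4))) (Reg 25))))"
    have "expr_val ?e s = Num (entry g i j)"
      using s r True by (auto simp: entry_def type_of_def of_bool_def)
    moreover have "runs orc V (Assign 24 ?e) s (1000 * (K + h + 1) + 20) [] (s(24 := expr_val ?e s))"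
      by (rule runs_Assign) (use sz V1 in simp_all)
    ultimately show ?thesis using True
      by (intro exI[of _ "s(24 := Num (entry g i j))"]) (auto intro!: frame_upd frame_refl)
  next
    case False
    show ?thesis
    proof (cases "j < N")
      case True
      obtain s' where s': "runs orc V weigh s (1000 * (K + h + 1)) [] s'" "s' 24 = Num (weight j)" "frame scratch s s'"
        using run_weigh[OF s(1,4) True] by blast
      have "runs orc V (Cond (Less (Reg 26) (Reg 10)) weigh (Assign 24 (Reg 11))) s (1000 * (K + h + 1) + 20) [] s'"
        by (rule runs_Cond[where m = "1000 * (K + h + 1)"]) (use s'(1) True s r sz V1 in simp_all)
      then show ?thesis using s' True False by (auto simp: entry_def)
    next
      case nj: False
      have "runs orc V (Cond (Less (Reg 26) (Reg 10)) weigh (Assign 24 (Reg 11))) s (1000 * (K + h + 1) + 20) [] (s(24 := Num g))"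
      proof (rule runs_Cond[where m = "1000 * (K + h + 1)"])
        show "runs orc V (Assign 24 (Reg 11)) s (1000 * (K + h + 1)) [] (s(24 := Num g))"
          using runs_Assign[of V "Reg 11" s "1000 * (K + h + 1)" orc 24] s sz V1 by simp
      qed (use nj s r sz V1 in simp_all)
      then show ?thesis using nj False
        by (intro exI[of _ "s(24 := Num g)"]) (auto simp: entry_def intro!: frame_upd frame_refl)
    qed
  qed
  then obtain s' where s': "runs orc V (if i < K then Assign 24 (Minus (Const 1) (Times (Less (Reg 26) (Reg 10))
      (Minus (Const 1) (Equal (IntDiv (Reg 26) (Times (Reg 4) (Reg 4))) (Reg 25)))))
      else Cond (Less (Reg 26) (Reg 10)) weigh (Assign 24 (Reg 11))) s (1000 * (K + h + 1) + 20) [] s'"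
      "s' 24 = Num (entry g i j)" "frame scratch s s'" by blast
  have "runs orc V compute_entry s (1050 * (K + h + 1)) [] s'"
    unfolding compute_entry_def
    by (rule runs_Cond[where m = "1000 * (K + h + 1) + 20"]) (use s'(1) s r sz V1 h1 in \<open>simp_all split: if_splits\<close>)
  then show ?thesis using s' by blast
qed

end

text \<open>\<open>mat_V\<close> makes room for the encoded matrix: at most \<open>N + K + 2\<close>
  columns with at most that many entries, each entry of size at most \<open>3 * d + 1\<close>, one
  more for each cell and for the end of each list.\<close>

locale matrix_run = reduction_run n k m E V d for n k m E V d +
  fixes dual :: bool and g :: nat
  assumes g: "g < 2 ^ d"
    and mat_V: "(N + K + 2) * ((N + K + 2) * (3 * d + 2) + 2) + 1 \<le> V"
begin

definition "nrows = (if dual then Suc N else Suc K)"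
definition "nothers = (if dual then Suc K else Suc N)"
definition "mentry = (if dual then (\<lambda>j i. entry g i j) else entry g)"
text \<open>The part from row \<open>i0\<close> on is what the downward loop has built when it
  reaches that row.\<close>

definition "column i0 j = map (\<lambda>i. bits (standard_nat_mat nrows nothers mentry $$ (i, j))) [i0..<nrows]"
definition "col_val i0 j = enc_list (enc_list Num) (column i0 j)"
definition "mat_val j0 = enc_list (enc_list (enc_list Num)) (map (column 0) [j0..<nrows + nothers])"

definition env' :: "state \<Rightarrow> bool" where
  "env' s \<longleftrightarrow> env s \<and> s 11 = Num g \<and> s 12 = Num nrows \<and> s 13 = Num nothers"

lemma env'_frame: "env' s \<Longrightarrow> frame A s s' \<Longrightarrow> {1, 2, 3, 4, 5, 6, 10, 11, 12, 13} \<inter> A = {} \<Longrightarrow> env' s'"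
  unfolding env'_def using env_frame[of s A s'] frameD[of A s s'] by auto

lemma total: "nrows + nothers = N + K + 2" "nrows < 2 ^ d" "nothers < 2 ^ d"
  using small(6) by (auto simp: nrows_def nothers_def)

lemma mat_less:
  assumes "i < nrows" "j < nrows + nothers"
  shows "standard_nat_mat nrows nothers mentry $$ (i, j) < 2 ^ d"
proof -
  have "mentry a b < 2 ^ d" for a b
    using entry_less[OF g small(7)] by (simp add: mentry_def)
  moreover have "1 < (2::nat) ^ d" using small(6) by linarith
  ultimately show ?thesis using assms by (auto simp: standard_nat_mat_def)
qed

lemma size_bits: "x < 2 ^ d \<Longrightarrow> val_size (enc_list Num (bits x)) \<le> 3 * d + 1"
  using val_size_enc_bits[OF set_bits, of x] length_bits_le[of x d] by simp

lemma size_col: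
  assumes "j < nrows + nothers"
  shows "val_size (col_val i0 j) \<le> (N + K + 2) * (3 * d + 2) + 1" "val_size (col_val i0 j) \<le> V"
proof -
  have "val_size (col_val i0 j) \<le> (nrows - i0) * (3 * d + 1 + 1) + 1"
  proof -
    have "val_size (enc_list Num x) \<le> 3 * d + 1"
      if "x \<in> set (column i0 j)" for x
      using that size_bits mat_less assms by (auto simp: column_def)
    then show ?thesis using val_size_enc_list[of "column i0 j" "enc_list Num" "3 * d + 1"]
      by (simp add: col_val_def column_def)
  qed
  also have "\<dots> \<le> (N + K + 2) * (3 * d + 2) + 1"
  proof -
    have "nrows - i0 \<le> N + K + 2" using total(1) by linarith
    from mult_le_mono1[OF this, of "3 * d + 2"] show ?thesis by simp
  qed
  finally show 1: "val_size (col_val i0 j) \<le> (N + K + 2) * (3 * d + 2) + 1" .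
  have "(N + K + 2) * (3 * d + 2) + 1 \<le> 1 * ((N + K + 2) * (3 * d + 2) + 2) + 1" by simp
  also have "\<dots> \<le> (N + K + 2) * ((N + K + 2) * (3 * d + 2) + 2) + 1"
    by (intro add_mono mult_le_mono) auto
  finally show "val_size (col_val i0 j) \<le> V" using 1 mat_V by linarith
qed

lemma size_mat: "val_size (mat_val j0) \<le> V"
proof -
  have "val_size (mat_val j0) \<le> (nrows + nothers - j0) * ((N + K + 2) * (3 * d + 2) + 1 + 1) + 1"
  proof -
    have "val_size (enc_list (enc_list Num) x) \<le> (N + K + 2) * (3 * d + 2) + 1"
      if "x \<in> set (map (column 0) [j0..<nrows + nothers])" for x
      using that size_col(1)[of _ 0] by (auto simp: col_val_def)
    then show ?thesis using val_size_enc_list[of "map (column 0) [j0..<nrows + nothers]" "enc_list (enc_list Num)" "(N + K + 2) * (3 * d + 2) + 1"]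
      by (simp add: mat_val_def)
  qed
  also have "\<dots> \<le> (N + K + 2) * ((N + K + 2) * (3 * d + 2) + 2) + 1"
  proof -
    have "nrows + nothers - j0 \<le> N + K + 2" using total(1) by linarith
    from mult_le_mono1[OF this, of "(N + K + 2) * (3 * d + 2) + 2"] show ?thesis by simp
  qed
  finally show ?thesis using mat_V by linarith
qed

lemma run_compute_elem:
  assumes s: "env' s" "s 20 = Num i" "s 21 = Num j" and less: "i < nrows" "j < nrows + nothers"
  shows "\<exists>s'. runs orc V (compute_elem dual) s (1100 * (K + h + 1)) [] s' \<and>
    s' 24 = Num (standard_nat_mat nrows nothers mentry $$ (i, j)) \<and> frame scratch s s'"
proof -
  have r: "env s" "s 11 = Num g" "s 12 = Num nrows" "s 13 = Num nothers" using s(1) by (simp_all add: env'_def)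
  have ij: "i < 2 ^ d" "j < 2 ^ d" using less total small(6) by linarith+
  have sz: "val_size (s 12) \<le> V" "val_size (s 20) \<le> V" "val_size (s 21) \<le> V"
    using s r ij total fit by (simp_all del: val_size.simps)
  have h1: "h \<ge> 1" using h_pos by simp
  show ?thesis
  proof (cases "j < nrows")
    case True
    have "runs orc V (compute_elem dual) s (1100 * (K + h + 1)) [] (s(24 := Num (of_bool (i = j))))"
      unfolding compute_elem_def
    proof (rule runs_Cond[where m = 20])
      show "runs orc V (Assign 24 (Equal (Reg 20) (Reg 21))) s 20 [] (s(24 := Num (of_bool (i = j))))"
        using runs_Assign[of V "Equal (Reg 20) (Reg 21)" s 20 orc 24] s sz V1 by simp
    qed (use True s r sz V1 h1 in simp_all)
    then show ?thesis using True less
      by (intro exI[of _ "s(24 := Num (of_bool (i = j)))"]) (auto simp: standard_nat_mat_def intro!: frame_upd frame_refl)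
  next
    case False
    define a b where "a = (if dual then j - nrows else i)" and "b = (if dual then i else j - nrows)"
    define ea eb where "ea = (if dual then Minus (Reg 21) (Reg 12) else Reg 20)"
      and "eb = (if dual then Reg 20 else Minus (Reg 21) (Reg 12))"
    define s1 where "s1 = s(25 := Num a, 26 := Num b)"
    have fr1: "frame scratch s s1" unfolding s1_def by (intro frame_upd frame_refl) auto
    have e1: "env s1" by (rule env_frame[OF r(1) fr1]) simp
    have ab: "a < 2 ^ d" "b < 2 ^ d" using ij by (auto simp: a_def b_def intro: le_less_trans[of _ j])
    obtain s' where s': "runs orc V compute_entry s1 (1050 * (K + h + 1)) [] s'" "s' 24 = Num (entry g a b)" "frame scratch s1 s'"
      using run_compute_entry[OF e1, of g a b orc] r ab g by (auto simp: s1_def)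
    obtain R where R: "R = nrows" by blast
    have val: "expr_val ea s = Num a" "expr_val eb (s(25 := v)) = Num b" for v
      using s(2,3) r(3) unfolding ea_def eb_def a_def b_def R[symmetric] by simp_all
    have work: "work ea \<le> 3" "work eb \<le> 3" by (simp_all add: ea_def eb_def)
    have fits: "fits V s (regs ea)" "fits V (s(25 := v)) (regs eb)" for v
      using sz V1 by (simp_all add: ea_def eb_def)
    have "runs orc V (compute_elem dual) s (1100 * (K + h + 1)) [] s'"
      unfolding compute_elem_def ea_def[symmetric] eb_def[symmetric]
    proof (rule runs_Cond[where m = "1050 * (K + h + 1) + 20"])
      show "runs orc V (Seq (Assign 25 ea) (Seq (Assign 26 eb) compute_entry)) s (1050 * (K + h + 1) + 20) [] s'"
      proof (rule runs_Seq_Assign[where m = "1050 * (K + h + 1) + 10"])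
        show "runs orc V (Seq (Assign 26 eb) compute_entry) (s(25 := expr_val ea s)) (1050 * (K + h + 1) + 10) [] s'"
        proof (rule runs_Seq_Assign[where m = "1050 * (K + h + 1)"])
          show "runs orc V compute_entry ((s(25 := expr_val ea s))(26 := expr_val eb (s(25 := expr_val ea s))))
              (1050 * (K + h + 1)) [] s'"
            using s'(1) val by (simp add: s1_def)
        qed (use fits work in simp_all)
      qed (use fits work in simp_all)
    qed (use False s(2,3) r sz V1 h1 in simp_all)
    moreover have "entry g a b = standard_nat_mat nrows nothers mentry $$ (i, j)"
      using False less by (auto simp: standard_nat_mat_def a_def b_def mentry_def)
    moreover have "frame scratch s s'" by (rule frame_trans[OF fr1 s'(3)]) auto
    ultimately show ?thesis using s'(2) by auto
  qed
qed

definition "step_cost = 1100 * (K + h + 1) + 50 * Suc d + 100"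
definition "col_cost = Suc (N + K + 2) * (step_cost + 10) + 20"
definition "mat_cost = Suc (N + K + 2) * (col_cost + 30) + 20"

lemma run_build_column:
  assumes s: "env' s" "s 21 = Num j" and j: "j < nrows + nothers"
  shows "\<exists>s'. runs orc V (build_column dual) s col_cost [] s' \<and> s' 23 = col_val 0 j \<and> frame ({20, 23} \<union> scratch) s s'"
proof -
  have r: "s 12 = Num nrows" using s(1) by (simp_all add: env'_def)
  have jd: "j < 2 ^ d" using j total small(6) by linarith
  define I where "I i s' \<longleftrightarrow> i \<le> nrows \<and> s' 20 = Num (nrows - i) \<and> s' 23 = col_val (nrows - i) j \<and>
    frame ({20, 23} \<union> scratch) s s'" for i s'
  let ?s0 = "s(23 := Num 0, 20 := Num nrows)"
  have fitr: "val_size (Num (nrows - i)) \<le> V" for i using total(2) by (intro fit) (rule le_less_trans[rotated], auto)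
  have "\<exists>s'. runs orc V (While (Reg 20) (column_step dual)) ?s0 (Suc (N + K + 2) * (step_cost + 10)) [] s' \<and> I nrows s'"
  proof (rule runs_While[where m = step_cost])
    show "I 0 ?s0" by (auto simp: I_def col_val_def column_def intro!: frame_upd frame_refl)
    show "fits V s' (regs (Reg 20))" if "I i s'" for i s'
      using that fitr[of i] V1 by (simp add: I_def del: val_size.simps)
    show "expr_val (Reg 20) s' = Num 0" if "I nrows s'" for s' using that by (simp add: I_def)
    show "Suc nrows * Suc (work (Reg 20) + step_cost) \<le> Suc (N + K + 2) * (step_cost + 10)"
      using total(1) by (intro mult_le_mono) auto
    fix i s' assume i: "i < nrows" "I i s'"
    define i' where "i' = nrows - Suc i"
    have i': "i' < nrows" "nrows - i = Suc i'" using i(1) by (auto simp: i'_def)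
    have fr: "frame ({20, 23} \<union> scratch) s s'" and regs: "s' 20 = Num (nrows - i)" "s' 23 = col_val (nrows - i) j"
      using i by (simp_all add: I_def)
    define s1 where "s1 = s'(20 := Num i')"
    have fr1: "frame ({20, 23} \<union> scratch) s s1" unfolding s1_def by (rule frame_upd[OF fr]) simp
    have e1: "env' s1" by (rule env'_frame[OF s(1) fr1]) simp
    have r1: "s1 20 = Num i'" "s1 21 = Num j" "s1 23 = col_val (nrows - i) j"
      using frameD[OF fr1, of 21] s(2) regs by (simp_all add: s1_def)
    let ?x = "standard_nat_mat nrows nothers mentry $$ (i', j)"
    have x: "?x < 2 ^ d" by (rule mat_less[OF i'(1) j])
    obtain s2 where s2: "runs orc V (compute_elem dual) s1 (1100 * (K + h + 1)) [] s2" "s2 24 = Num ?x" "frame scratch s1 s2"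
      using run_compute_elem[OF e1 r1(1,2) i'(1) j] by blast
    have fr2: "frame ({20, 23} \<union> scratch) s s2" by (rule frame_trans[OF fr1 s2(3)]) auto
    define s3 where "s3 = s2(36 := Num ?x)"
    have fr3: "frame ({20, 23} \<union> scratch) s s3" unfolding s3_def by (rule frame_upd[OF fr2]) simp
    obtain s4 where s4: "runs orc V conv s3 (50 * Suc d) [] s4" "s4 35 = enc_list Num (bits ?x)" "frame {35, 36} s3 s4"
      using run_conv[of s3 ?x d V orc] x d_V by (auto simp: s3_def)
    have fr4: "frame ({20, 23} \<union> scratch) s s4" by (rule frame_trans[OF fr3 s4(3)]) auto
    have r4: "s4 23 = col_val (nrows - i) j" "s4 20 = Num i'"
      using frameD[OF s4(3)] frameD[OF s2(3)] r1 by (simp_all add: s3_def)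
    define s5 where "s5 = s4(23 := col_val i' j)"
    have cons: "Cell (enc_list Num (bits ?x)) (col_val (nrows - i) j) = col_val i' j"
      unfolding i'(2) col_val_def column_def using i'(1) by (simp add: upt_conv_Cons)
    have "val_size (s4 35) \<le> V" using size_bits[OF x] d_V s4(2) by simp
    then have a5: "runs orc V (Assign 23 (MkCell (Reg 35) (Reg 23))) s4 20 [] s5"
      using runs_Assign[of V "MkCell (Reg 35) (Reg 23)" s4 20 orc 23] r4 s4(2) cons size_col(2)[OF j] V1
      by (simp add: s5_def)
    have a4: "runs orc V (Seq conv (Assign 23 (MkCell (Reg 35) (Reg 23)))) s3 (50 * Suc d + 30) [] s5"
      using runs_Seq[OF s4(1) a5 V1(1), of "50 * Suc d + 30"] by simp
    have a3: "runs orc V (Seq (Assign 36 (Reg 24)) (Seq conv (Assign 23 (MkCell (Reg 35) (Reg 23))))) s2 (50 * Suc d + 40) [] s5"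
    proof (rule runs_Seq_Assign[where m = "50 * Suc d + 30"])
      show "runs orc V (Seq conv (Assign 23 (MkCell (Reg 35) (Reg 23)))) (s2(36 := expr_val (Reg 24) s2)) (50 * Suc d + 30) [] s5"
        using a4 s2(2) by (simp add: s3_def)
    qed (use s2(2) fit[OF x] V1 in \<open>simp_all del: val_size.simps\<close>)
    have a2: "runs orc V (Seq (compute_elem dual) (Seq (Assign 36 (Reg 24)) (Seq conv (Assign 23 (MkCell (Reg 35) (Reg 23)))))) s1
        (1100 * (K + h + 1) + 50 * Suc d + 50) [] s5"
      using runs_Seq[OF s2(1) a3 V1(1), of "1100 * (K + h + 1) + 50 * Suc d + 50"] by simp
    have "runs orc V (column_step dual) s' step_cost [] s5"
      unfolding column_step_def
    proof (rule runs_Seq_Assign[where m = "1100 * (K + h + 1) + 50 * Suc d + 50"])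
      show "runs orc V (Seq (compute_elem dual) (Seq (Assign 36 (Reg 24)) (Seq conv (Assign 23 (MkCell (Reg 35) (Reg 23))))))
          (s'(20 := expr_val (Minus (Reg 20) (Const 1)) s')) (1100 * (K + h + 1) + 50 * Suc d + 50) [] s5"
        using a2 regs i'(2) by (simp add: s1_def)
    qed (use regs fitr[of i] V1 in \<open>simp_all add: step_cost_def del: val_size.simps\<close>)
    moreover have "I (Suc i) s5"
      using i(1) r4 frame_upd[OF fr4, of 23] by (simp add: I_def s5_def i'_def)
    ultimately show "expr_val (Reg 20) s' \<noteq> Num 0 \<and> (\<exists>s''. runs orc V (column_step dual) s' step_cost [] s'' \<and> I (Suc i) s'')"
      using regs i(1) by auto
  qed
  then obtain s' where s': "runs orc V (While (Reg 20) (column_step dual)) ?s0 (Suc (N + K + 2) * (step_cost + 10)) [] s'" "I nrows s'"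
    by blast
  have "runs orc V (build_column dual) s col_cost [] s'"
    unfolding build_column_def
  proof (rule runs_Seq_Assign[where m = "Suc (N + K + 2) * (step_cost + 10) + 10"], goal_cases)
    case 2
    show ?case
    proof (rule runs_Seq_Assign[where m = "Suc (N + K + 2) * (step_cost + 10)"], goal_cases)
      case 2
      show ?case using s'(1) r by simp
    qed (use r fitr[of 0] V1 in \<open>simp_all del: val_size.simps\<close>)
  qed (use V1 in \<open>simp_all add: col_cost_def\<close>)
  then show ?thesis using s'(2) by (auto simp: I_def)
qed

lemma run_build_matrix:
  assumes s: "env' s"
  shows "\<exists>s'. runs orc V (build_matrix dual) s mat_cost [] s' \<and> s' 22 = mat_val 0 \<and> frame ({20, 21, 22, 23} \<union> scratch) s s'"
proof -
  have r: "s 12 = Num nrows" "s 13 = Num nothers" using s(1) by (simp_all add: env'_def)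
  define I where "I i s' \<longleftrightarrow> i \<le> nrows + nothers \<and> s' 21 = Num (nrows + nothers - i) \<and> s' 22 = mat_val (nrows + nothers - i) \<and>
    frame ({20, 21, 22, 23} \<union> scratch) s s'" for i s'
  let ?s0 = "s(22 := Num 0, 21 := Num (nrows + nothers))"
  have fitr: "val_size (Num (nrows + nothers - i)) \<le> V" for i
    using total(1) small(6) by (intro fit) (rule le_less_trans[rotated], auto)
  have "\<exists>s'. runs orc V (While (Reg 21) (matrix_step dual)) ?s0 (Suc (N + K + 2) * (col_cost + 30)) [] s' \<and> I (nrows + nothers) s'"
  proof (rule runs_While[where m = "col_cost + 20"])
    show "I 0 ?s0" by (auto simp: I_def mat_val_def intro!: frame_upd frame_refl)
    show "fits V s' (regs (Reg 21))" if "I i s'" for i s'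
      using that fitr[of i] V1 by (simp add: I_def del: val_size.simps)
    show "expr_val (Reg 21) s' = Num 0" if "I (nrows + nothers) s'" for s' using that by (simp add: I_def)
    show "Suc (nrows + nothers) * Suc (work (Reg 21) + (col_cost + 20)) \<le> Suc (N + K + 2) * (col_cost + 30)"
      unfolding total(1) by (intro mult_le_mono) auto
    fix i s' assume i: "i < nrows + nothers" "I i s'"
    define j where "j = nrows + nothers - Suc i"
    have j: "j < nrows + nothers" "nrows + nothers - i = Suc j" using i(1) by (auto simp: j_def)
    have fr: "frame ({20, 21, 22, 23} \<union> scratch) s s'" and regs: "s' 21 = Num (nrows + nothers - i)" "s' 22 = mat_val (nrows + nothers - i)"
      using i by (simp_all add: I_def)
    define s1 where "s1 = s'(21 := Num j)"
    have fr1: "frame ({20, 21, 22, 23} \<union> scratch) s s1" unfolding s1_def by (rule frame_upd[OF fr]) simp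
    have e1: "env' s1" by (rule env'_frame[OF s(1) fr1]) simp
    have r1: "s1 21 = Num j" "s1 22 = mat_val (nrows + nothers - i)" using regs by (simp_all add: s1_def)
    obtain s2 where s2: "runs orc V (build_column dual) s1 col_cost [] s2" "s2 23 = col_val 0 j" "frame ({20, 23} \<union> scratch) s1 s2"
      using run_build_column[OF e1 r1(1) j(1)] by blast
    have fr2: "frame ({20, 21, 22, 23} \<union> scratch) s s2" by (rule frame_trans[OF fr1 s2(3)]) auto
    have r2: "s2 21 = Num j" "s2 22 = mat_val (nrows + nothers - i)" using frameD[OF s2(3)] r1 by simp_all
    define s3 where "s3 = s2(22 := mat_val j)"
    have cons: "Cell (col_val 0 j) (mat_val (nrows + nothers - i)) = mat_val j"
      unfolding j(2) mat_val_def col_val_def using j(1) by (simp add: upt_conv_Cons del: upt_Suc)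
    have a3: "runs orc V (Assign 22 (MkCell (Reg 23) (Reg 22))) s2 10 [] s3"
      using runs_Assign[of V "MkCell (Reg 23) (Reg 22)" s2 10 orc 22] r2 s2(2) cons size_col(2)[OF j(1)] size_mat V1
      by (simp add: s3_def)
    have a2: "runs orc V (Seq (build_column dual) (Assign 22 (MkCell (Reg 23) (Reg 22)))) s1 (col_cost + 11) [] s3"
      using runs_Seq[OF s2(1) a3 V1(1), of "col_cost + 11"] by simp
    have "runs orc V (matrix_step dual) s' (col_cost + 20) [] s3"
      unfolding matrix_step_def
    proof (rule runs_Seq_Assign[where m = "col_cost + 11"])
      show "runs orc V (Seq (build_column dual) (Assign 22 (MkCell (Reg 23) (Reg 22))))
          (s'(21 := expr_val (Minus (Reg 21) (Const 1)) s')) (col_cost + 11) [] s3"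
        using a2 regs j(2) by (simp add: s1_def)
    qed (use regs fitr[of i] V1 in \<open>simp_all del: val_size.simps\<close>)
    moreover have "I (Suc i) s3"
      using i(1) r2 frame_upd[OF fr2, of 22] by (simp add: I_def s3_def j_def)
    ultimately show "expr_val (Reg 21) s' \<noteq> Num 0 \<and> (\<exists>s''. runs orc V (matrix_step dual) s' (col_cost + 20) [] s'' \<and> I (Suc i) s'')"
      using regs i(1) by auto
  qed
  then obtain s' where s': "runs orc V (While (Reg 21) (matrix_step dual)) ?s0 (Suc (N + K + 2) * (col_cost + 30)) [] s'"
      "I (nrows + nothers) s'" by blast
  have "runs orc V (build_matrix dual) s mat_cost [] s'"
    unfolding build_matrix_def
  proof (rule runs_Seq_Assign[where m = "Suc (N + K + 2) * (col_cost + 30) + 10"], goal_cases)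
    case 2
    show ?case
    proof (rule runs_Seq_Assign[where m = "Suc (N + K + 2) * (col_cost + 30)"], goal_cases)
      case 2
      show ?case using s'(1) r by simp
    qed (use r fit[OF total(2)] fit[OF total(3)] V1 in \<open>simp_all del: val_size.simps\<close>)
  qed (use V1 in \<open>simp_all add: mat_cost_def\<close>)
  then show ?thesis using s'(2) by (auto simp: I_def)
qed

text \<open>The program only handles nested lists. This identifies them with the encoding of an
  instance, the only values on which the oracle may be queried.\<close>

lemma enc_query_repr:
  "enc_repr (query_repr dual q g) = Cell (Cell (Num 2) (enc_list Num (trinomial q))) (Cell (Num nrows) (mat_val 0))"
proof -
  have "map list_of_vec (cols (map_mat bits (standard_nat_mat nrows nothers mentry))) =
      map (column 0) [0..<nrows + nothers]"
    by (intro nth_equalityI) (auto simp: column_def standard_nat_mat_def cols_def list_of_vec_map intro!: nth_equalityI)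
  moreover have "query_repr dual q g = bits_repr q nrows nothers mentry"
    by (simp add: query_repr_def nrows_def nothers_def mentry_def)
  ultimately show ?thesis
    by (simp add: bits_repr_def enc_mat_def mat_val_def) (simp add: standard_nat_mat_def)
qed

end

section \<open>The complete program and its two queries\<close>

lemma runs_Assign_eq:
  "fits V s (regs e) \<Longrightarrow> Suc (work e) \<le> m \<Longrightarrow> s' = s(x := expr_val e s) \<Longrightarrow> runs orc V (Assign x e) s m [] s'"
  using runs_Assign by blast

text \<open>
  Registers: 1 graph, 2 \<open>k\<close>, 3 \<open>n\<close>, 4 \<open>h\<close>, 5 \<open>K\<close>, 6 \<open>B\<close>, 7 and 8 the two target sums, 9 the modulus,
  10 \<open>N\<close>, 11 the target sum in use, 12 and 13 the shape of the matrix, 14 and 15 the answers of the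
  oracle, 20 to 23 the loops over rows and columns, 24 to 36 scratch.
\<close>

definition load :: com where
  "load = Seq (Assign 1 (LeftOf (Reg 0))) (Assign 2 (RightOf (Reg 0)))"

definition count_body :: com where
  "count_body = Seq (Assign 3 (Plus (Reg 3) (Const 1))) (Assign 31 (RightOf (Reg 31)))"

definition count_vertices :: com where
  "count_vertices = Seq (Assign 3 (Const 0)) (Seq (Assign 31 (Reg 1)) (While (IsCell (Reg 31)) count_body))"

definition block_size :: com where
  "block_size = Seq (Assign 4 (Const 1)) (While (Less (Reg 4) (Plus (Reg 3) (Const 1))) (Assign 4 (Plus (Reg 4) (Reg 4))))"

definition dimensions :: com where
  "dimensions = Seq (Assign 5 (Times (Reg 2) (Reg 2))) (Seq (Assign 6 (Times (Times (Const 2) (Reg 4)) (Reg 4)))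
    (Assign 10 (Times (Reg 5) (Times (Reg 4) (Reg 4)))))"

definition targets_body :: com where
  "targets_body = Seq (Assign 7 (Times (Reg 7) (Reg 6))) (Seq (Assign 8 (Plus (Times (Reg 8) (Reg 6)) (Const 1)))
    (Assign 33 (Minus (Reg 33) (Const 1))))"

definition targets :: com where
  "targets = Seq (Assign 7 (Const 1)) (Seq (Assign 8 (Const 0)) (Seq (Assign 33 (Reg 5)) (While (Reg 33) targets_body)))"

text \<open>Repeated cubing of 2 passes through the numbers \<open>2 ^ (3 ^ i)\<close>. With
  \<open>y = 2 ^ q\<close> at the end, \<open>y * y + y + 1\<close> is the number whose binary
  digits are the coefficients of the trinomial.\<close>

definition modulus :: com where
  "modulus = Seq (Assign 36 (Const 2)) (Seq
    (While (Less (Reg 36) (Plus (Reg 7) (Const 1))) (Assign 36 (Times (Times (Reg 36) (Reg 36)) (Reg 36))))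
    (Seq (Assign 36 (Plus (Plus (Times (Reg 36) (Reg 36)) (Reg 36)) (Const 1))) (Seq conv (Assign 9 (Reg 35)))))"

definition shape :: "bool \<Rightarrow> com" where
  "shape dual = Seq (Assign 12 (Plus (Reg (if dual then 10 else 5)) (Const 1)))
    (Assign 13 (Plus (Reg (if dual then 5 else 10)) (Const 1)))"

definition setup_regs :: "bool \<Rightarrow> com" where
  "setup_regs dual = Seq load (Seq count_vertices (Seq block_size (Seq dimensions (Seq targets (Seq modulus (shape dual))))))"

definition query_matrix :: "bool \<Rightarrow> nat \<Rightarrow> nat \<Rightarrow> com" where
  "query_matrix dual x y = Seq (Assign 11 (Reg y)) (Seq (build_matrix dual)
    (Query x (MkCell (MkCell (Const 2) (Reg 9)) (MkCell (Reg 12) (Reg 22)))))"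

definition reduction :: "bool \<Rightarrow> com" where
  "reduction dual = Seq (setup_regs dual) (Seq (query_matrix dual 14 8) (Seq (query_matrix dual 15 7)
    (Assign 0 (Minus (Reg 15) (Reg 14)))))"

lemma right_iter_enc_list: "i \<le> length xs \<Longrightarrow> (right_of ^^ i) (enc_list e xs) = enc_list e (drop i xs)"
proof (induction xs arbitrary: i)
  case (Cons x xs)
  then show ?case by (cases i) (auto simp: funpow_Suc_right simp del: funpow.simps)
qed simp

lemma is_cell_enc_list: "is_cell (enc_list e xs) \<longleftrightarrow> xs \<noteq> []"
  by (cases xs) auto

text \<open>The minimality of \<open>m\<close> and \<open>l\<close> fixes the number of rounds of
  the loops for \<open>h\<close> and the modulus. The trinomial has \<open>2 * q + 1\<close>
  coefficients, whence \<open>q_d\<close>.\<close>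

locale main_run = reduction_run n k m E V d + clique_reduction n k m "\<lambda>u v. {u, v} \<in> E" q l
  for n k m E V d q l +
  assumes m_min: "\<And>i. i < m \<Longrightarrow> 2 ^ i \<le> n" and l_min: "\<And>i. i < l \<Longrightarrow> 2 ^ (3 ^ i) \<le> B ^ K"
    and q_d: "2 * q + 1 \<le> d" and n_d: "n + 1 < 2 ^ d"
    and mat_V: "(N + K + 2) * ((N + K + 2) * (3 * d + 2) + 2) + 1 \<le> V"
    and input_V: "val_size (Cell (enc_graph (n, E)) (Num k)) \<le> V"
begin

lemma run_load:
  assumes "s 0 = Cell (enc_graph (n, E)) (Num k)"
  shows "\<exists>s'. runs orc V load s 20 [] s' \<and> s' 1 = enc_graph (n, E) \<and> s' 2 = Num k"
proof -
  let ?s = "s(1 := enc_graph (n, E), 2 := Num k)"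
  have "runs orc V load s 20 [] ?s"
    unfolding load_def
    by (rule runs_Seq_Assign[where m = 10]; (rule runs_Assign_eq)?; use assms input_V V1 in \<open>simp del: val_size.simps\<close>)
  then show ?thesis by (intro exI[of _ ?s]) simp
qed

lemma run_count_vertices:
  assumes s: "s 1 = enc_graph (n, E)"
  shows "\<exists>s'. runs orc V count_vertices s (40 * Suc n) [] s' \<and> s' 3 = Num n \<and> frame {3, 31} s s'"
proof -
  define G where "G = enc_graph (n, E)"
  have G: "is_cell ((right_of ^^ i) G) \<longleftrightarrow> i < n" if "i \<le> n" for i
    using that unfolding G_def enc_graph_def by (auto simp: right_iter_enc_list is_cell_enc_list)
  define I where "I i s' \<longleftrightarrow> i \<le> n \<and> s' 3 = Num i \<and> s' 31 = (right_of ^^ i) G \<and> frame {3, 31} s s'" for i s'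
  have sz: "val_size ((right_of ^^ i) G) \<le> V" for i
    using val_size_right_iter[of i G] graph_size by (simp add: G_def)
  have szn: "val_size (Num i) \<le> V" if "i \<le> n" for i
    using that small(2) by (intro fit) simp
  let ?s0 = "s(3 := Num 0, 31 := G)"
  have "\<exists>s'. runs orc V (While (IsCell (Reg 31)) count_body) ?s0 (30 * Suc n) [] s' \<and> I n s'"
  proof (rule runs_While[where m = 20])
    show "I 0 ?s0" by (simp add: I_def frame_upd frame_refl)
    show "fits V s' (regs (IsCell (Reg 31)))" if "I i s'" for i s'
      using that sz V1 by (simp add: I_def)
    show "expr_val (IsCell (Reg 31)) s' = Num 0" if "I n s'" for s' using that G[of n] by (simp add: I_def)
    fix i s' assume i: "i < n" "I i s'"
    let ?s1 = "s'(3 := Num (Suc i), 31 := (right_of ^^ Suc i) G)"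
    have r: "s' 3 = Num i" "s' 31 = (right_of ^^ i) G" "frame {3, 31} s s'" using i by (simp_all add: I_def)
    have "runs orc V count_body s' 20 [] ?s1"
      unfolding count_body_def
      by (rule runs_Seq_Assign[where m = 5]; (rule runs_Assign_eq)?; use r sz[of i] szn[of i] i V1 in \<open>simp del: val_size.simps\<close>)
    moreover have "I (Suc i) ?s1" using i r by (simp add: I_def frame_upd)
    moreover have "expr_val (IsCell (Reg 31)) s' \<noteq> Num 0" using r G[of i] i by simp
    ultimately show "expr_val (IsCell (Reg 31)) s' \<noteq> Num 0 \<and> (\<exists>s''. runs orc V count_body s' 20 [] s'' \<and> I (Suc i) s'')"
      by blast
  qed simp
  then obtain s' where s': "runs orc V (While (IsCell (Reg 31)) count_body) ?s0 (30 * Suc n) [] s'" "I n s'" by blast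
  have "runs orc V count_vertices s (40 * Suc n) [] s'"
    unfolding count_vertices_def
  proof (rule runs_Seq_Assign[where m = "35 * Suc n"])
    show "runs orc V (Seq (Assign 31 (Reg 1)) (While (IsCell (Reg 31)) count_body)) (s(3 := expr_val (Const 0) s)) (35 * Suc n) [] s'"
    proof (rule runs_Seq_Assign[where m = "30 * Suc n"])
      show "runs orc V (While (IsCell (Reg 31)) count_body)
         ((s(3 := expr_val (Const 0) s))(31 := expr_val (Reg 1) (s(3 := expr_val (Const 0) s)))) (30 * Suc n) [] s'"
        using s'(1) s by (simp add: G_def)
    qed (use s graph_size V1 in simp_all)
  qed (use V1 in simp_all)
  then show ?thesis using s'(2) by (auto simp: I_def)
qed

lemma run_block_size:
  assumes s: "s 3 = Num n"
  shows "\<exists>s'. runs orc V block_size s (40 * Suc m) [] s' \<and> s' 4 = Num h \<and> frame {4} s s'"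
proof -
  define I where "I i s' \<longleftrightarrow> i \<le> m \<and> s' 4 = Num (2 ^ i) \<and> frame {4} s s'" for i s'
  let ?b = "Less (Reg 4) (Plus (Reg 3) (Const 1))"
  have sz: "val_size (Num (2 ^ i)) \<le> V" if "i \<le> m" for i
    using power_increasing[OF that, of "2::nat"] small(3) by (intro fit) (simp add: h_def)
  have szn: "val_size (Num n) \<le> V" by (rule fit[OF small(2)])
  have r3: "s' 3 = Num n" if "frame {4} s s'" for s' using frameD[OF that, of 3] s by simp
  have "\<exists>s'. runs orc V (While ?b (Assign 4 (Plus (Reg 4) (Reg 4)))) (s(4 := Num 1)) (30 * Suc m) [] s' \<and> I m s'"
  proof (rule runs_While[where m = 10])
    show "I 0 (s(4 := Num 1))" by (simp add: I_def frame_upd frame_refl)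
    show "fits V s' (regs ?b)" if "I i s'" for i s'
      using that sz[of i] r3[of s'] szn V1 by (simp add: I_def del: val_size.simps)
    show "expr_val ?b s' = Num 0" if "I m s'" for s' using that r3[of s'] n_less by (simp add: I_def)
    fix i s' assume i: "i < m" "I i s'"
    let ?s1 = "s'(4 := Num (2 ^ Suc i))"
    have r: "s' 4 = Num (2 ^ i)" "frame {4} s s'" using i by (simp_all add: I_def)
    have "runs orc V (Assign 4 (Plus (Reg 4) (Reg 4))) s' 10 [] ?s1"
      by (rule runs_Assign_eq; use r sz[of i] i V1 in \<open>simp add: mult_2 del: val_size.simps\<close>)
    moreover have "I (Suc i) ?s1" using i r by (simp add: I_def frame_upd)
    moreover have "expr_val ?b s' \<noteq> Num 0" using r r3[of s'] m_min[OF i(1)] by simp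
    ultimately show "expr_val ?b s' \<noteq> Num 0 \<and> (\<exists>s''. runs orc V (Assign 4 (Plus (Reg 4) (Reg 4))) s' 10 [] s'' \<and> I (Suc i) s'')"
      by blast
  qed simp
  then obtain s' where s': "runs orc V (While ?b (Assign 4 (Plus (Reg 4) (Reg 4)))) (s(4 := Num 1)) (30 * Suc m) [] s'" "I m s'"
    by blast
  have "runs orc V block_size s (40 * Suc m) [] s'"
    unfolding block_size_def by (rule runs_Seq_Assign[where m = "30 * Suc m"]) (use s'(1) V1 in simp_all)
  then show ?thesis using s'(2) by (auto simp: I_def h_def)
qed

lemma run_dimensions:
  assumes s: "s 1 = enc_graph (n, E)" "s 2 = Num k" "s 3 = Num n" "s 4 = Num h"
  shows "\<exists>s'. runs orc V dimensions s 60 [] s' \<and> env s'"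
proof -
  let ?s = "s(5 := Num K, 6 := Num B, 10 := Num N)"
  have "runs orc V dimensions s 60 [] ?s"
    unfolding dimensions_def
    by (rule runs_Seq_Assign[where m = 40]; (rule runs_Seq_Assign[where m = 20])?; (rule runs_Assign_eq)?;
        use s fit[OF small(1)] fit[OF small(3)] fit[OF small(4)] V1 in \<open>simp add: K_def B_def N_def del: val_size.simps\<close>)
  moreover have "env ?s" using s by (simp add: env_def)
  ultimately show ?thesis by blast
qed

lemma run_targets:
  assumes s: "env s"
  shows "\<exists>s'. runs orc V targets s (90 * Suc K) [] s' \<and> s' 7 = Num (B ^ K) \<and> s' 8 = Num target \<and> frame {7, 8, 33} s s'"
proof -
  define I where "I i s' \<longleftrightarrow> i \<le> K \<and> s' 7 = Num (B ^ i) \<and> s' 8 = Num (\<Sum>b<i. B ^ b) \<and> s' 33 = Num (K - i) \<and>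
    frame {7, 8, 33} s s'" for i s'
  have r: "s 5 = Num K" "s 6 = Num B" using s by (simp_all add: env_def)
  have B1: "1 < B" using one_less_base by (simp add: B_eq)
  have p: "B ^ i < 2 ^ d" if "i \<le> K" for i
  proof -
    have "B ^ i \<le> B ^ K" by (rule power_increasing[OF that]) (use B1 in simp)
    then show ?thesis using small(7) by (rule le_less_trans)
  qed
  have q: "(\<Sum>b<i. B ^ b) < 2 ^ d" if "i \<le> K" for i
    using digit_sum_less[of i "\<lambda>_. 1" B] B1 p[OF that] by simp
  have c: "K - i < 2 ^ d" for i using small(4) by (rule le_less_trans[rotated]) simp
  let ?s0 = "s(7 := Num 1, 8 := Num 0, 33 := Num K)"
  have "\<exists>s'. runs orc V (While (Reg 33) targets_body) ?s0 (70 * Suc K) [] s' \<and> I K s'"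
  proof (rule runs_While[where m = 50])
    show "I 0 ?s0" by (simp add: I_def frame_upd frame_refl)
    show "fits V s' (regs (Reg 33))" if "I i s'" for i s'
      using that fit[OF c[of i]] V1 by (simp add: I_def del: val_size.simps)
    show "expr_val (Reg 33) s' = Num 0" if "I K s'" for s' using that by (simp add: I_def)
    fix i s' assume i: "i < K" "I i s'"
    let ?s1 = "s'(7 := Num (B ^ Suc i), 8 := Num (\<Sum>b<Suc i. B ^ b), 33 := Num (K - Suc i))"
    have rr: "s' 7 = Num (B ^ i)" "s' 8 = Num (\<Sum>b<i. B ^ b)" "s' 33 = Num (K - i)" "frame {7, 8, 33} s s'"
      using i by (simp_all add: I_def)
    then have r6: "s' 6 = Num B" using frameD[OF rr(4), of 6] r by simp
    have eq: "(\<Sum>b<i. B ^ b) * B + 1 = (\<Sum>b<Suc i. B ^ b)"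
      by (simp add: sum.lessThan_Suc_shift sum_distrib_left mult.commute del: sum.lessThan_Suc)
    have "runs orc V targets_body s' 50 [] ?s1"
      unfolding targets_body_def eq[symmetric]
      by (rule runs_Seq_Assign[where m = 40]; (rule runs_Seq_Assign[where m = 20])?; (rule runs_Assign_eq)?;
          use rr r6 fit[OF p[of i]] fit[OF q[of i]] fit[OF c[of i]] fit[OF small(5)] i V1 in \<open>simp add: mult.commute del: val_size.simps\<close>)
    moreover have "I (Suc i) ?s1" using i rr by (simp add: I_def frame_upd)
    ultimately show "expr_val (Reg 33) s' \<noteq> Num 0 \<and> (\<exists>s''. runs orc V targets_body s' 50 [] s'' \<and> I (Suc i) s'')"
      using rr i by auto
  qed simp
  then obtain s' where s': "runs orc V (While (Reg 33) targets_body) ?s0 (70 * Suc K) [] s'" "I K s'" by blast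
  have "runs orc V targets s (90 * Suc K) [] s'"
    unfolding targets_def
  proof (rule runs_Seq_Assign[where m = "70 * Suc K + 14"], goal_cases)
    case 2
    show ?case
    proof (rule runs_Seq_Assign[where m = "70 * Suc K + 7"], goal_cases)
      case 2
      show ?case
        by (rule runs_Seq_Assign[where m = "70 * Suc K"]) (use s'(1) r fit[OF small(4)] V1 in \<open>simp_all del: val_size.simps\<close>)
    qed (use V1 in simp_all)
  qed (use V1 in simp_all)
  then show ?thesis using s'(2) by (auto simp: I_def target_def)
qed

lemma run_modulus:
  assumes s: "s 7 = Num (B ^ K)"
  shows "\<exists>s'. runs orc V modulus s (50 * (l + d) + 200) [] s' \<and> s' 9 = enc_list Num (trinomial q) \<and> frame {9, 35, 36} s s'"
proof -
  define I where "I i s' \<longleftrightarrow> i \<le> l \<and> s' 36 = Num (2 ^ (3 ^ i)) \<and> frame {36} s s'" for i s'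
  let ?b = "Less (Reg 36) (Plus (Reg 7) (Const 1))"
  let ?c = "Assign 36 (Times (Times (Reg 36) (Reg 36)) (Reg 36))"
  have p: "(2::nat) ^ (3 ^ i) < 2 ^ d" if "i \<le> l" for i
  proof (intro power_strict_increasing)
    have "(3::nat) ^ i \<le> 3 ^ l" using that by (intro power_increasing) auto
    then show "3 ^ i < d" using q_d q by linarith
  qed simp
  have r7: "s' 7 = Num (B ^ K)" if "frame {36} s s'" for s' using frameD[OF that, of 7] s by simp
  have "\<exists>s'. runs orc V (While ?b ?c) (s(36 := Num 2)) (50 * Suc l) [] s' \<and> I l s'"
  proof (rule runs_While[where m = 20])
    show "I 0 (s(36 := Num 2))" by (simp add: I_def frame_upd frame_refl)
    show "fits V s' (regs ?b)" if "I i s'" for i s'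
      using that fit[OF p[of i]] r7[of s'] fit[OF small(7)] V1 by (simp add: I_def del: val_size.simps)
    show "expr_val ?b s' = Num 0" if "I l s'" for s' using that r7[of s'] B_less by (simp add: I_def q)
    fix i s' assume i: "i < l" "I i s'"
    let ?s1 = "s'(36 := Num (2 ^ (3 ^ Suc i)))"
    have r: "s' 36 = Num (2 ^ (3 ^ i))" "frame {36} s s'" using i by (simp_all add: I_def)
    have eq: "(2::nat) ^ (3 ^ i) * 2 ^ (3 ^ i) * 2 ^ (3 ^ i) = 2 ^ (3 ^ Suc i)"
      unfolding power_add[symmetric] by (simp add: algebra_simps)
    have "runs orc V ?c s' 20 [] ?s1"
      unfolding eq[symmetric]
      by (rule runs_Assign_eq; use r fit[OF p[of i]] i V1 in \<open>simp del: val_size.simps\<close>)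
    moreover have "I (Suc i) ?s1" using i r by (simp add: I_def frame_upd)
    moreover have "expr_val ?b s' \<noteq> Num 0" using r r7[of s'] l_min[OF i(1)] by simp
    ultimately show "expr_val ?b s' \<noteq> Num 0 \<and> (\<exists>s''. runs orc V ?c s' 20 [] s'' \<and> I (Suc i) s'')"
      by blast
  qed simp
  then obtain s1 where s1: "runs orc V (While ?b ?c) (s(36 := Num 2)) (50 * Suc l) [] s1" "I l s1" by blast
  have r36: "s1 36 = Num (2 ^ q)" and fr1: "frame {36} s s1" using s1(2) by (simp_all add: I_def q)
  define x :: nat where "x = 2 ^ (2 * q) + 2 ^ q + 1"
  have eq: "(2::nat) ^ q * 2 ^ q + 2 ^ q + 1 = x" by (simp add: x_def mult_2 power_add)
  have x: "x < 2 ^ d"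
  proof -
    have "floorlog 2 x = Suc (2 * q)" using length_trinomial[OF q_pos] by (simp add: length_bits x_def)
    then have "x < 2 ^ Suc (2 * q)" using less_power_floorlog[of x] by simp
    also have "\<dots> \<le> (2::nat) ^ d" using q_d by (intro power_increasing) auto
    finally show ?thesis .
  qed
  define s2 where "s2 = s1(36 := Num x)"
  obtain s3 where s3: "runs orc V conv s2 (50 * Suc d) [] s3" "s3 35 = enc_list Num (bits x)" "frame {35, 36} s2 s3"
    using run_conv[of s2 x d V orc] x d_V by (auto simp: s2_def)
  let ?s4 = "s3(9 := enc_list Num (trinomial q))"
  have "val_size (s3 35) \<le> V"
    using val_size_enc_bits[OF set_bits, of x] length_bits_le[OF x] d_V s3(2) by simp
  then have a4: "runs orc V (Assign 9 (Reg 35)) s3 5 [] ?s4"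
    by (intro runs_Assign_eq) (use s3(2) V1 in \<open>simp_all add: trinomial_def x_def\<close>)
  have a3: "runs orc V (Seq conv (Assign 9 (Reg 35))) s2 (50 * Suc d + 10) [] ?s4"
    using runs_Seq[OF s3(1) a4 V1(1), of "50 * Suc d + 10"] by simp
  have a2: "runs orc V (Seq (Assign 36 (Plus (Plus (Times (Reg 36) (Reg 36)) (Reg 36)) (Const 1))) (Seq conv (Assign 9 (Reg 35)))) s1
      (50 * Suc d + 50) [] ?s4"
  proof (rule runs_Seq_Assign[where m = "50 * Suc d + 10"])
    show "runs orc V (Seq conv (Assign 9 (Reg 35)))
        (s1(36 := expr_val (Plus (Plus (Times (Reg 36) (Reg 36)) (Reg 36)) (Const 1)) s1)) (50 * Suc d + 10) [] ?s4"
      using a3 r36 eq by (simp add: s2_def)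
  qed (use r36 fit[OF p[of l]] V1 in \<open>simp_all add: q del: val_size.simps\<close>)
  have a1: "runs orc V (Seq (While ?b ?c) (Seq (Assign 36 (Plus (Plus (Times (Reg 36) (Reg 36)) (Reg 36)) (Const 1)))
      (Seq conv (Assign 9 (Reg 35))))) (s(36 := Num 2)) (50 * (l + d) + 160) [] ?s4"
    using runs_Seq[OF s1(1) a2 V1(1), of "50 * (l + d) + 160"] by simp
  have "runs orc V modulus s (50 * (l + d) + 200) [] ?s4"
    unfolding modulus_def by (rule runs_Seq_Assign[where m = "50 * (l + d) + 160"]) (use a1 V1 in simp_all)
  moreover have "frame {9, 35, 36} s ?s4"
  proof -
    have "frame {36} s s2" unfolding s2_def by (rule frame_upd[OF fr1]) simp
    then have "frame {9, 35, 36} s s3" using s3(3) by (rule frame_trans) auto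
    then show ?thesis by (rule frame_upd) simp
  qed
  ultimately show ?thesis by (intro exI[of _ ?s4]) simp
qed

lemma run_setup:
  assumes s: "s 0 = Cell (enc_graph (n, E)) (Num k)"
  shows "\<exists>s'. runs orc V (setup_regs dual) s (90 * (n + m + K + l + d) + 800) [] s' \<and> env s' \<and>
    s' 7 = Num (B ^ K) \<and> s' 8 = Num target \<and> s' 9 = enc_list Num (trinomial q) \<and>
    s' 12 = Num (if dual then Suc N else Suc K) \<and> s' 13 = Num (if dual then Suc K else Suc N)"
proof -
  obtain s1 where s1: "runs orc V load s 20 [] s1" "s1 1 = enc_graph (n, E)" "s1 2 = Num k"
    using run_load[of s orc] s by blast
  obtain s2 where s2: "runs orc V count_vertices s1 (40 * Suc n) [] s2" "s2 3 = Num n" "frame {3, 31} s1 s2"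
    using run_count_vertices[where s = s1, OF s1(2)] by blast
  have r2: "s2 1 = enc_graph (n, E)" "s2 2 = Num k" using frameD[OF s2(3)] s1 by simp_all
  obtain s3 where s3: "runs orc V block_size s2 (40 * Suc m) [] s3" "s3 4 = Num h" "frame {4} s2 s3"
    using run_block_size[where s = s2, OF s2(2)] by blast
  have r3: "s3 1 = enc_graph (n, E)" "s3 2 = Num k" "s3 3 = Num n" using frameD[OF s3(3)] r2 s2(2) by simp_all
  obtain s4 where s4: "runs orc V dimensions s3 60 [] s4" "env s4"
    using run_dimensions[where s = s3, OF r3 s3(2)] by blast
  obtain s5 where s5: "runs orc V targets s4 (90 * Suc K) [] s5" "s5 7 = Num (B ^ K)" "s5 8 = Num target" "frame {7, 8, 33} s4 s5"
    using run_targets[OF s4(2)] by blast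
  have e5: "env s5" by (rule env_frame[OF s4(2) s5(4)]) simp
  obtain s6 where s6: "runs orc V modulus s5 (50 * (l + d) + 200) [] s6" "s6 9 = enc_list Num (trinomial q)" "frame {9, 35, 36} s5 s6"
    using run_modulus[where s = s5, OF s5(2)] by blast
  have e6: "env s6" by (rule env_frame[OF e5 s6(3)]) simp
  have r6: "s6 7 = Num (B ^ K)" "s6 8 = Num target" using frameD[OF s6(3)] s5 by simp_all
  let ?s7 = "s6(12 := Num (if dual then Suc N else Suc K), 13 := Num (if dual then Suc K else Suc N))"
  have r56: "s6 5 = Num K" "s6 10 = Num N" using e6 by (simp_all add: env_def)
  have "runs orc V (shape dual) s6 30 [] ?s7"
    unfolding shape_def
    by (cases dual) (rule runs_Seq_Assign[where m = 10]; (rule runs_Assign_eq)?;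
      use r56 env_sizes[OF e6] V1 in \<open>simp del: val_size.simps\<close>)+
  note chain = runs_Seq[OF s1(1) runs_Seq[OF s2(1) runs_Seq[OF s3(1) runs_Seq[OF s4(1) runs_Seq[OF s5(1)
    runs_Seq[OF s6(1) this V1(1) order_refl] V1(1) order_refl] V1(1) order_refl] V1(1) order_refl] V1(1) order_refl] V1(1)]
  have "runs orc V (setup_regs dual) s (90 * (n + m + K + l + d) + 800) [] ?s7"
    unfolding setup_regs_def using chain[of "90 * (n + m + K + l + d) + 800"] by simp
  moreover have "env ?s7" using e6 by (simp add: env_def)
  ultimately show ?thesis using r6 s6(2) by (intro exI[of _ ?s7]) simp
qed

text \<open>Bases are subsets of the ground set. This crude bound shows that the answers of the
  oracle have few enough bits to fit into \<open>V\<close>.\<close>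

lemma card_bases_less:
  assumes "g < 2 ^ (2 * q)"
  shows "count_bases dual g < 2 ^ (N + K + 3)"
proof -
  have "matroid (ground_set (query_repr dual q g)) (indep_sets (query_repr dual q g))"
    by (rule matroid_indep_sets[OF query_repr_props(1)[OF assms]])
  then have "bases (indep_sets (query_repr dual q g)) \<subseteq> Pow (ground_set (query_repr dual q g))"
    by (auto simp: matroid_def bases_def)
  moreover have "ground_set (query_repr dual q g) = {..<N + K + 2}"
    by (auto simp: query_repr_def bits_repr_def standard_nat_mat_def)
  ultimately have "count_bases dual g \<le> card (Pow {..<N + K + 2})"
    by (intro card_mono) auto
  also have "\<dots> = 2 ^ (N + K + 2)" by (simp only: card_Pow finite_lessThan card_lessThan)
  also have "\<dots> < 2 ^ (N + K + 3)" by (intro power_strict_increasing) auto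
  finally show ?thesis .
qed

lemma run_query:
  assumes s: "env s" "s y = Num g" "s 9 = enc_list Num (trinomial q)"
      "s 12 = Num (if dual then Suc N else Suc K)" "s 13 = Num (if dual then Suc K else Suc N)"
    and g: "g < 2 ^ q" and orc: "orc (enc_repr (query_repr dual q g)) = count_bases dual g"
  shows "\<exists>s'. runs orc V (query_matrix dual x y) s (matrix_run.mat_cost k m d + 40) [enc_repr (query_repr dual q g)] s' \<and>
    s' x = Num (count_bases dual g) \<and>
    frame ({x, 11, 20, 21, 22, 23} \<union> scratch) s s'"
proof -
  have gd: "g < 2 ^ d" using g power_increasing[of q d "2::nat"] q_d by linarith
  have g2: "g < 2 ^ (2 * q)" using g power_increasing[of q "2 * q" "2::nat"] by linarith
  interpret M: matrix_run n k m E V d dual g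
    by unfold_locales (use gd mat_V in auto)
  define s1 where "s1 = s(11 := Num g)"
  have e1: "M.env' s1" using s by (simp add: M.env'_def s1_def env_def M.nrows_def M.nothers_def)
  obtain s2 where s2: "runs orc V (build_matrix dual) s1 M.mat_cost [] s2" "s2 22 = M.mat_val 0"
      "frame ({20, 21, 22, 23} \<union> scratch) s1 s2"
    using M.run_build_matrix[OF e1] by blast
  have e2: "M.env' s2" by (rule M.env'_frame[OF e1 s2(3)]) simp
  have r2: "s2 9 = enc_list Num (trinomial q)" "s2 12 = Num M.nrows"
    using frameD[OF s2(3), of 9] s(3) e2 by (simp_all add: s1_def M.env'_def)
  let ?e = "MkCell (MkCell (Const 2) (Reg 9)) (MkCell (Reg 12) (Reg 22))"
  have val: "expr_val ?e s2 = enc_repr (query_repr dual q g)"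
    using r2 s2(2) M.enc_query_repr by simp
  have ans: "val_size (Num (orc (expr_val ?e s2))) \<le> V"
  proof -
    have "N + K + 3 < (N + K + 2) * 2 + 1" by simp
    also have "\<dots> \<le> (N + K + 2) * ((N + K + 2) * (3 * d + 2) + 2) + 1"
      by (intro add_mono mult_le_mono) auto
    finally show ?thesis
      unfolding val orc using card_bases_less[OF g2] mat_V by (intro val_size_Num_le[of _ "N + K + 3"]) auto
  qed
  have sz9: "val_size (s2 9) \<le> V"
  proof -
    have "val_size (enc_list Num (trinomial q)) \<le> 3 * length (trinomial q) + 1"
      unfolding trinomial_def by (rule val_size_enc_bits[OF set_bits])
    then show ?thesis using r2(1) length_trinomial' q_d d_V by simp
  qed
  have "runs orc V (Query x ?e) s2 30 [expr_val ?e s2] (s2(x := Num (orc (expr_val ?e s2))))"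
    by (rule runs_Query[where e = ?e and s = s2 and orc = orc and V = V, OF _ ans]) (use sz9 r2(2) s2(2) M.size_mat[of 0] fit[OF M.total(2)] V1 in \<open>simp_all del: val_size.simps\<close>)
  then have a2: "runs orc V (Query x ?e) s2 30 [enc_repr (query_repr dual q g)]
      (s2(x := Num (count_bases dual g)))"
    unfolding val orc .
  have a1: "runs orc V (Seq (build_matrix dual) (Query x ?e)) s1 (M.mat_cost + 31) [enc_repr (query_repr dual q g)]
      (s2(x := Num (count_bases dual g)))"
    using runs_Seq[OF s2(1) a2 V1(1), of "M.mat_cost + 31"] by simp
  have "runs orc V (query_matrix dual x y) s (M.mat_cost + 40) [enc_repr (query_repr dual q g)]
      (s2(x := Num (count_bases dual g)))"
    unfolding query_matrix_def
    by (rule runs_Seq_Assign[where m = "M.mat_cost + 31"]) (use a1 s(2) fit[OF gd] V1 in \<open>simp_all add: s1_def del: val_size.simps\<close>)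
  moreover have "frame ({x, 11, 20, 21, 22, 23} \<union> scratch) s (s2(x := v))" for v
  proof -
    have "frame {11} s s1" unfolding s1_def by (intro frame_upd frame_refl) simp
    then have "frame ({x, 11, 20, 21, 22, 23} \<union> scratch) s s2" using s2(3) by (rule frame_trans) auto
    then show ?thesis by (rule frame_upd) simp
  qed
  ultimately show ?thesis
    by (intro exI[of _ "s2(x := Num (count_bases dual g))"] conjI fun_upd_same)
qed

lemma run_reduction:
  assumes s: "s 0 = Cell (enc_graph (n, E)) (Num k)"
    and orc: "\<And>g. g < 2 ^ (2 * q) \<Longrightarrow> orc (enc_repr (query_repr dual q g)) = count_bases dual g"
  shows "\<exists>s'. runs orc V (reduction dual) s (90 * (n + m + K + l + d) + 2 * matrix_run.mat_cost k m d + 1000)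
      [enc_repr (query_repr dual q target), enc_repr (query_repr dual q (B ^ K))] s' \<and>
    s' 0 = Num (card (cliques (n, E) k))"
proof -
  have q2: "g < 2 ^ (2 * q)" if "g < 2 ^ q" for g :: nat using that power_increasing[of q "2 * q" "2::nat"] by linarith
  have less: "target < 2 ^ q" "B ^ K < 2 ^ q" using target_less B_less by linarith+
  define C where "C = count_bases dual"
  obtain s1 where s1: "runs orc V (setup_regs dual) s (90 * (n + m + K + l + d) + 800) [] s1" "env s1"
    "s1 7 = Num (B ^ K)" "s1 8 = Num target" "s1 9 = enc_list Num (trinomial q)"
    "s1 12 = Num (if dual then Suc N else Suc K)" "s1 13 = Num (if dual then Suc K else Suc N)"
    using run_setup[where s = s and orc = orc and dual = dual, OF s] by blast
  obtain s2 where s2: "runs orc V (query_matrix dual 14 8) s1 (matrix_run.mat_cost k m d + 40) [enc_repr (query_repr dual q target)] s2"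
    "s2 14 = Num (C target)" "frame ({14, 11, 20, 21, 22, 23} \<union> scratch) s1 s2"
    using run_query[where orc = orc, OF s1(2,4-7) less(1) orc[OF q2[OF less(1)]], of 14] by (auto simp: C_def)
  have e2: "env s2" by (rule env_frame[OF s1(2) s2(3)]) simp
  have r2: "s2 7 = Num (B ^ K)" "s2 9 = enc_list Num (trinomial q)"
    "s2 12 = Num (if dual then Suc N else Suc K)" "s2 13 = Num (if dual then Suc K else Suc N)"
    using frameD[OF s2(3)] s1 by simp_all
  obtain s3 where s3: "runs orc V (query_matrix dual 15 7) s2 (matrix_run.mat_cost k m d + 40) [enc_repr (query_repr dual q (B ^ K))] s3"
    "s3 15 = Num (C (B ^ K))" "frame ({15, 11, 20, 21, 22, 23} \<union> scratch) s2 s3"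
    using run_query[where orc = orc, OF e2 r2 less(2) orc[OF q2[OF less(2)]], of 15] by (auto simp: C_def)
  have r3: "s3 14 = Num (C target)" using frameD[OF s3(3), of 14] s2(2) by simp
  have diff: "C (B ^ K) - C target = card (cliques (n, E) k)"
    unfolding C_def by (rule bases_difference) simp
  have szC: "val_size (Num (C g)) \<le> V" if "g < 2 ^ q" for g
  proof -
    have "N + K + 3 < (N + K + 2) * 2 + 1" by simp
    also have "\<dots> \<le> (N + K + 2) * ((N + K + 2) * (3 * d + 2) + 2) + 1"
      by (intro add_mono mult_le_mono) auto
    finally show ?thesis
      unfolding C_def using card_bases_less[OF q2[OF that]] mat_V by (intro val_size_Num_le[of _ "N + K + 3"]) auto
  qed
  let ?s4 = "s3(0 := Num (card (cliques (n, E) k)))"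
  have a4: "runs orc V (Assign 0 (Minus (Reg 15) (Reg 14))) s3 10 [] ?s4"
    by (rule runs_Assign_eq) (use r3 s3(2) diff szC less V1 in \<open>simp_all del: val_size.simps\<close>)
  have "runs orc V (reduction dual) s (90 * (n + m + K + l + d) + 2 * matrix_run.mat_cost k m d + 1000)
      ([] @ [enc_repr (query_repr dual q target)] @ [enc_repr (query_repr dual q (B ^ K))] @ []) ?s4"
    unfolding reduction_def
    by (rule runs_Seq[OF s1(1) runs_Seq[OF s2(1) runs_Seq[OF s3(1) a4 V1(1) order_refl] V1(1) order_refl] V1(1)]) simp
  then show ?thesis by (intro exI[of _ ?s4]) simp
qed

end

section \<open>The reduction\<close>

lemma computable_expr:
  assumes "\<And>n. expr_val e (init_state (Num n)) = Num (f n)"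
  shows "computable f"
  unfolding computable_def computes_in_def
proof (intro exI allI conjI)
  fix n
  show "exec (\<lambda>_. 0) (Assign 0 e) (init_state (Num n)) (1 + expr_cost e (init_state (Num n))) []
      ((init_state (Num n))(0 := expr_val e (init_state (Num n))))"
    by (rule exec.Assign)
qed (use assms in simp)

fun power_expr :: "nat \<Rightarrow> expr" where
  "power_expr 0 = Const 1"
| "power_expr (Suc i) = Times (Plus (Reg 0) (Const 2)) (power_expr i)"

lemma power_expr_val: "expr_val (power_expr i) (init_state (Num n)) = Num ((n + 2) ^ i)"
  by (induction i) (simp_all add: init_state_def)

lemma computable_polynomial: "computable (\<lambda>k. c * (k + 2) ^ i)"
  by (rule computable_expr[of "Times (Const c) (power_expr i)"]) (simp add: power_expr_val)

lemma computable_square: "computable (\<lambda>k. k * k + 1)"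
  by (rule computable_expr[of "Plus (Times (Reg 0) (Reg 0)) (Const 1)"]) (simp add: init_state_def)

lemma length_less_val_size: "length xs < val_size (enc_list e xs)"
proof (induction xs)
  case (Cons x xs)
  then show ?case using val_size_ge_1[of "e x"] by simp
qed simp

section \<open>Choice of the size parameters and polynomial bounds\<close>

locale reduction_instance =
  fixes n k :: nat and E :: "nat set set"
  assumes graph: "simple_graph (n, E)"
begin

definition "input = Cell (enc_graph (n, E)) (Num k)"
definition "size_in = val_size input"
definition "m = (LEAST i. n < 2 ^ i)"

lemma m_bounds: "n < 2 ^ m" "\<And>i. i < m \<Longrightarrow> 2 ^ i \<le> n"
proof -
  have "n < 2 ^ n" by (rule less_exp)
  then show "n < 2 ^ m" unfolding m_def by (rule LeastI)
  show "2 ^ i \<le> n" if "i < m" for i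
    using not_less_Least[of i "\<lambda>i. n < 2 ^ i"] that by (simp add: m_def not_less)
qed

sublocale clique_items n k m "\<lambda>u v. {u, v} \<in> E"
  by unfold_locales (rule m_bounds(1))

definition "l = (LEAST i. B ^ K < 2 ^ (3 ^ i))"
definition "q = (3::nat) ^ l"
text \<open>A sum of the required bit lengths: \<open>2 * q + 1\<close> for the trinomial,
  \<open>w * K\<close> for \<open>B ^ K\<close>, \<open>K + 2 * m\<close> for \<open>N\<close>,
  crude bounds for \<open>n\<close> and \<open>k\<close>, and some slack.\<close>

definition "d = 2 * q + 1 + w * K + K + 2 * m + n + k + 10"
definition "S = N + K + 2"
definition "V = size_in + (3 * d + 2) + (S * (S * (3 * d + 2) + 2) + 1)"

lemma l_bounds: "B ^ K < 2 ^ (3 ^ l)" "\<And>i. i < l \<Longrightarrow> 2 ^ (3 ^ i) \<le> B ^ K"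
proof -
  \<comment> \<open>The exponent \<open>B ^ K\<close> itself witnesses that the set under
    \<open>LEAST\<close> is nonempty.\<close>
  have "B ^ K < 2 ^ B ^ K" by (rule less_exp)
  also have "\<dots> \<le> (2::nat) ^ 3 ^ (B ^ K)"
    by (intro power_increasing) (auto intro: less_imp_le less_le_trans[OF less_exp power_mono])
  finally have "B ^ K < 2 ^ (3 ^ (B ^ K))" .
  then show "B ^ K < 2 ^ (3 ^ l)" unfolding l_def by (rule LeastI)
  show "2 ^ (3 ^ i) \<le> B ^ K" if "i < l" for i
    using not_less_Least[of i "\<lambda>i. B ^ K < 2 ^ (3 ^ i)"] that by (simp add: l_def not_less)
qed

lemma power_less_d: "x < 2 ^ j \<Longrightarrow> j \<le> d \<Longrightarrow> x < 2 ^ d" for x j :: nat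
  by (erule less_le_trans) (simp add: power_increasing)

sublocale main_run n k m E V d q l
proof unfold_locales
  show "simple_graph (n, E)" by (rule graph)
  show "val_size (enc_graph (n, E)) \<le> V" by (simp add: V_def size_in_def input_def)
  show "3 * d + 2 \<le> V" by (simp add: V_def)
  show "k < 2 ^ d" by (rule power_less_d[OF less_exp]) (simp add: d_def)
  show "n < 2 ^ d" by (rule power_less_d[OF less_exp]) (simp add: d_def)
  show "n + 1 < 2 ^ d" by (rule power_less_d[OF less_exp]) (simp add: d_def)
  show "h < 2 ^ d" by (rule power_less_d[of _ "Suc m"]) (simp_all add: h_def d_def)
  show "K < 2 ^ d" by (rule power_less_d[OF less_exp]) (simp add: d_def)
  show "B < 2 ^ d" by (rule power_less_d[of _ "Suc w"]) (simp_all add: B_eq w_def d_def)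
  show "B ^ K < 2 ^ d"
    unfolding B_eq power_mult[symmetric] by (intro power_strict_increasing) (simp_all add: d_def)
  show "N + K + 2 < 2 ^ d"
  \<comment> \<open>\<open>N = K * (h * h)\<close> is at most \<open>2 ^ K * 2 ^ (2 * m)\<close>;
    the additional 2 in the exponent absorbs \<open>K + 2\<close>.\<close>
  proof (rule power_less_d[of _ "K + 2 * m + 2"])
    have K: "K < 2 ^ K" by (rule less_exp)
    have hh: "h * h = 2 ^ (2 * m)" by (simp add: h_def mult_2 power_add)
    have "(N + K + 2) < 2 ^ K * 2 ^ (2 * m) + 2 ^ K + 2"
      unfolding N_def hh using K by (intro add_le_less_mono add_less_le_mono mult_le_mono1) simp_all
    also have "\<dots> \<le> 2 ^ K * 2 ^ (2 * m) + 2 ^ K * 2 ^ (2 * m) + 2 * (2 ^ K * 2 ^ (2 * m))"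
      by (intro add_mono) simp_all
    finally show "N + K + 2 < 2 ^ (K + 2 * m + 2)" by (simp add: power_add)
  qed (simp add: d_def)
  show "q = 3 ^ l" by (simp add: q_def)
  show "B ^ K < 2 ^ q" using l_bounds(1) by (simp add: q_def)
  show "\<And>i. i < m \<Longrightarrow> 2 ^ i \<le> n" by (rule m_bounds(2))
  show "\<And>i. i < l \<Longrightarrow> 2 ^ 3 ^ i \<le> B ^ K" by (rule l_bounds(2))
  show "2 * q + 1 \<le> d" by (simp add: d_def)
  show "(N + K + 2) * ((N + K + 2) * (3 * d + 2) + 2) + 1 \<le> V" by (simp add: V_def S_def)
  show "val_size (Cell (enc_graph (n, E)) (Num k)) \<le> V" by (simp add: V_def size_in_def input_def)
qed

text \<open>All bounds are powers of this product, which split in the end into a function of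
  \<open>k\<close> and a power of the input size.\<close>

definition "x = (k + 2) * size_in"

lemma x_bounds: "n + 2 \<le> x" "k + 2 \<le> x" "size_in \<le> x"
proof -
  have "n < val_size (enc_graph (n, E))"
    unfolding enc_graph_def using length_less_val_size[of "map (\<lambda>u. map (\<lambda>v. {u, v} \<in> snd (n, E)) [0..<fst (n, E)]) [0..<fst (n, E)]"]
    by simp
  then have s: "n + 2 \<le> size_in" by (simp add: size_in_def input_def)
  also have le: "size_in \<le> x" by (simp add: x_def)
  finally show "n + 2 \<le> x" .
  show "size_in \<le> x" by (rule le)
  have "(k + 2) * 1 \<le> x" unfolding x_def using s by (intro mult_le_mono) auto
  then show "k + 2 \<le> x" by simp
qed

lemma x_powers: "x ^ i \<le> x ^ j" if "i \<le> j"
  using x_bounds(1) that by (intro power_increasing) auto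

text \<open>The minimality of \<open>m\<close> and \<open>l\<close> keeps \<open>h\<close> linear in
  \<open>x\<close> and \<open>q\<close> cubic.\<close>

lemma sizes: "m \<le> x" "K \<le> x ^ 2" "h \<le> 2 * x" "N + K + 2 \<le> 7 * x ^ 4" "w * K \<le> 3 * x ^ 3"
  "q \<le> 10 * x ^ 3" "l \<le> 10 * x ^ 3" "d \<le> 50 * x ^ 3"
proof -
  have x1: "1 \<le> x" using x_bounds by simp
  have p: "x \<le> x ^ 3" "x ^ 2 \<le> x ^ 3" "1 \<le> x ^ 3" "x ^ 2 \<le> x ^ 4" "1 \<le> x ^ 4"
    using x_powers[of 1 3] x_powers[of 2 3] x_powers[of 0 3] x_powers[of 2 4] x_powers[of 0 4] by simp_all
  have "m \<le> n" unfolding m_def by (rule Least_le) (rule less_exp)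
  then show m': "m \<le> x" using x_bounds by simp
  show K': "K \<le> x ^ 2" unfolding K_def power2_eq_square using x_bounds by (intro mult_le_mono) auto
  have "2 ^ m \<le> 2 * x"
  proof (cases m)
    case 0
    then show ?thesis using x1 by simp
  next
    case (Suc i)
    then show ?thesis using m_bounds(2)[of i] x_bounds by simp
  qed
  then show h': "h \<le> 2 * x" by (simp add: h_def)
  have "N \<le> x ^ 2 * ((2 * x) * (2 * x))" unfolding N_def by (intro mult_le_mono K' h')
  also have "\<dots> = 4 * x ^ 4" by (simp add: power2_eq_square power4_eq_xxxx)
  finally show "N + K + 2 \<le> 7 * x ^ 4" using K' p by linarith
  have "w \<le> 3 * x" using m' x1 by (simp add: w_def)
  then have "w * K \<le> 3 * x * x ^ 2" using K' by (rule mult_le_mono)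
  then show wK: "w * K \<le> 3 * x ^ 3" by (simp add: power3_eq_cube power2_eq_square mult.assoc)
  show q': "q \<le> 10 * x ^ 3"
  proof (cases l)
    case 0
    then show ?thesis using p by (simp add: q_def)
  next
    case (Suc i)
    \<comment> \<open>The exponent before the last was too small, so \<open>q = 3 * 3 ^ i\<close> is
      at most three times \<open>w * K\<close>.\<close>
    then have "(2::nat) ^ (3 ^ i) \<le> 2 ^ (w * K)"
      using l_bounds(2)[of i] by (simp add: B_eq power_mult)
    then have "3 ^ i \<le> w * K" by (rule power_le_imp_le_exp[rotated]) simp
    then show ?thesis using wK Suc by (simp add: q_def)
  qed
  have "l < 3 ^ l" by (rule less_le_trans[OF less_exp power_mono]) simp_all
  then show "l \<le> 10 * x ^ 3" using q' by (simp add: q_def)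
  show "d \<le> 50 * x ^ 3"
    unfolding d_def using q' wK K' m' x_bounds(1,2) p by linarith
qed

text \<open>The matrix dominates: at most \<open>S * S\<close> entries, of order
  \<open>x ^ 8\<close>, with \<open>d\<close> bits each, of order \<open>x ^ 3\<close>.\<close>

lemma V_le: "V \<le> 8000 * x ^ 11"
proof -
  have "3 * d + 2 \<le> 152 * x ^ 3" using sizes(8) x_powers[of 0 3] by simp
  have S: "S \<le> 7 * x ^ 4" using sizes(4) by (simp add: S_def)
  have "S * (3 * d + 2) \<le> (7 * x ^ 4) * (152 * x ^ 3)"
    by (intro mult_le_mono S \<open>3 * d + 2 \<le> 152 * x ^ 3\<close>)
  also have "\<dots> = 1064 * x ^ 7" by (simp flip: power_add)
  finally have "S * (3 * d + 2) + 2 \<le> 1066 * x ^ 7" using x_powers[of 0 7] by simp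
  then have "S * (S * (3 * d + 2) + 2) \<le> (7 * x ^ 4) * (1066 * x ^ 7)"
    by (intro mult_le_mono S)
  also have "\<dots> = 7462 * x ^ 11" by (simp flip: power_add)
  finally show ?thesis
    unfolding V_def using \<open>3 * d + 2 \<le> 152 * x ^ 3\<close> x_bounds(3) x_powers[of 0 11] x_powers[of 1 11] x_powers[of 3 11] by simp
qed

text \<open>Building the matrices dominates, with about \<open>x ^ 8\<close> entries at a cost of
  order \<open>x ^ 3\<close> each. The unit is \<open>V\<close>, so the time is of order
  \<open>x ^ 22\<close>.\<close>

lemma cost_le: "90 * (n + m + K + l + d) + 2 * matrix_run.mat_cost k m d + 1000 \<le> 1000000 * x ^ 11"
proof -
  interpret M: matrix_run n k m E V d False 0
    by unfold_locales (use mat_V in auto)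
  have p: "x \<le> x ^ 3" "x ^ 2 \<le> x ^ 3" "1 \<le> x ^ 3" "1 \<le> x ^ 4" "1 \<le> x ^ 7" "1 \<le> x ^ 11" "x ^ 3 \<le> x ^ 11"
    using x_powers[of 1 3] x_powers[of 2 3] x_powers[of 0 3] x_powers[of 0 4] x_powers[of 0 7] x_powers[of 0 11]
      x_powers[of 3 11] by simp_all
  have "K + h + 1 \<le> 4 * x ^ 3" using sizes(2,3) p by linarith
  moreover have "50 * Suc d + 100 \<le> 2650 * x ^ 3" using sizes(8) p by simp
  ultimately have "1100 * (K + h + 1) + (50 * Suc d + 100) \<le> 1100 * (4 * x ^ 3) + 2650 * x ^ 3"
    by (intro add_mono mult_le_mono2)
  then have "M.step_cost \<le> 7100 * x ^ 3"
    unfolding M.step_cost_def by simp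
  then have step: "M.step_cost + 10 \<le> 7110 * x ^ 3" using p by linarith
  have S: "Suc (N + K + 2) \<le> 8 * x ^ 4" using sizes(4) p by linarith
  have "Suc (N + K + 2) * (M.step_cost + 10) \<le> (8 * x ^ 4) * (7110 * x ^ 3)"
    by (rule mult_le_mono[OF S step])
  also have "\<dots> = 56880 * x ^ 7" by (simp flip: power_add)
  finally have col: "M.col_cost + 30 \<le> 56930 * x ^ 7" unfolding M.col_cost_def using p by linarith
  have "Suc (N + K + 2) * (M.col_cost + 30) \<le> (8 * x ^ 4) * (56930 * x ^ 7)"
    by (rule mult_le_mono[OF S col])
  also have "\<dots> = 455440 * x ^ 11" by (simp flip: power_add)
  finally have mat: "M.mat_cost \<le> 455460 * x ^ 11" unfolding M.mat_cost_def using p by linarith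
  have "n + m + K + l + d \<le> 63 * x ^ 3" using sizes(1,2,7,8) x_bounds(1) p by linarith
  then have "n + m + K + l + d \<le> 63 * x ^ 11" using p by linarith
  moreover have "2 * M.mat_cost + 1000 \<le> 920000 * x ^ 11" using mat p by linarith
  ultimately have "90 * (n + m + K + l + d) + (2 * M.mat_cost + 1000) \<le> 90 * (63 * x ^ 11) + 920000 * x ^ 11"
    by (intro add_mono mult_le_mono2)
  then show ?thesis by simp
qed

text \<open>The oracle is trusted only on valid representations of characteristic 2, so the same run
  serves the general problems and the restricted ones.\<close>

lemma reduction_runs:
  assumes orc: "\<And>M. valid_repr M \<Longrightarrow> field_char M = 2 \<Longrightarrow> orc (enc_repr M) = card (bases (indep_sets M))"
  shows "\<exists>t Q. computes_in orc (reduction dual) input (card (cliques (n, E) k)) t Q \<and>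
    t \<le> 8000000000 * (k + 2) ^ 22 * size_in ^ 22 \<and>
    (\<forall>c\<in>set Q. \<exists>M. c = enc_repr M \<and> valid_repr M \<and> field_char M = 2 \<and>
      (if dual then matroid_nullity (ground_set M) (indep_sets M) else matroid_rank (indep_sets M)) = k * k + 1)"
proof -
  have s: "init_state input 0 = Cell (enc_graph (n, E)) (Num k)" by (simp add: init_state_def input_def)
  have orc': "orc (enc_repr (query_repr dual q g)) = count_bases dual g"
    if "g < 2 ^ (2 * q)" for g
    by (rule orc) (rule query_repr_props(1,2)[OF that])+
  obtain s' where s': "runs orc V (reduction dual) (init_state input) (90 * (n + m + K + l + d) + 2 * matrix_run.mat_cost k m d + 1000)
      [enc_repr (query_repr dual q target), enc_repr (query_repr dual q (B ^ K))] s'"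
      "s' 0 = Num (card (cliques (n, E) k))"
    using run_reduction[where s = "init_state input" and orc = orc, OF s orc'] by blast
  obtain t where t: "exec orc (reduction dual) (init_state input) t
      [enc_repr (query_repr dual q target), enc_repr (query_repr dual q (B ^ K))] s'"
    "t \<le> (90 * (n + m + K + l + d) + 2 * matrix_run.mat_cost k m d + 1000) * V"
    using s'(1) unfolding runs_def by blast
  note t(2)
  also have "(90 * (n + m + K + l + d) + 2 * matrix_run.mat_cost k m d + 1000) * V \<le> (1000000 * x ^ 11) * (8000 * x ^ 11)"
    by (rule mult_le_mono[OF cost_le V_le])
  also have "\<dots> = 8000000000 * x ^ 22" by (simp flip: power_add)
  finally have time: "t \<le> 8000000000 * (k + 2) ^ 22 * size_in ^ 22"
    unfolding x_def power_mult_distrib mult.assoc .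
  have "\<exists>M. c = enc_repr M \<and> valid_repr M \<and> field_char M = 2 \<and>
      (if dual then matroid_nullity (ground_set M) (indep_sets M) else matroid_rank (indep_sets M)) = k * k + 1"
    if c: "c = enc_repr (query_repr dual q g)" and g: "g < 2 ^ (2 * q)" for c g
    using c query_repr_props(1-4)[OF g, of dual] by (intro exI[of _ "query_repr dual q g"]) (simp add: K_def)
  moreover have "target < 2 ^ (2 * q)" "B ^ K < 2 ^ (2 * q)" using target_less bound_less by linarith+
  ultimately show ?thesis
    using t(1) s'(2) time unfolding computes_in_def
    by (intro exI[of _ t] exI[of _ "[enc_repr (query_repr dual q target), enc_repr (query_repr dual q (B ^ K))]"]) auto
qed

end

text \<open>The hypotheses only ask \<open>P\<close> to contain the instances of characteristic 2.
  They hold for each counting problem and for its restriction, which yields all four claims.\<close>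

lemma reduction_fpt:
  assumes enc: "encode P = enc_repr" and sol: "solution P = (\<lambda>M. card (bases (indep_sets M)))"
    and inst: "\<And>M. valid_repr M \<Longrightarrow> field_char M = 2 \<Longrightarrow> M \<in> instances P"
    and par: "\<And>M. parameter P M =
      (if dual then matroid_nullity (ground_set M) (indep_sets M) else matroid_rank (indep_sets M))"
  shows "fpt_turing_reduction (reduction dual) clique_problem P"
  unfolding fpt_turing_reduction_def
proof (rule exI[of _ "\<lambda>k. 8000000000 * (k + 2) ^ 22"], rule exI[of _ "\<lambda>k. k * k + 1"], rule exI[of _ 22],
    intro conjI ballI)
  show "computable (\<lambda>k. 8000000000 * (k + 2) ^ 22)" by (rule computable_polynomial)
  show "computable (\<lambda>k. k * k + 1)" by (rule computable_square)
  have orc: "oracle_for P (enc_repr M) = card (bases (indep_sets M))" if "valid_repr M" "field_char M = 2" for M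
    using the_inv_into_f_f[OF inj_on_subset[OF inj_enc_repr subset_UNIV] inst[OF that]]
    by (simp add: oracle_for_def enc sol)
  fix i assume "i \<in> instances clique_problem"
  then obtain n E k where i: "i = ((n, E), k)" and graph: "simple_graph (n, E)"
    by (cases i; cases "fst i") (auto simp: clique_problem_def)
  interpret reduction_instance n k E by unfold_locales (rule graph)
  have prob: "encode clique_problem i = input" "solution clique_problem i = card (cliques (n, E) k)"
    "parameter clique_problem i = k"
    by (simp_all add: clique_problem_def i input_def)
  obtain t Q where tQ: "computes_in (oracle_for P) (reduction dual) input (card (cliques (n, E) k)) t Q"
    "t \<le> 8000000000 * (k + 2) ^ 22 * size_in ^ 22"
    "\<And>c. c \<in> set Q \<Longrightarrow> \<exists>M. c = enc_repr M \<and> valid_repr M \<and> field_char M = 2 \<and>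
      (if dual then matroid_nullity (ground_set M) (indep_sets M) else matroid_rank (indep_sets M)) = k * k + 1"
    using reduction_runs[of "oracle_for P" dual, OF orc] by blast
  have "\<exists>j\<in>instances P. c = encode P j \<and> parameter P j \<le> k * k + 1" if "c \<in> set Q" for c
    using tQ(3)[OF that] inst unfolding enc par by (metis order_refl)
  then show "\<exists>t Q. computes_in (oracle_for P) (reduction dual) (encode clique_problem i) (solution clique_problem i) t Q \<and>
      t \<le> 8000000000 * (parameter clique_problem i + 2) ^ 22 * val_size (encode clique_problem i) ^ 22 \<and>
      (\<forall>c\<in>set Q. \<exists>j\<in>instances P. c = encode P j \<and> parameter P j \<le> parameter clique_problem i * parameter clique_problem i + 1)"
    unfolding prob using tQ(1,2) unfolding size_in_def by blast
qed

theorem theorem4: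
  shows "sharp_W1_hard rank_bases \<and> sharp_W1_hard nullity_bases \<and>
    sharp_W1_hard (restrict_to rank_bases {M. field_char M = 2}) \<and>
    sharp_W1_hard (restrict_to nullity_bases {M. field_char M = 2})"
  unfolding sharp_W1_hard_def
proof (intro conjI exI)
  show "fpt_turing_reduction (reduction False) clique_problem rank_bases"
    by (rule reduction_fpt) (auto simp: rank_bases_def)
  show "fpt_turing_reduction (reduction True) clique_problem nullity_bases"
    by (rule reduction_fpt) (auto simp: nullity_bases_def)
  show "fpt_turing_reduction (reduction False) clique_problem (restrict_to rank_bases {M. field_char M = 2})"
    by (rule reduction_fpt) (auto simp: rank_bases_def restrict_to_def)
  show "fpt_turing_reduction (reduction True) clique_problem (restrict_to nullity_bases {M. field_char M = 2})"
    by (rule reduction_fpt) (auto simp: nullity_bases_def restrict_to_def)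
qed

end
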